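(* Let $n,k\ge1$ and let $H=\sum_{P\in\{I,X,Y,Z\}^{\otimes n}:|P|\le k}\alpha_P P$ be an $n$-qubit $k$-local Hamiltonian, $\alpha_P\in\mathbb{R}$. There is a randomized algorithm that runs in time $\mathcal{O}(n^k)$ and produces a random product state $|\psi\rangle=|\psi_1\rangle\otimes\cdots\otimes|\psi_n\rangle$ with $$\left|\mathbb{E}_{|\psi\rangle}\big[\langle\psi|H|\psi\rangle\big]-\mathbb{E}_{|\phi\rangle:\mathrm{Haar}}\big[\langle\phi|H|\phi\rangle\big]\right|\ge C(k)\left(\sum_{P\ne I}|\alpha_P|^{2k/(k+1)}\right)^{(k+1)/(2k)},$$ where $$C(k)=\frac{\sqrt{2(k!)}}{2\,k^{\,k+1.5+(k+1)/(2k)}\,(\sqrt6+2\sqrt3)^k}.$$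
   Context: $\{I,X,Y,Z\}^{\otimes n}$ is the set of $n$-qubit Pauli observables $P=P_1\otimes\cdots\otimes P_n$; $|P|$ is the number of $i$ with $P_i\neq I$; "$P\ne I$" means $P\neq I^{\otimes n}$. The Haar expectation is over Haar-random $n$-qubit pure states $|\phi\rangle$. The input of the algorithm is the list of coefficients $\alpha_P$, and $\mathbb{E}_{|\psi\rangle}$ is over the algorithm's randomness; the inequality means the output is either, in expectation, above the Haar average or below it by the stated margin, without control over which. *)

theory Defs
  imports
    "HOL-Probability.Probability"
    "HOL-Library.Landau_Symbols"
    "Jordan_Normal_Form.Schur_Decomposition"
begin

hide_const (open) Finite_Cartesian_Product.vec Finite_Cartesian_Product.mat
hide_type (open) Finite_Cartesian_Product.vec
unbundle no vec_syntax

section \<open>Pauli observables, local Hamiltonians and product states\<close>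

datatype pauli = PI | PX | PY | PZ

fun pauli_mat :: "pauli \<Rightarrow> complex mat" where
  "pauli_mat PI = mat_of_rows_list 2 [[1, 0], [0, 1]]"
| "pauli_mat PX = mat_of_rows_list 2 [[0, 1], [1, 0]]"
| "pauli_mat PY = mat_of_rows_list 2 [[0, - \<i>], [\<i>, 0]]"
| "pauli_mat PZ = mat_of_rows_list 2 [[1, 0], [0, - 1]]"

definition kron_mat :: "complex mat \<Rightarrow> complex mat \<Rightarrow> complex mat" where
  "kron_mat A B = mat (dim_row A * dim_row B) (dim_col A * dim_col B)
     (\<lambda>(i, j). A $$ (i div dim_row B, j div dim_col B) * B $$ (i mod dim_row B, j mod dim_col B))"

definition kron_vec :: "complex vec \<Rightarrow> complex vec \<Rightarrow> complex vec" where
  "kron_vec v w = vec (dim_vec v * dim_vec w) (\<lambda>i. v $ (i div dim_vec w) * w $ (i mod dim_vec w))"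

definition tensor_mats :: "complex mat list \<Rightarrow> complex mat" where
  "tensor_mats As = foldr kron_mat As (1\<^sub>m 1)"

definition tensor_vecs :: "complex vec list \<Rightarrow> complex vec" where
  "tensor_vecs vs = foldr kron_vec vs (vec 1 (\<lambda>_. 1))"

text \<open>An \<open>n\<close>-qubit Pauli observable is represented by the list of its \<open>n\<close> tensor factors.\<close>

definition pauli_op :: "pauli list \<Rightarrow> complex mat" where
  "pauli_op P = tensor_mats (map pauli_mat P)"

definition pauli_support :: "pauli list \<Rightarrow> nat list" where
  "pauli_support P = filter (\<lambda>i. P ! i \<noteq> PI) [0..<length P]"

definition pauli_weight :: "pauli list \<Rightarrow> nat" where
  "pauli_weight P = length (pauli_support P)"

definition local_paulis :: "nat \<Rightarrow> nat \<Rightarrow> pauli list set" where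
  "local_paulis k n = {P. length P = n \<and> pauli_weight P \<le> k}"

definition hamiltonian :: "nat \<Rightarrow> nat \<Rightarrow> (pauli list \<Rightarrow> real) \<Rightarrow> complex mat" where
  "hamiltonian k n \<alpha> = mat (2 ^ n) (2 ^ n)
     (\<lambda>ij. \<Sum>P\<in>local_paulis k n. complex_of_real (\<alpha> P) * pauli_op P $$ ij)"

text \<open>The quadratic form is real for Hermitian \<open>H\<close>; \<^const>\<open>Re\<close> only adjusts the type.\<close>

definition energy :: "complex mat \<Rightarrow> complex vec \<Rightarrow> real" where
  "energy H \<psi> = Re ((H *\<^sub>v \<psi>) \<bullet>c \<psi>)"

section \<open>Haar-random pure states\<close>

definition pure_states :: "nat \<Rightarrow> complex vec set" where
  "pure_states n = {\<phi> \<in> carrier_vec (2 ^ n). \<phi> \<bullet>c \<phi> = 1}"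

text \<open>
  The Haar measure on state vectors is the unitarily invariant Borel probability measure on the
  unit sphere of the \<open>2 ^ n\<close>-dimensional space. The type of vectors carries no topology, so the
  Borel sets are the ones induced by the coordinate map into the finite power of the complex
  numbers.
\<close>

definition is_haar_measure :: "nat \<Rightarrow> complex vec measure \<Rightarrow> bool" where
  "is_haar_measure n \<mu> \<longleftrightarrow>
     prob_space \<mu> \<and>
     sets \<mu> = sets (vimage_algebra (pure_states n)
       (\<lambda>\<phi>. \<lambda>i\<in>{..<2 ^ n}. \<phi> $ i) (\<Pi>\<^sub>M i\<in>{..<2 ^ n}. (borel :: complex measure))) \<and>
     (\<forall>U\<in>carrier_mat (2 ^ n) (2 ^ n). mat_adjoint U * U = 1\<^sub>m (2 ^ n) \<longrightarrow>
        distr \<mu> \<mu> (\<lambda>\<phi>. U *\<^sub>v \<phi>) = \<mu>)"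

section \<open>Randomized algorithms on a real RAM\<close>

text \<open>
  Programs work on finitely many statically named arrays of natural numbers and of real numbers.
  Real arithmetic is exact and consists of the field operations, roots of fixed order and
  comparisons; there is no conversion (such as rounding) from reals to natural numbers, and no
  real constants other than those obtained from natural numbers. Randomness is given by Bernoulli
  trials. A step evaluates the expressions of one command, whose size is fixed by the program, so
  counting steps is unit-cost time up to a constant factor depending only on the program.
\<close>

datatype iexp = IConst nat | IRead nat iexp | IAdd iexp iexp | ISub iexp iexp | IMul iexp iexp

datatype rexp = OfNat iexp | RRead nat iexp | RAdd rexp rexp | RSub rexp rexp | RMul rexp rexp
  | RDiv rexp rexp | RRoot nat rexp

datatype bexp = ILess iexp iexp | RLess rexp rexp | BNot bexp | BAnd bexp bexp

datatype com =
    Skip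
  | IAssign nat iexp iexp
  | RAssign nat iexp rexp
  | Flip nat iexp rexp
  | Seq com com
  | Cond bexp com com
  | While bexp com

record store =
  ints :: "nat \<Rightarrow> nat \<Rightarrow> nat"
  reals :: "nat \<Rightarrow> nat \<Rightarrow> real"

definition set_int :: "nat \<Rightarrow> nat \<Rightarrow> nat \<Rightarrow> store \<Rightarrow> store" where
  "set_int a i v s = s\<lparr>ints := (ints s)(a := (ints s a)(i := v))\<rparr>"

definition set_real :: "nat \<Rightarrow> nat \<Rightarrow> real \<Rightarrow> store \<Rightarrow> store" where
  "set_real a i v s = s\<lparr>reals := (reals s)(a := (reals s a)(i := v))\<rparr>"

primrec ival :: "iexp \<Rightarrow> store \<Rightarrow> nat" where
  "ival (IConst c) s = c"
| "ival (IRead a e) s = ints s a (ival e s)"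
| "ival (IAdd e f) s = ival e s + ival f s"
| "ival (ISub e f) s = ival e s - ival f s"
| "ival (IMul e f) s = ival e s * ival f s"

primrec rval :: "rexp \<Rightarrow> store \<Rightarrow> real" where
  "rval (OfNat e) s = real (ival e s)"
| "rval (RRead a e) s = reals s a (ival e s)"
| "rval (RAdd e f) s = rval e s + rval f s"
| "rval (RSub e f) s = rval e s - rval f s"
| "rval (RMul e f) s = rval e s * rval f s"
| "rval (RDiv e f) s = rval e s / rval f s"
| "rval (RRoot m e) s = root m (rval e s)"

primrec bval :: "bexp \<Rightarrow> store \<Rightarrow> bool" where
  "bval (ILess e f) s \<longleftrightarrow> ival e s < ival f s"
| "bval (RLess e f) s \<longleftrightarrow> rval e s < rval f s"
| "bval (BNot b) s \<longleftrightarrow> \<not> bval b s"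
| "bval (BAnd b c) s \<longleftrightarrow> bval b s \<and> bval c s"

text \<open>
  \<^const>\<open>Flip\<close> stores the outcome (0 or 1) of a coin whose bias is the value of the real
  expression, clamped to the unit interval by \<^const>\<open>bernoulli_pmf\<close>. A halted configuration is one
  whose remaining command is \<^const>\<open>Skip\<close>.
\<close>

primrec step :: "com \<Rightarrow> store \<Rightarrow> (com \<times> store) pmf" where
  "step Skip s = return_pmf (Skip, s)"
| "step (IAssign a i e) s = return_pmf (Skip, set_int a (ival i s) (ival e s) s)"
| "step (RAssign a i e) s = return_pmf (Skip, set_real a (ival i s) (rval e s) s)"
| "step (Flip a i e) s =
     map_pmf (\<lambda>b. (Skip, set_int a (ival i s) (if b then 1 else 0) s)) (bernoulli_pmf (rval e s))"
| "step (Seq c d) s =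
     (if c = Skip then return_pmf (d, s) else map_pmf (\<lambda>(c', s'). (Seq c' d, s')) (step c s))"
| "step (Cond b c d) s = return_pmf (if bval b s then c else d, s)"
| "step (While b c) s = return_pmf (Cond b (Seq c (While b c)) Skip, s)"

primrec run :: "nat \<Rightarrow> com \<Rightarrow> store \<Rightarrow> (com \<times> store) pmf" where
  "run 0 c s = return_pmf (c, s)"
| "run (Suc t) c s = bind_pmf (run t c s) (\<lambda>(c', s'). step c' s')"

definition halts_within :: "nat \<Rightarrow> com \<Rightarrow> store \<Rightarrow> bool" where
  "halts_within t c s \<longleftrightarrow> (\<forall>(c', s')\<in>set_pmf (run t c s). c' = Skip)"

definition final_store :: "nat \<Rightarrow> com \<Rightarrow> store \<Rightarrow> store pmf" where
  "final_store t c s = map_pmf snd (run t c s)"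

section \<open>Input and output conventions\<close>

definition list_array :: "'a::zero list \<Rightarrow> nat \<Rightarrow> 'a" where
  "list_array xs i = (if i < length xs then xs ! i else 0)"

fun pauli_code :: "pauli \<Rightarrow> nat" where
  "pauli_code PI = 0"
| "pauli_code PX = 1"
| "pauli_code PY = 2"
| "pauli_code PZ = 3"

text \<open>
  The input is the number of qubits and the list of coefficients, in an arbitrary order \<open>Ps\<close> of the
  Pauli observables, each one accompanied by a sparse description of its observable. Entry \<open>j\<close> of
  the arrays describes the term \<open>Ps ! j\<close>: its coefficient is in real array 0, its weight in integer
  array 1, and for each \<open>r\<close> below the weight, the position and the letter of its \<open>r\<close>-th
  non-identity factor are in integer arrays \<open>2 * r + 2\<close> and \<open>2 * r + 3\<close>. Integer array 0 contains
  the number of qubits and the number of terms. All other memory is zero.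
\<close>

definition position_entry :: "nat \<Rightarrow> pauli list \<Rightarrow> nat" where
  "position_entry r P = (if r < pauli_weight P then pauli_support P ! r else 0)"

definition letter_entry :: "nat \<Rightarrow> pauli list \<Rightarrow> nat" where
  "letter_entry r P = (if r < pauli_weight P then pauli_code (P ! (pauli_support P ! r)) else 0)"

definition input_store :: "nat \<Rightarrow> pauli list list \<Rightarrow> (pauli list \<Rightarrow> real) \<Rightarrow> store" where
  "input_store n Ps \<alpha> =
     \<lparr>ints = (\<lambda>a. list_array
        (if a = 0 then [n, length Ps]
         else if a = 1 then map pauli_weight Ps
         else if even a then map (position_entry ((a - 2) div 2)) Ps
         else map (letter_entry ((a - 2) div 2)) Ps)),
      reals = (\<lambda>a. list_array (if a = 0 then map \<alpha> Ps else []))\<rparr>"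

text \<open>
  The output is read from real arrays 1 to 4: their entries at \<open>i\<close> are the real and imaginary parts
  of the two amplitudes of qubit \<open>i\<close>.
\<close>

definition output_qubit :: "store \<Rightarrow> nat \<Rightarrow> complex vec" where
  "output_qubit s i =
     vec_of_list [Complex (reals s 1 i) (reals s 2 i), Complex (reals s 3 i) (reals s 4 i)]"

definition output_state :: "nat \<Rightarrow> store \<Rightarrow> complex vec" where
  "output_state n s = tensor_vecs (map (output_qubit s) [0..<n])"

section \<open>The constant in the lower bound\<close>

definition opt_const :: "nat \<Rightarrow> real" where
  "opt_const k = sqrt (2 * fact k) /
     (2 * real k powr (real k + 1.5 + (real k + 1) / (2 * real k)) * (sqrt 6 + 2 * sqrt 3) ^ k)"

end

theory Submission
  imports Defs
begin

text \<open>
  The expected energy of a product state with independent random qubits is the polynomial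
  \<open>f(x) = \<Sum>\<^sub>P \<alpha>\<^sub>P \<Prod>\<^sub>v x\<^sub>v\<close> in the mean Bloch coordinates, and the Haar average is \<open>f(0)\<close>, because
  conjugation with an anticommuting Pauli observable changes the sign of each traceless term. The
  sign of \<open>f(x) - f(0)\<close> must be the same for all outcomes of the search for \<open>x\<close>, or the gains cancel
  in expectation; hence the search is deterministic and randomness is used only to realize \<open>x\<close>.

  For the homogeneous part of degree \<open>\<kappa>\<close> let \<open>S\<close> be the sum of the \<open>\<ell>\<^sub>2\<close> norms of its partial
  derivatives; \<open>S\<close> bounds the \<open>\<ell>\<^sub>r\<close> norm of the coefficients. The symmetric coefficient tensor is
  contracted with sign vectors \<open>Y\<^sub>\<kappa>, \<dots>, Y\<^sub>1\<close>. A random sign vector would lose a factor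
  \<open>\<surd>3\<close> (Khintchine's inequality, from the fourth moment), and the method of conditional
  expectations finds signs that are as good, in time linear in the size of the tensor. By
  polarization, the resulting multilinear value is a signed average of the degree \<open>\<kappa>\<close> part at the
  points \<open>\<Sum>\<^sub>j \<epsilon>\<^sub>j Y\<^sub>j\<close>. The same average of all other parts vanishes below degree \<open>\<kappa>\<close>, and the parts of
  higher degree are removed by rescaling the points and extrapolating to scale zero. So one of
  boundedly many candidates is good, and evaluating \<open>f\<close> at all of them is affordable.
\<close>

section \<open>A calculus for halting, step counts and unmodified cells\<close>

section \<open>Executions of programs\<close>

text \<open>The time bound shapes the search: \<open>N ^ k\<close> with \<open>N = 4 * n\<close> is
  already the size of the dense tensor of order \<open>k\<close>, so every tensor entry may be
  touched only boundedly often. This rules out testing many sign vectors, and the potential of the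
  conditional expectations has to be an explicit formula that can be updated in place. Second and
  fourth moments allow that; the expected norm itself does not.

  Factors \<open>sqrt 3\<close> arise twice. One comes from each greedy contraction. The other comes
  from the output: three independent spins of a qubit form a pure state if its Bloch coordinates are
  plus or minus 1 / sqrt 3, so the means are confined to that cube. Extrapolation uses scales from
  3/5 to 1. The lower end costs \<open>(5 / 3) ^ \<kappa>\<close>, which together with the two roots
  gives \<open>5 ^ \<kappa>\<close>, and with \<open>j = k - \<kappa>\<close> the extrapolation
  costs \<open>(5 * j) ^ j / fact j\<close>. The common base 5 lies below the base
  \<open>sqrt 6 + 2 * sqrt 3\<close> of the constant, so all levels can be treated alike.\<close>

lemma run_Skip [simp]: "run t Skip s = return_pmf (Skip, s)"
  by (induction t) (auto simp: bind_return_pmf)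

lemma run_add: "run (t + u) c s = bind_pmf (run t c s) (\<lambda>(c', s'). run u c' s')"
proof (induction u)
  case 0
  then show ?case by (simp add: case_prod_unfold bind_return_pmf')
next
  case (Suc u)
  then show ?case
    by (simp add: bind_assoc_pmf case_prod_unfold)
qed

lemma run_Suc: "run (Suc t) c s = bind_pmf (step c s) (\<lambda>(c', s'). run t c' s')"
  using run_add[of 1 t c s] by (simp add: bind_return_pmf)

text \<open>Equality of distributions over configurations says at once that every branch has halted
  and how the final store is distributed. Since \<open>Skip\<close> steps to itself,
  \<open>t\<close> is only an upper bound for the running time.\<close>

definition outcome :: "nat \<Rightarrow> com \<Rightarrow> store \<Rightarrow> store pmf \<Rightarrow> bool" where
  "outcome t c s p \<longleftrightarrow> run t c s = map_pmf (Pair Skip) p"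

lemma outcome_halts:
  assumes "outcome t c s p"
  shows "halts_within t c s" and "final_store t c s = p"
  using assms by (auto simp: outcome_def halts_within_def final_store_def map_pmf_comp)

lemma halts_outcome:
  assumes "halts_within t c s"
  shows "outcome t c s (final_store t c s)"
  unfolding outcome_def final_store_def map_pmf_comp
proof -
  have "map_pmf (\<lambda>x. (Skip, snd x)) (run t c s) = map_pmf (\<lambda>x. x) (run t c s)"
    by (rule map_pmf_cong) (use assms in \<open>auto simp: halts_within_def\<close>)
  then show "run t c s = map_pmf (\<lambda>x. (Skip, snd x)) (run t c s)"
    by simp
qed

lemma outcome_mono:
  assumes "outcome t c s p" "t \<le> u"
  shows "outcome u c s p"
proof -
  obtain d where "u = t + d" using assms(2) le_Suc_ex by blast
  then show ?thesis
    using assms(1) by (simp add: outcome_def run_add bind_map_pmf) (simp add: map_pmf_def)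
qed

text \<open>One step is added for passing from \<open>Seq Skip d\<close> to \<open>d\<close>. The
  first command may halt earlier on some branches than on others, so the induction follows its first
  step and applies the hypothesis to every successor separately; \<open>outcome_mono\<close> absorbs
  early halting.\<close>

lemma outcome_Seq:
  assumes "outcome t c s p" "\<And>s'. s' \<in> set_pmf p \<Longrightarrow> outcome u d s' (q s')"
  shows "outcome (t + 1 + u) (Seq c d) s (bind_pmf p q)"
  using assms
proof (induction t arbitrary: c s p)
  case 0
  then have eq: "map_pmf (Pair Skip) p = return_pmf (c, s)" by (simp add: outcome_def)
  then have "set_pmf (map_pmf (Pair Skip) p) = {(c, s)}" by simp
  then have c: "c = Skip" and p: "set_pmf p = {s}"
    by (auto simp: image_def)
  then have p: "p = return_pmf s" by (simp flip: set_pmf_subset_singleton)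
  show ?case
    using 0(2) unfolding c p by (simp add: outcome_def run_Suc bind_return_pmf del: run.simps)
next
  case (Suc t)
  show ?case
  proof (cases "c = Skip")
    case True
    then have "set_pmf (map_pmf (Pair Skip) p) = {(Skip, s)}"
      using Suc(2) by (simp add: outcome_def del: run.simps set_map_pmf flip: set_return_pmf)
    then have "set_pmf p = {s}" by (auto simp: image_def)
    then have p: "p = return_pmf s" by (simp flip: set_pmf_subset_singleton)
    have "outcome (1 + u) (Seq Skip d) s (q s)"
      using Suc(3) p by (simp add: outcome_def run_Suc bind_return_pmf del: run.simps)
    then show ?thesis
      using True p by (simp add: bind_return_pmf) (erule outcome_mono, simp)
  next
    case False
    have h: "halts_within t c' s'" if "(c', s') \<in> set_pmf (step c s)" for c' s'
    proof -
      have "halts_within (Suc t) c s" using Suc(2) by (rule outcome_halts)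
      then show ?thesis using that unfolding halts_within_def run_Suc by fastforce
    qed
    have p: "p = bind_pmf (step c s) (\<lambda>(c', s'). final_store t c' s')"
      using outcome_halts(2)[OF Suc(2)]
      by (simp add: final_store_def run_Suc map_bind_pmf case_prod_unfold del: run.simps)
    have "run (Suc (t + 1 + u)) (Seq c d) s
        = bind_pmf (step c s) (\<lambda>(c', s'). run (t + 1 + u) (Seq c' d) s')"
      using False by (simp add: run_Suc bind_map_pmf case_prod_unfold del: run.simps)
    also have "\<dots> = bind_pmf (step c s)
        (\<lambda>(c', s'). map_pmf (Pair Skip) (bind_pmf (final_store t c' s') q))"
    proof (rule bind_pmf_cong[OF refl], clarify)
      fix c' s' assume cs: "(c', s') \<in> set_pmf (step c s)"
      have "outcome (t + 1 + u) (Seq c' d) s' (bind_pmf (final_store t c' s') q)"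
        by (rule Suc.IH[OF halts_outcome[OF h[OF cs]]], rule Suc.prems(2))
          (use cs in \<open>auto simp: p intro!: bexI[of _ "(c', s')"]\<close>)
      then show "run (t + 1 + u) (Seq c' d) s'
          = map_pmf (Pair Skip) (bind_pmf (final_store t c' s') q)"
        by (simp add: outcome_def)
    qed
    also have "\<dots> = map_pmf (Pair Skip) (bind_pmf p q)"
      by (simp add: p bind_assoc_pmf map_bind_pmf case_prod_unfold)
    finally show ?thesis by (simp add: outcome_def)
  qed
qed

lemma outcome_Cond:
  assumes "outcome t (if bval b s then c else d) s p"
  shows "outcome (t + 1) (Cond b c d) s p"
  using assms by (simp add: outcome_def run_Suc bind_return_pmf del: run.simps split del: if_split)

lemma outcome_While_step:
  assumes "bval b s" "outcome t (Seq c (While b c)) s p"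
  shows "outcome (t + 2) (While b c) s p"
proof -
  have "outcome (t + 1) (Cond b (Seq c (While b c)) Skip) s p"
    by (rule outcome_Cond) (use assms in simp)
  then show ?thesis by (simp add: outcome_def run_Suc bind_return_pmf del: run.simps)
qed

lemma outcome_While_end:
  assumes "\<not> bval b s"
  shows "outcome 2 (While b c) s (return_pmf s)"
  using assms by (simp add: outcome_def run_Suc bind_return_pmf numeral_2_eq_2 del: run.simps)

text \<open>The search flips no coin. Its executions are point masses and can be described by a
  single final store.\<close>

definition exec :: "nat \<Rightarrow> com \<Rightarrow> store \<Rightarrow> store \<Rightarrow> bool" where
  "exec t c s s' \<longleftrightarrow> outcome t c s (return_pmf s')"

lemma exec_mono: "exec t c s s' \<Longrightarrow> t \<le> u \<Longrightarrow> exec u c s s'"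
  unfolding exec_def by (rule outcome_mono)

lemma exec_Skip: "exec t Skip s s"
  by (simp add: exec_def outcome_def)

lemma exec_IAssign: "exec 1 (IAssign a i e) s (set_int a (ival i s) (ival e s) s)"
  by (simp add: exec_def outcome_def bind_return_pmf)

lemma exec_RAssign: "exec 1 (RAssign a i e) s (set_real a (ival i s) (rval e s) s)"
  by (simp add: exec_def outcome_def bind_return_pmf)

lemma exec_Seq: "exec t c s s' \<Longrightarrow> exec u d s' s'' \<Longrightarrow> exec (t + 1 + u) (Seq c d) s s''"
  unfolding exec_def using outcome_Seq[of t c s "return_pmf s'" u d "\<lambda>_. return_pmf s''"]
  by (simp add: bind_return_pmf)

lemma exec_Cond: "exec t (if bval b s then c else d) s s' \<Longrightarrow> exec (t + 1) (Cond b c d) s s'"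
  unfolding exec_def by (rule outcome_Cond)

subsection \<open>Cells that a program may modify\<close>

text \<open>Addresses are tracked only if they are constants; any computed address counts as the
  whole array. This is precise enough because counters and scalars have constant addresses, and the
  other arrays are treated as units.\<close>

primrec cell_indices :: "iexp \<Rightarrow> nat set" where
  "cell_indices (IConst c) = {c}"
| "cell_indices (IRead a e) = UNIV"
| "cell_indices (IAdd e f) = UNIV"
| "cell_indices (ISub e f) = UNIV"
| "cell_indices (IMul e f) = UNIV"

primrec int_writes :: "com \<Rightarrow> (nat \<times> nat) set" where
  "int_writes Skip = {}"
| "int_writes (IAssign a i e) = {a} \<times> cell_indices i"
| "int_writes (RAssign a i e) = {}"
| "int_writes (Flip a i e) = {a} \<times> cell_indices i"
| "int_writes (Seq c d) = int_writes c \<union> int_writes d"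
| "int_writes (Cond b c d) = int_writes c \<union> int_writes d"
| "int_writes (While b c) = int_writes c"

primrec real_writes :: "com \<Rightarrow> (nat \<times> nat) set" where
  "real_writes Skip = {}"
| "real_writes (IAssign a i e) = {}"
| "real_writes (RAssign a i e) = {a} \<times> cell_indices i"
| "real_writes (Flip a i e) = {}"
| "real_writes (Seq c d) = real_writes c \<union> real_writes d"
| "real_writes (Cond b c d) = real_writes c \<union> real_writes d"
| "real_writes (While b c) = real_writes c"

definition same_outside :: "com \<Rightarrow> store \<Rightarrow> store \<Rightarrow> bool" where
  "same_outside c s s' \<longleftrightarrow>
     (\<forall>a j. (a, j) \<notin> int_writes c \<longrightarrow> ints s' a j = ints s a j) \<and>
     (\<forall>a j. (a, j) \<notin> real_writes c \<longrightarrow> reals s' a j = reals s a j)"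

lemma same_outside_refl [simp]: "same_outside c s s"
  by (simp add: same_outside_def)

lemma same_outside_trans:
  "same_outside c s s' \<Longrightarrow> same_outside d s' s'' \<Longrightarrow> int_writes c \<subseteq> int_writes e \<Longrightarrow>
   int_writes d \<subseteq> int_writes e \<Longrightarrow> real_writes c \<subseteq> real_writes e \<Longrightarrow>
   real_writes d \<subseteq> real_writes e \<Longrightarrow> same_outside e s s''"
  unfolding same_outside_def by (metis subsetD)

lemma ints_set_int [simp]:
  "ints (set_int a i v s) b = (if a = b then (ints s b)(i := v) else ints s b)"
  by (auto simp: set_int_def)

lemma ints_set_real [simp]: "ints (set_real a i v s) = ints s"
  by (simp add: set_real_def)

lemma reals_set_real [simp]:
  "reals (set_real a i v s) b = (if a = b then (reals s b)(i := v) else reals s b)"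
  by (auto simp: set_real_def)

lemma reals_set_int [simp]: "reals (set_int a i v s) = reals s"
  by (simp add: set_int_def)

lemma ival_in_cell_indices: "ival i s \<in> cell_indices i"
  by (cases i) auto

lemma step_writes:
  "(c', s') \<in> set_pmf (step c s) \<Longrightarrow>
   same_outside c s s' \<and> int_writes c' \<subseteq> int_writes c \<and> real_writes c' \<subseteq> real_writes c"
proof (induction c arbitrary: c' s')
  case (IAssign a i e)
  then show ?case using ival_in_cell_indices[of i s] by (auto simp: same_outside_def)
next
  case (RAssign a i e)
  then show ?case using ival_in_cell_indices[of i s] by (auto simp: same_outside_def)
next
  case (Flip a i e)
  then show ?case using ival_in_cell_indices[of i s] by (auto simp: same_outside_def)
next
  case (Seq c d)
  show ?case
  proof (cases "c = Skip")
    case True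
    then show ?thesis using Seq.prems by auto
  next
    case False
    then obtain c1 where c1: "(c1, s') \<in> set_pmf (step c s)" "c' = Seq c1 d"
      using Seq.prems by auto
    then show ?thesis using Seq.IH(1)[OF c1(1)] by (auto simp: same_outside_def)
  qed
qed (auto split: if_splits)

lemma run_writes:
  "(c', s') \<in> set_pmf (run t c s) \<Longrightarrow>
   same_outside c s s' \<and> int_writes c' \<subseteq> int_writes c \<and> real_writes c' \<subseteq> real_writes c"
proof (induction t arbitrary: c' s')
  case (Suc t)
  then obtain c1 s1 where 1: "(c1, s1) \<in> set_pmf (run t c s)" "(c', s') \<in> set_pmf (step c1 s1)"
    by auto
  show ?case using Suc.IH[OF 1(1)] step_writes[OF 1(2)]
    by (meson order_trans same_outside_trans order_refl)
qed simp

lemma outcome_writes: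
  assumes "outcome t c s p" "s' \<in> set_pmf p"
  shows "same_outside c s s'"
  using assms run_writes[of Skip s' t c s] by (auto simp: outcome_def)

lemma exec_writes: "exec t c s s' \<Longrightarrow> same_outside c s s'"
  unfolding exec_def using outcome_writes[of t c s "return_pmf s'" s'] by simp

lemma same_outside_int:
  "same_outside c s s' \<Longrightarrow> (a, j) \<notin> int_writes c \<Longrightarrow> ints s' a j = ints s a j"
  by (simp add: same_outside_def)

lemma same_outside_real:
  "same_outside c s s' \<Longrightarrow> (a, j) \<notin> real_writes c \<Longrightarrow> reals s' a j = reals s a j"
  by (simp add: same_outside_def)

definition does :: "nat \<Rightarrow> com \<Rightarrow> store \<Rightarrow> (store \<Rightarrow> bool) \<Rightarrow> bool" where
  "does t c s Q \<longleftrightarrow> (\<exists>s'. exec t c s s' \<and> Q s')"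

text \<open>Every postcondition may draw on \<open>same_outside\<close>, so assertions have to
  mention only the cells that the program writes.\<close>

lemma does_mono:
  assumes "does t c s P" "t \<le> u" "\<And>s'. P s' \<Longrightarrow> same_outside c s s' \<Longrightarrow> Q s'"
  shows "does u c s Q"
  using assms exec_mono exec_writes unfolding does_def by blast

lemma does_Skip: "Q s \<Longrightarrow> does t Skip s Q"
  unfolding does_def using exec_Skip by blast

lemma does_IAssign:
  "Q (set_int a (ival i s) (ival e s) s) \<Longrightarrow> 0 < t \<Longrightarrow> does t (IAssign a i e) s Q"
  unfolding does_def using exec_IAssign exec_mono[of 1 _ _ _ t] by (metis Suc_leI One_nat_def)

lemma does_RAssign:
  "Q (set_real a (ival i s) (rval e s) s) \<Longrightarrow> 0 < t \<Longrightarrow> does t (RAssign a i e) s Q"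
  unfolding does_def using exec_RAssign exec_mono[of 1 _ _ _ t] by (metis Suc_leI One_nat_def)

lemma does_Seq:
  assumes "does t c s P" "\<And>s'. P s' \<Longrightarrow> same_outside c s s' \<Longrightarrow> does u d s' Q"
  shows "does (t + 1 + u) (Seq c d) s Q"
  using assms exec_Seq exec_writes unfolding does_def by blast

lemma does_RAssign_Seq:
  assumes "does u d (set_real a (ival i s) (rval e s) s) Q"
  shows "does (u + 2) (Seq (RAssign a i e) d) s Q"
proof -
  have "does (1 + 1 + u) (Seq (RAssign a i e) d) s Q"
    by (rule does_Seq[OF does_RAssign[where Q = "\<lambda>s'. s' = set_real a (ival i s) (rval e s) s"]])
      (use assms in simp_all)
  then show ?thesis by (simp add: add.commute)
qed

lemma does_Cond:
  assumes "bval b s \<Longrightarrow> does t c s Q" "\<not> bval b s \<Longrightarrow> does t d s Q"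
  shows "does (t + 1) (Cond b c d) s Q"
  using assms exec_Cond[of t b s c d] unfolding does_def by (cases "bval b s") auto

subsection \<open>Bounded loops\<close>

abbreviation counter :: "nat \<Rightarrow> iexp" where
  "counter c \<equiv> IRead 0 (IConst c)"

definition For :: "nat \<Rightarrow> iexp \<Rightarrow> com \<Rightarrow> com" where
  "For c b d = Seq (IAssign 0 (IConst c) (IConst 0))
     (While (ILess (counter c) b) (Seq d (IAssign 0 (IConst c) (IAdd (counter c) (IConst 1)))))"

lemma int_writes_For [simp]: "int_writes (For c b d) = insert (0, c) (int_writes d)"
  by (auto simp: For_def)

lemma real_writes_For [simp]: "real_writes (For c b d) = real_writes d"
  by (auto simp: For_def)

text \<open>A round costs five steps besides the body: two unfold the loop, two pass from one
  command to the next, one increments the counter. The invariant must tolerate changes of the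
  counter because it has to survive the increment; that the body keeps the counter is read off from
  its set of written cells.\<close>

lemma does_For:
  assumes "(0, c) \<notin> int_writes d"
    and bound: "\<And>s. same_outside (For c b d) s0 s \<Longrightarrow> ival b s = L"
    and init: "I 0 s0"
    and cong: "\<And>i s v. I i s \<Longrightarrow> I i (set_int 0 c v s)"
    and body: "\<And>i s. i < L \<Longrightarrow> I i s \<Longrightarrow> ints s 0 c = i \<Longrightarrow> same_outside (For c b d) s0 s \<Longrightarrow>
      does t d s (I (Suc i))"
  shows "does (L * (t + 5) + 5) (For c b d) s0 (I L)"
proof -
  define W where "W = While (ILess (counter c) b)
    (Seq d (IAssign 0 (IConst c) (IAdd (counter c) (IConst 1))))"
  have out: "same_outside (For c b d) s0 s' \<Longrightarrow> same_outside d s' s'' \<Longrightarrow>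
      same_outside (For c b d) s0 (set_int 0 c v s'')" for s' s'' v
    unfolding same_outside_def int_writes_For real_writes_For by simp
  have W: "does ((L - i) * (t + 5) + 2) W s (I L)"
    if "i \<le> L" "I i s" "ints s 0 c = i" "same_outside (For c b d) s0 s" for i s
    using that
  proof (induction "L - i" arbitrary: i s)
    case 0
    then have "\<not> bval (ILess (counter c) b) s" using bound[OF 0(5)] by simp
    then have "exec 2 W s s" unfolding W_def exec_def by (rule outcome_While_end)
    then have "exec ((L - i) * (t + 5) + 2) W s s" by (rule exec_mono) simp
    then show ?case using 0 by (auto simp: does_def)
  next
    case (Suc m)
    then have i: "i < L" by simp
    obtain s1 where s1: "exec t d s s1" "I (Suc i) s1"
      using body[OF i Suc.prems(2,3,4)] by (auto simp: does_def)
    have out1: "same_outside d s s1" using s1(1) by (rule exec_writes)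
    then have c1: "ints s1 0 c = i" using Suc.prems(3) assms(1) by (simp add: same_outside_int)
    define s2 where "s2 = set_int 0 c (Suc i) s1"
    have e2: "exec (t + 1 + 1) (Seq d (IAssign 0 (IConst c) (IAdd (counter c) (IConst 1)))) s s2"
      using exec_Seq[OF s1(1) exec_IAssign[of 0 "IConst c" "IAdd (counter c) (IConst 1)" s1]] c1
      by (simp add: s2_def)
    have "does ((L - Suc i) * (t + 5) + 2) W s2 (I L)"
      by (rule Suc.hyps(1)) (use Suc.hyps(2) i s1 in
        \<open>auto simp: s2_def intro!: cong out[OF Suc.prems(4) out1]\<close>)
    then obtain s3 where s3: "exec ((L - Suc i) * (t + 5) + 2) W s2 s3" "I L s3"
      by (auto simp: does_def)
    have "exec (t + 1 + 1 + 1 + ((L - Suc i) * (t + 5) + 2))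
        (Seq (Seq d (IAssign 0 (IConst c) (IAdd (counter c) (IConst 1)))) W) s s3"
      by (rule exec_Seq[OF e2 s3(1)])
    then have "exec (t + 1 + 1 + 1 + ((L - Suc i) * (t + 5) + 2) + 2) W s s3"
      unfolding W_def exec_def
      by (intro outcome_While_step) (use bound[OF Suc.prems(4)] i Suc.prems(3) in auto)
    moreover have "t + 1 + 1 + 1 + ((L - Suc i) * (t + 5) + 2) + 2 = (L - i) * (t + 5) + 2"
      using i by (simp add: Suc_diff_Suc[OF i, symmetric])
    ultimately show ?case using s3(2) by (auto simp: does_def)
  qed
  have "does (L * (t + 5) + 2) W (set_int 0 c 0 s0) (I L)"
    using W[of 0 "set_int 0 c 0 s0"] cong[OF init] out[of s0 s0] by simp
  then have "does (1 + 1 + (L * (t + 5) + 2)) (For c b d) s0 (I L)"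
    unfolding For_def W_def[symmetric]
    by (intro does_Seq[OF does_IAssign[where Q = "\<lambda>s. s = set_int 0 c 0 s0"]]) auto
  then show ?thesis by (rule does_mono) auto
qed

definition SumLoop :: "nat \<Rightarrow> nat \<Rightarrow> iexp \<Rightarrow> rexp \<Rightarrow> com" where
  "SumLoop c r b e = Seq (RAssign 5 (IConst r) (OfNat (IConst 0)))
     (For c b (RAssign 5 (IConst r) (RAdd (RRead 5 (IConst r)) e)))"

lemma int_writes_SumLoop [simp]: "int_writes (SumLoop c r b e) = {(0, c)}"
  by (auto simp: SumLoop_def)

lemma real_writes_SumLoop [simp]: "real_writes (SumLoop c r b e) = {(5, r)}"
  by (auto simp: SumLoop_def)

lemma does_SumLoop:
  assumes "\<And>s. same_outside (SumLoop c r b e) s0 s \<Longrightarrow> ival b s = L"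
    and "\<And>i s. i < L \<Longrightarrow> ints s 0 c = i \<Longrightarrow> same_outside (SumLoop c r b e) s0 s \<Longrightarrow> rval e s = E i"
  shows "does (L * 6 + 7) (SumLoop c r b e) s0 (\<lambda>s. reals s 5 r = (\<Sum>i<L. E i))"
proof -
  have out: "same_outside (SumLoop c r b e) s0 s"
    if "same_outside (For c b (RAssign 5 (IConst r) (RAdd (RRead 5 (IConst r)) e)))
      (set_real 5 r 0 s0) s" for s
    using that by (auto simp: same_outside_def split: if_splits)
  have "does (L * (1 + 5) + 5) (For c b (RAssign 5 (IConst r) (RAdd (RRead 5 (IConst r)) e)))
      (set_real 5 r 0 s0) (\<lambda>s. reals s 5 r = (\<Sum>i<L. E i))"
    by (rule does_For[where I = "\<lambda>j s. reals s 5 r = (\<Sum>i<j. E i)"])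
      (auto intro!: does_RAssign assms dest: out)
  then show ?thesis
    unfolding SumLoop_def by (intro does_mono[OF does_RAssign_Seq]) auto
qed

definition MapLoop :: "nat \<Rightarrow> iexp \<Rightarrow> nat \<Rightarrow> rexp \<Rightarrow> com" where
  "MapLoop c b a e = For c b (RAssign a (counter c) e)"

lemma int_writes_MapLoop [simp]: "int_writes (MapLoop c b a e) = {(0, c)}"
  by (auto simp: MapLoop_def)

lemma real_writes_MapLoop [simp]: "real_writes (MapLoop c b a e) = {a} \<times> UNIV"
  by (auto simp: MapLoop_def)

text \<open>When round \<open>i\<close> starts, cell \<open>i\<close> still has its initial content,
  because earlier rounds wrote only smaller cells. This lets the expression \<open>e\<close> refer
  to the old value, as in the in-place addition of \<open>choose_prog\<close>.\<close>

lemma does_MapLoop: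
  assumes bound: "\<And>s. same_outside (MapLoop c b a e) s0 s \<Longrightarrow> ival b s = L"
    and "\<And>i s. i < L \<Longrightarrow> ints s 0 c = i \<Longrightarrow> same_outside (MapLoop c b a e) s0 s \<Longrightarrow>
      reals s a i = reals s0 a i \<Longrightarrow> rval e s = E i"
  shows "does (L * 6 + 5) (MapLoop c b a e) s0
    (\<lambda>s. \<forall>i. reals s a i = (if i < L then E i else reals s0 a i))"
proof -
  have "does (L * (1 + 5) + 5) (For c b (RAssign a (counter c) e)) s0
    (\<lambda>s. \<forall>i. reals s a i = (if i < L then E i else reals s0 a i))"
    by (rule does_For[where I = "\<lambda>j s. \<forall>i. reals s a i = (if i < j then E i else reals s0 a i)"])
      (auto intro!: does_RAssign assms simp flip: MapLoop_def)
  then show ?thesis by (simp add: MapLoop_def)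
qed

text \<open>Array names in a program are static, so a counter cannot range over the tensors of
  different orders. Iterations of this kind are unrolled; their number depends on \<open>k\<close>
  only.\<close>

primrec Seqs :: "com list \<Rightarrow> com" where
  "Seqs [] = Skip"
| "Seqs (c # cs) = Seq c (Seqs cs)"

lemma int_writes_Seqs [simp]: "int_writes (Seqs cs) = (\<Union>c\<in>set cs. int_writes c)"
  by (induction cs) auto

lemma real_writes_Seqs [simp]: "real_writes (Seqs cs) = (\<Union>c\<in>set cs. real_writes c)"
  by (induction cs) auto

lemma does_Seqs:
  assumes "\<And>i s. i < length cs \<Longrightarrow> I i s \<Longrightarrow> same_outside (Seqs cs) s0 s \<Longrightarrow>
      does t (cs ! i) s (I (Suc i))"
    and "I 0 s0"
  shows "does (length cs * (t + 1)) (Seqs cs) s0 (I (length cs))"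
proof -
  have "does ((length cs - i) * (t + 1)) (Seqs (drop i cs)) s (I (length cs))"
    if "i \<le> length cs" "I i s" "same_outside (Seqs cs) s0 s" for i s
    using that
  proof (induction "length cs - i" arbitrary: i s)
    case 0
    then show ?case by (auto intro: does_Skip)
  next
    case (Suc m)
    then have i: "i < length cs" by simp
    have drop: "drop i cs = cs ! i # drop (Suc i) cs" using i by (simp add: Cons_nth_drop_Suc)
    have "does (t + 1 + (length cs - Suc i) * (t + 1)) (Seqs (drop i cs)) s (I (length cs))"
      unfolding drop Seqs.simps
    proof (rule does_Seq[OF assms(1)[OF i Suc.prems(2,3)]])
      fix s' assume s': "I (Suc i) s'" "same_outside (cs ! i) s s'"
      have "same_outside (Seqs cs) s0 s'"
        by (rule same_outside_trans[OF Suc.prems(3) s'(2)]) (use i in force)+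
      then show "does ((length cs - Suc i) * (t + 1)) (Seqs (drop (Suc i) cs)) s' (I (length cs))"
        using Suc i s'(1) by (intro Suc.hyps(1)) auto
    qed
    moreover have "t + 1 + (length cs - Suc i) * (t + 1) = (length cs - i) * (t + 1)"
      using i by (simp add: Suc_diff_Suc[OF i, symmetric])
    ultimately show ?case by simp
  qed
  from this[of 0 s0] show ?thesis using assms(2) by simp
qed

section \<open>A vector-valued Khintchine inequality by conditional expectations\<close>

section \<open>Greedy contraction of a tensor\<close>

lemma sum_mult_lessThan:
  fixes g :: "nat \<Rightarrow> 'a :: comm_monoid_add"
  shows "(\<Sum>l<a * b. g l) = (\<Sum>i<a. \<Sum>j<b. g (i * b + j))"
proof -
  have "sum g {..<a * b} = (\<Sum>i<a. sum g {i * b..<i * b + b})"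
    by (rule sum.nat_group[symmetric])
  moreover have "sum g {i * b..<i * b + b} = (\<Sum>j<b. g (i * b + j))"
    for i using sum.shift_bounds_nat_ivl[of g 0 "i * b" b]
    by (simp add: add.commute lessThan_atLeast0)
  ultimately show ?thesis by simp
qed

text \<open>
  For a vector-valued Rademacher sum whose first summands add up to a vector of squared norm \<open>w\<close>
  and whose remaining summands have total squared norm \<open>s\<close>, out of a total \<open>a\<close>, this is, up to the
  factor \<open>\<surd>3 / 2\<close>, an estimate from below of the expected norm of the sum: it comes from
  \<open>x \<ge> (\<surd>3 / 2) (x\<^sup>2 - x\<^sup>4 / 9)\<close> and from the second and fourth moments.
\<close>

definition norm_estimate :: "real \<Rightarrow> real \<Rightarrow> real \<Rightarrow> real" where
  "norm_estimate a w s = (w + s) / sqrt a - (w\<^sup>2 + 6 * w * s + 3 * s\<^sup>2) / (9 * (a * sqrt a))"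

text \<open>With \<open>x = sqrt (w / a)\<close> this is the scalar inequality
  \<open>x ^ 2 - x ^ 4 / 9 \<le> 2 / sqrt 3 * x\<close>, which is tight at
  \<open>x = sqrt 3\<close>.\<close>

lemma norm_estimate_final:
  assumes "0 \<le> a" "0 \<le> w"
  shows "norm_estimate a w 0 \<le> 2 / sqrt 3 * sqrt w"
proof (cases "a = 0")
  case True
  then show ?thesis using assms by (simp add: norm_estimate_def)
next
  case False
  define A u where "A = sqrt a" and "u = sqrt w"
  have a: "a = A\<^sup>2" "w = u\<^sup>2" "A > 0" "u \<ge> 0"
    using assms False by (auto simp: A_def u_def)
  define r :: real where "r = sqrt 3"
  have r: "r * r = 3" "r > 0" by (simp_all add: r_def)
  have est: "norm_estimate a w 0 = u ^ 2 / A - u ^ 4 / (9 * A ^ 3)"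
    using a(3) by (simp add: norm_estimate_def a(1,2) power2_eq_square power3_eq_cube power4_eq_xxxx)
  \<comment> \<open>The double root at \<open>u = r * A\<close> is the point where both sides
    touch.\<close>
  have "0 \<le> u * ((u - r * A)\<^sup>2 * (u + 2 * r * A))"
    using a r by (intro mult_nonneg_nonneg add_nonneg_nonneg) auto
  also have "\<dots> = u ^ 4 - 3 * (r * r) * A ^ 2 * u ^ 2 + 2 * r * (r * r) * A ^ 3 * u"
    by (simp add: power2_eq_square power3_eq_cube power4_eq_xxxx algebra_simps)
  also have "\<dots> = 9 * A ^ 3 * (2 * r / 3 * u - norm_estimate a w 0)"
    using a(3) unfolding r est
    by (simp add: field_simps power2_eq_square power3_eq_cube power4_eq_xxxx)
  also have "2 * r / 3 = 2 / sqrt 3"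
    using r by (simp add: field_simps flip: r_def)
  finally show ?thesis using a(3) by (simp add: zero_le_mult_iff u_def)
qed

text \<open>Together with \<open>norm_estimate_final\<close> this fixes the loss of one contraction:
  the quotient of \<open>2 / sqrt 3\<close> and \<open>2 / 3\<close> is
  \<open>sqrt 3\<close>.\<close>

lemma norm_estimate_start: "0 \<le> a \<Longrightarrow> norm_estimate a 0 a = 2 / 3 * sqrt a"
  by (cases "a = 0") (simp_all add: norm_estimate_def field_simps power2_eq_square)

text \<open>Submartingale property of the estimate. A new summand with squared norm \<open>b\<close>
  and inner product \<open>d\<close> with the current vector changes \<open>w\<close> to
  \<open>w + b + 2 * d\<close> or to \<open>w + b - 2 * d\<close>. The second-moment part keeps its
  mean, and the fourth-moment bound \<open>w\<^sup>2 + 6 * w * s + 3 * s\<^sup>2\<close> drops in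
  mean by \<open>4 * (w * b - d\<^sup>2) + 2 * b\<^sup>2\<close>, where the first bracket is
  nonnegative by the Cauchy-Schwarz inequality.\<close>

lemma norm_estimate_mean:
  assumes "0 \<le> a" "d\<^sup>2 \<le> w * b" 
  shows "2 * norm_estimate a w (s + b) \<le>
    norm_estimate a (w + b + 2 * d) s + norm_estimate a (w + b - 2 * d) s"
proof -
  define q where "q w s = w\<^sup>2 + 6 * w * s + 3 * s\<^sup>2" for w s :: real
  have "q (w + b + 2 * d) s + q (w + b - 2 * d) s = 2 * q w (s + b) - 8 * (w * b - d\<^sup>2) - 4 * b\<^sup>2"
    by (simp add: q_def power2_eq_square algebra_simps)
  also have "\<dots> \<le> 2 * q w (s + b)"
  proof -
    have "0 \<le> 8 * (w * b - d\<^sup>2)" "0 \<le> 4 * b\<^sup>2" using assms(2) by simp_all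
    then show ?thesis by linarith
  qed
  finally have "(q (w + b + 2 * d) s + q (w + b - 2 * d) s) / (9 * (a * sqrt a))
      \<le> 2 * q w (s + b) / (9 * (a * sqrt a))"
    using assms(1) by (intro divide_right_mono) auto
  moreover have "norm_estimate a w s = (w + s) / sqrt a - q w s / (9 * (a * sqrt a))" for w s
    by (simp add: norm_estimate_def q_def)
  moreover have "2 * ((w + (s + b)) / sqrt a) =
      (w + b + 2 * d + s) / sqrt a + (w + b - 2 * d + s) / sqrt a"
    by (simp add: add_divide_distrib diff_divide_distrib)
  ultimately show ?thesis by (simp add: add_divide_distrib)
qed

text \<open>Choosing between the two signs requires only this difference, in which everything even
  in \<open>d\<close> cancels. What is left can be evaluated on a real RAM from inner products and
  squared norms. For \<open>a = 0\<close> both sides vanish by \<open>x / 0 = 0\<close>.\<close>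

lemma norm_estimate_diff:
  "norm_estimate a (n + 2 * d) s - norm_estimate a (n - 2 * d) s =
   4 / 9 * (d * (9 * a - 2 * (n + 3 * s)) / (a * sqrt a))"
proof (cases "a = 0")
  case False
  define c where "c = 9 * (a * sqrt a)"
  have "(w + s) / sqrt a = 9 * a * (w + s) / c" for w
    using False by (simp add: c_def)
  then have e: "norm_estimate a w s = (9 * a * (w + s) - (w\<^sup>2 + 6 * w * s + 3 * s\<^sup>2)) / c" for w
    by (simp add: norm_estimate_def c_def diff_divide_distrib)
  have "norm_estimate a (n + 2 * d) s - norm_estimate a (n - 2 * d) s =
      4 * (d * (9 * a - 2 * (n + 3 * s))) / c"
    unfolding e diff_divide_distrib[symmetric]
    by (rule arg_cong[of _ _ "\<lambda>x. x / c"]) (simp add: power2_eq_square algebra_simps)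
  then show ?thesis by (simp add: c_def)
qed (simp add: norm_estimate_def)

text \<open>One choice of signs must serve all indices \<open>v\<close> simultaneously, so the
  potential is the sum over \<open>v\<close> of the estimates. By \<open>norm_estimate_mean\<close>
  the better sign never decreases it, and \<open>D i\<close>, up to the factor 4 / 9, is the
  advantage of plus over minus. The values of the potential at the start and at the end give the two
  sides of the inequality.\<close>

lemma greedy_contraction:
  fixes B :: "nat \<Rightarrow> nat \<Rightarrow> nat \<Rightarrow> real" and Y :: "nat \<Rightarrow> real" and n L N :: nat
  defines "U \<equiv> \<lambda>i q v. \<Sum>j<i. Y j * B j q v"
  defines "a \<equiv> \<lambda>v. \<Sum>i<n. \<Sum>q<L. (B i q v)\<^sup>2"
  defines "b \<equiv> \<lambda>i v. \<Sum>q<L. (B i q v)\<^sup>2"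
  defines "D \<equiv> \<lambda>i. \<Sum>v<N. (\<Sum>q<L. U i q v * B i q v) *
    (9 * a v - 2 * ((\<Sum>q<L. (U i q v)\<^sup>2) + b i v + 3 * (a v - (\<Sum>j<Suc i. b j v)))) / (a v * sqrt (a v))"
  assumes Y: "\<And>i. i < n \<Longrightarrow> Y i = (if D i < 0 then - 1 else 1)"
  shows "(\<Sum>v<N. sqrt (a v)) \<le> sqrt 3 * (\<Sum>v<N. sqrt (\<Sum>q<L. (U n q v)\<^sup>2))"
proof -
  define w where "w i v = (\<Sum>q<L. (U i q v)\<^sup>2)" for i v
  define s where "s i v = a v - (\<Sum>j<i. b j v)" for i v
  have a0: "a v \<ge> 0" for v unfolding a_def by (intro sum_nonneg) auto
  have step: "(\<Sum>v<N. norm_estimate (a v) (w i v) (s i v)) \<le>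
      (\<Sum>v<N. norm_estimate (a v) (w (Suc i) v) (s (Suc i) v))" if i: "i < n" for i
  proof -
    define d where "d v = (\<Sum>q<L. U i q v * B i q v)" for v
    have y2: "Y i * Y i = 1" using Y[OF i] by auto
    have w': "w (Suc i) v = w i v + b i v + 2 * (Y i * d v)" for v
    proof -
      have "(U (Suc i) q v)\<^sup>2 = (U i q v)\<^sup>2 + (B i q v)\<^sup>2 + 2 * (Y i * (U i q v * B i q v))" for q
      proof -
        have "(U (Suc i) q v)\<^sup>2 = (U i q v)\<^sup>2 + (Y i * Y i) * (B i q v)\<^sup>2 + 2 * (Y i * (U i q v * B i q v))"
          by (simp add: U_def power2_eq_square algebra_simps)
        then show ?thesis by (simp add: y2)
      qed
      then show ?thesis
        by (simp add: w_def b_def d_def sum.distrib sum_distrib_left)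
    qed
    have cs: "(d v)\<^sup>2 \<le> w i v * b i v" for v
      unfolding d_def w_def b_def by (rule Cauchy_Schwarz_ineq_sum)
    have s': "s i v = s (Suc i) v + b i v" for v by (simp add: s_def)
    let ?p = "\<Sum>v<N. norm_estimate (a v) (w i v + b i v + 2 * d v) (s (Suc i) v)"
    let ?m = "\<Sum>v<N. norm_estimate (a v) (w i v + b i v - 2 * d v) (s (Suc i) v)"
    have mean: "2 * (\<Sum>v<N. norm_estimate (a v) (w i v) (s i v)) \<le> ?p + ?m"
      unfolding s' sum_distrib_left sum.distrib[symmetric]
      by (intro sum_mono norm_estimate_mean a0 cs)
    have diff: "?p - ?m = 4 / 9 * D i"
      unfolding sum_subtractf[symmetric] norm_estimate_diff D_def sum_distrib_left
      by (simp add: d_def w_def s_def)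
    show ?thesis
    proof (cases "D i < 0")
      case True
      then show ?thesis using mean diff Y[OF i] by (simp add: w')
    next
      case False
      then show ?thesis using mean diff Y[OF i] by (simp add: w')
    qed
  qed
  have mono: "i \<le> n \<Longrightarrow> (\<Sum>v<N. norm_estimate (a v) (w 0 v) (s 0 v)) \<le>
      (\<Sum>v<N. norm_estimate (a v) (w i v) (s i v))" for i
    by (induction i) (use step in \<open>auto intro: order_trans\<close>)
  have "2 / 3 * (\<Sum>v<N. sqrt (a v)) = (\<Sum>v<N. norm_estimate (a v) (w 0 v) (s 0 v))"
    using a0 by (simp add: w_def U_def s_def norm_estimate_start sum_distrib_left)
  also have "\<dots> \<le> (\<Sum>v<N. norm_estimate (a v) (w n v) 0)"
    using mono[of n] by (simp add: s_def a_def b_def)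
  also have "\<dots> \<le> (\<Sum>v<N. 2 / sqrt 3 * sqrt (w n v))"
    by (intro sum_mono norm_estimate_final a0) (simp add: w_def sum_nonneg)
  finally have "2 / 3 * (\<Sum>v<N. sqrt (a v)) \<le> 2 / sqrt 3 * (\<Sum>v<N. sqrt (w n v))"
    by (simp add: sum_distrib_left)
  then have "3 / 2 * (2 / 3 * (\<Sum>v<N. sqrt (a v))) \<le> 3 / 2 * (2 / sqrt 3 * (\<Sum>v<N. sqrt (w n v)))"
    by (rule mult_left_mono) simp
  also have "\<dots> = sqrt 3 * (\<Sum>v<N. sqrt (w n v))"
    using real_div_sqrt[of 3] by (simp add: divide_simps)
  finally show ?thesis by (simp add: w_def)
qed

section \<open>Lagrange extrapolation from equidistant nodes\<close>

section \<open>Extrapolation to zero\<close>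

text \<open>Denominators of the Lagrange weights at equidistant nodes: the indices below
  \<open>l\<close> contribute \<open>fact l\<close>, those above contribute
  \<open>fact (j - l)\<close>.\<close>

lemma prod_dist_index:
  assumes "l \<le> j"
  shows "(\<Prod>m\<in>{..j} - {l}. \<bar>real m - real l\<bar>) = fact l * fact (j - l)"
proof -
  have split: "{..j} - {l} = {..<l} \<union> {l<..j}" using assms by auto
  have "(\<Prod>m\<in>{..<l}. \<bar>real m - real l\<bar>) = (\<Prod>i\<in>{1..l}. real i)"
    by (rule prod.reindex_bij_witness[of _ "\<lambda>i. l - i" "\<lambda>m. l - m"]) (auto simp: of_nat_diff)
  moreover have "(\<Prod>m\<in>{l<..j}. \<bar>real m - real l\<bar>) = (\<Prod>i\<in>{1..j - l}. real i)"
    by (rule prod.reindex_bij_witness[of _ "\<lambda>i. i + l" "\<lambda>m. m - l"]) (auto simp: of_nat_diff)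
  ultimately show ?thesis
    unfolding split by (subst prod.union_disjoint) (auto simp: fact_prod)
qed

text \<open>Lagrange interpolation evaluated at 0: the interpolating polynomial \<open>R\<close> and
  the polynomial \<open>q\<close> with coefficients \<open>c i\<close> have degree at most
  \<open>j\<close> and agree at \<open>j + 1\<close> nodes.\<close>

lemma interpolation_at_0:
  fixes c s :: "nat \<Rightarrow> real"
  assumes inj: "inj_on s {..j}"
  shows "c 0 = (\<Sum>l\<le>j. (\<Sum>i\<le>j. c i * s l ^ i) * (\<Prod>m\<in>{..j} - {l}. s m / (s m - s l)))"
proof -
  define q where "q = (\<Sum>i\<le>j. monom (c i) i)"
  define R where "R = (\<Sum>l\<le>j. Polynomial.smult (poly q (s l)) (\<Prod>m\<in>{..j} - {l}. Polynomial.smult (1 / (s l - s m)) [:- s m, 1:]))"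
  have q: "poly q x = (\<Sum>i\<le>j. c i * x ^ i)" for x
    by (simp add: q_def poly_sum poly_monom)
  have R: "poly R x = (\<Sum>l\<le>j. poly q (s l) * (\<Prod>m\<in>{..j} - {l}. (x - s m) / (s l - s m)))" for x
    by (simp add: R_def poly_sum poly_prod diff_divide_distrib)
  have "R = q"
  proof (rule poly_eqI_degree[of "s ` {..j}"])
    fix x assume "x \<in> s ` {..j}"
    then obtain l where l: "l \<le> j" "x = s l" by auto
    have "poly q (s i) * (\<Prod>m\<in>{..j} - {i}. (x - s m) / (s i - s m)) = (if i = l then poly q (s l) else 0)"
      if i: "i \<le> j" for i
    proof (cases "i = l")
      case True
      have "(\<Prod>m\<in>{..j} - {l}. (s l - s m) / (s l - s m)) = (\<Prod>m\<in>{..j} - {l}. 1)"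
        by (rule prod.cong) (use inj l in \<open>auto simp: inj_on_def\<close>)
      then show ?thesis using True l by simp
    next
      case False
      have "(\<Prod>m\<in>{..j} - {i}. (x - s m) / (s i - s m)) = 0"
        by (rule prod_zero) (use False l in auto)
      then show ?thesis using False by simp
    qed
    then have "poly R x = (\<Sum>i\<le>j. if i = l then poly q (s l) else 0)"
      unfolding R by (intro sum.cong) auto
    then show "poly R x = poly q x" using l by simp
  next
    have card: "card (s ` {..j}) = Suc j" using inj by (simp add: card_image)
    have "degree R \<le> j"
      unfolding R_def
    proof (rule degree_sum_le, simp)
      fix l assume l: "l \<in> {..j}"
      have "degree (\<Prod>m\<in>{..j} - {l}. Polynomial.smult (1 / (s l - s m)) [:- s m, 1:]) \<le>
          (\<Sum>m\<in>{..j} - {l}. degree (Polynomial.smult (1 / (s l - s m)) [:- s m, 1:]))"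
        by (rule order_trans[OF degree_prod_sum_le]) (simp_all add: comp_def del: Polynomial.smult_pCons)
      also have "\<dots> \<le> (\<Sum>m\<in>{..j} - {l}. 1)"
        by (intro sum_mono) (rule order_trans[OF degree_smult_le], simp)
      also have "\<dots> = j" using l by simp
      finally show "degree (Polynomial.smult (poly q (s l)) (\<Prod>m\<in>{..j} - {l}. Polynomial.smult (1 / (s l - s m)) [:- s m, 1:])) \<le> j"
        using degree_smult_le order_trans by blast
    qed
    then show "card (s ` {..j}) > degree R" using card by simp
    have "degree q \<le> j" unfolding q_def
      by (rule degree_sum_le) (auto intro: order_trans[OF degree_monom_le])
    then show "card (s ` {..j}) > degree q" using card by simp
  qed
  have "c 0 = poly q 0" by (simp add: q power_0_left if_distrib cong: if_cong)
  also have "\<dots> = poly R 0" using \<open>R = q\<close> by simp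
  also have "\<dots> = (\<Sum>l\<le>j. poly q (s l) * (\<Prod>m\<in>{..j} - {l}. s m / (s m - s l)))"
  proof -
    have "(0 - s m) / (s l - s m) = s m / (s m - s l)" for l m
      using minus_divide_divide[of "s m" "s m - s l"] by simp
    then show ?thesis unfolding R by simp
  qed
  finally show ?thesis by (simp add: q)
qed

text \<open>Equidistant nodes from 1 down to 3/5. Values above 1 would push candidates out of the
  cube of realizable means; values near 0 would be costly because the lowest power of the scale is
  divided out. The end 3/5 balances the losses: \<open>sqrt 3 * sqrt 3 * (5 / 3) = 5\<close> per
  degree of the extracted part, and 5 per degree of the extrapolation. For \<open>j = 0\<close>
  division by zero yields the single node 1.\<close>

definition scale :: "nat \<Rightarrow> nat \<Rightarrow> real" where
  "scale j l = 1 - real (2 * l) / real (5 * j)"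

lemma scale_bounds:
  assumes "l \<le> j"
  shows "3 / 5 \<le> scale j l" "scale j l \<le> 1"
  using assms by (cases "j = 0"; simp add: scale_def field_simps)+

text \<open>Each Lagrange weight has a numerator of modulus at most 1, and the spacing
  \<open>2 / (5 * j)\<close> contributes \<open>5 * j / 2\<close> to each of its \<open>j\<close>
  factors. The reciprocals of \<open>fact l * fact (j - l)\<close> add up to
  \<open>2 ^ j / fact j\<close>, which turns \<open>5 * j / 2\<close> into
  \<open>5 * j\<close>.\<close>

lemma extrapolation_bound:
  fixes c :: "nat \<Rightarrow> real"
  assumes "\<And>l. l \<le> j \<Longrightarrow> \<bar>\<Sum>i\<le>j. c i * scale j l ^ i\<bar> \<le> B"
  shows "\<bar>c 0\<bar> \<le> B * ((5 * real j) ^ j / fact j)"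
proof (cases "j = 0")
  case True
  then show ?thesis using assms[of 0] by simp
next
  case False
  have inj: "inj_on (scale j) {..j}" using False by (auto simp: inj_on_def scale_def)
  have B: "B \<ge> 0" using assms[of 0] by auto
  have w: "\<bar>\<Prod>m\<in>{..j} - {l}. scale j m / (scale j m - scale j l)\<bar> \<le>
      (5 * real j / 2) ^ j * (1 / (fact l * fact (j - l)))" if l: "l \<le> j" for l
  proof -
    have "\<bar>\<Prod>m\<in>{..j} - {l}. scale j m / (scale j m - scale j l)\<bar> =
        (\<Prod>m\<in>{..j} - {l}. \<bar>scale j m\<bar> * ((5 * real j / 2) / \<bar>real m - real l\<bar>))"
      unfolding abs_prod
    proof (rule prod.cong[OF refl])
      fix m assume m: "m \<in> {..j} - {l}"
      have diff: "scale j m - scale j l = - ((real m - real l) / (5 * real j / 2))"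
        using False by (simp add: scale_def field_simps)
      show "\<bar>scale j m / (scale j m - scale j l)\<bar> = \<bar>scale j m\<bar> * ((5 * real j / 2) / \<bar>real m - real l\<bar>)"
        unfolding diff by (simp only: abs_divide abs_minus_cancel) simp
    qed
    also have "\<dots> \<le> (\<Prod>m\<in>{..j} - {l}. 1 * ((5 * real j / 2) / \<bar>real m - real l\<bar>))"
    proof (intro prod_mono conjI mult_right_mono)
      fix m assume "m \<in> {..j} - {l}"
      then show "\<bar>scale j m\<bar> \<le> 1" using scale_bounds[of m j] by simp
    qed auto
    also have "\<dots> = (5 * real j / 2) ^ j * (1 / (fact l * fact (j - l)))"
      using l by (simp add: prod_dividef prod_dist_index power_divide power_mult_distrib)
    finally show ?thesis .
  qed
  have "\<bar>c 0\<bar> \<le> (\<Sum>l\<le>j. \<bar>\<Sum>i\<le>j. c i * scale j l ^ i\<bar> * \<bar>\<Prod>m\<in>{..j} - {l}. scale j m / (scale j m - scale j l)\<bar>)"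
    unfolding interpolation_at_0[OF inj, of c] abs_mult[symmetric] by (rule sum_abs)
  also have "\<dots> \<le> (\<Sum>l\<le>j. B * ((5 * real j / 2) ^ j * (1 / (fact l * fact (j - l)))))"
    using B by (intro sum_mono mult_mono assms w) auto
  also have "\<dots> = B * (5 * real j / 2) ^ j * (\<Sum>l\<le>j. 1 / (fact l * fact (j - l)))"
    by (simp add: sum_distrib_left mult.assoc)
  also have "(\<Sum>l\<le>j. 1 / (fact l * fact (j - l))) = (2 ^ j / fact j :: real)"
  proof -
    have "(\<Sum>l\<le>j. 1 / (fact l * fact (j - l))) = (\<Sum>l\<le>j. real (j choose l) / fact j)"
      by (intro sum.cong) (auto simp: binomial_fact)
    also have "\<dots> = real (\<Sum>l\<le>j. j choose l) / fact j"
      by (simp add: sum_divide_distrib)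
    also have "(\<Sum>l\<le>j. j choose l) = 2 ^ j"
      by (rule choose_row_sum)
    finally show ?thesis by simp
  qed
  finally show ?thesis by (simp add: power_divide)
qed

section \<open>Comparison of the collected losses with the required constant\<close>

section \<open>The constant\<close>

text \<open>A single term of the binomial expansion of \<open>(\<kappa> + j) ^ k\<close> is at most
  the whole sum.\<close>

lemma fact_power_le:
  assumes "\<kappa> + j = k"
  shows "fact k * (real \<kappa> ^ \<kappa> * (real j ^ j / fact j)) \<le> real k ^ k * fact \<kappa>"
proof -
  have "real (k choose \<kappa>) * real \<kappa> ^ \<kappa> * real j ^ (k - \<kappa>) \<le>
      (\<Sum>i\<le>k. real (k choose i) * real \<kappa> ^ i * real j ^ (k - i))"
    by (rule member_le_sum) (use assms in auto)
  also have "\<dots> = real k ^ k"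
    using binomial_ring[of "real \<kappa>" "real j" k] assms by (simp flip: of_nat_add)
  finally have "fact k / (fact \<kappa> * fact j) * real \<kappa> ^ \<kappa> * real j ^ j \<le> real k ^ k"
    using assms binomial_fact[of \<kappa> k, where 'a = real] by auto
  then show ?thesis by (simp add: field_simps)
qed

text \<open>The last factor on the left is the loss collected for level \<open>\<kappa>\<close>. By
  \<open>fact_power_le\<close> it is at most \<open>5 ^ k * k ^ k * fact \<kappa> / fact k\<close>;
  the constant pays for \<open>5 ^ k\<close> with the base \<open>sqrt 6 + 2 * sqrt 3\<close> and
  for \<open>k ^ k\<close> with part of its power of \<open>k\<close>. The factor
  \<open>k powr ((k + 1) / (2 * k))\<close> is set aside for the summation over the \<open>k\<close>
  levels.\<close>

lemma opt_const_le:
  assumes "1 \<le> \<kappa>" "\<kappa> + j = k"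
  shows "opt_const k * real k powr ((real k + 1) / (2 * real k)) *
      (5 ^ \<kappa> * real \<kappa> ^ \<kappa> * ((5 * real j) ^ j / fact j)) \<le> sqrt 3 * sqrt (fact \<kappa>)"
proof -
  have k: "k \<ge> 1" using assms by simp
  define e where "e = (real k + 1) / (2 * real k)"
  define c :: real where "c = sqrt 6 + 2 * sqrt 3"
  have c: "c \<ge> 5"
  proof -
    have "sqrt 6 \<ge> 2" "sqrt 3 \<ge> 1.5" by (rule real_le_rsqrt, simp add: power2_eq_square)+
    then show ?thesis by (simp add: c_def)
  qed
  have "real k powr (real k + 1.5 + e) = real k ^ k * real k powr 1.5 * real k powr e"
    using k by (simp add: powr_add powr_realpow)
  then have "opt_const k * real k powr e = sqrt (2 * fact k) / (2 * (real k ^ k * real k powr 1.5) * c ^ k)"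
    using k by (simp add: opt_const_def e_def[symmetric] c_def[symmetric])
  also have "\<dots> \<le> sqrt (2 * fact k) / (2 * (real k ^ k * 1) * 5 ^ k)"
    using k c by (intro divide_left_mono mult_mono power_mono ge_one_powr_ge_zero) (auto intro!: mult_pos_pos)
  finally have 1: "opt_const k * real k powr e \<le> sqrt (2 * fact k) / (2 * real k ^ k * 5 ^ k)"
    by simp
  let ?R = "5 ^ \<kappa> * real \<kappa> ^ \<kappa> * ((5 * real j) ^ j / fact j)"
  have "?R = 5 ^ k * (real \<kappa> ^ \<kappa> * (real j ^ j / fact j))"
    using assms(2) by (simp add: power_mult_distrib flip: power_add)
  also have "\<dots> \<le> 5 ^ k * (real k ^ k * fact \<kappa> / fact k)"
    using fact_power_le[OF assms(2)] by (intro mult_left_mono) (auto simp: field_simps)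
  finally have R: "?R \<le> 5 ^ k * (real k ^ k * fact \<kappa> / fact k)" .
  have "opt_const k * real k powr e * ?R \<le>
      sqrt (2 * fact k) / (2 * real k ^ k * 5 ^ k) * (5 ^ k * (real k ^ k * fact \<kappa> / fact k))"
    by (rule mult_mono[OF 1 R]) auto
  also have "\<dots> = sqrt 2 / 2 * (sqrt (fact k) / fact k) * fact \<kappa>"
    using k by (simp add: real_sqrt_mult)
  also have "\<dots> \<le> 1 * (1 / sqrt (fact \<kappa>)) * fact \<kappa>"
  proof (intro mult_mono)
    show "sqrt 2 / 2 \<le> (1 :: real)" using real_le_lsqrt[of 2 2] by simp
    have "sqrt (fact k) / fact k = 1 / sqrt (fact k)" 
      by (metis fact_ge_zero inverse_eq_divide inverse_divide real_div_sqrt)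
    also have "\<dots> \<le> 1 / sqrt (fact \<kappa>)"
      using assms fact_mono[of \<kappa> k, where 'a = real] by (intro divide_left_mono) auto
    finally show "sqrt (fact k) / fact k \<le> 1 / sqrt (fact \<kappa>)" .
  qed auto
  also have "\<dots> = 1 * sqrt (fact \<kappa>)"
    by (simp add: real_div_sqrt)
  also have "\<dots> \<le> sqrt 3 * sqrt (fact \<kappa>)"
    by (intro mult_right_mono) auto
  finally show ?thesis by (simp add: e_def)
qed

section \<open>Contraction of symmetric tensors and a Bohnenblust-Hille type bound\<close>

section \<open>Symmetric tensors\<close>

definition lists_below :: "nat \<Rightarrow> nat \<Rightarrow> nat list set" where
  "lists_below N m = {xs. length xs = m \<and> set xs \<subseteq> {..<N}}"

lemma finite_lists_below [simp]: "finite (lists_below N m)"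
  unfolding lists_below_def using finite_lists_length_eq[of "{..<N}" m]
  by (simp add: conj_commute)

lemma lists_below_0 [simp]: "lists_below N 0 = {[]}"
  by (auto simp: lists_below_def)

lemma sum_lists_Cons:
  "(\<Sum>xs\<in>lists_below N (Suc m). h xs) = (\<Sum>i<N. \<Sum>xs\<in>lists_below N m. h (i # xs))"
proof -
  have eq: "lists_below N (Suc m) = (\<lambda>(i, xs). i # xs) ` ({..<N} \<times> lists_below N m)"
    by (auto simp: lists_below_def length_Suc_conv image_def)
  show ?thesis
    unfolding eq sum.cartesian_product
    by (subst sum.reindex) (auto simp: inj_on_def case_prod_unfold)
qed

text \<open>Most significant digit first. Fixing the head then selects a contiguous block, which is
  what a contraction adds up, while the last index is the remainder modulo \<open>N\<close>, which
  groups the entries by the variable whose influence is measured.\<close>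

primrec enc :: "nat \<Rightarrow> nat list \<Rightarrow> nat" where
  "enc N [] = 0"
| "enc N (x # xs) = x * N ^ length xs + enc N xs"

lemma enc_snoc: "enc N (xs @ [v]) = enc N xs * N + v"
  by (induction xs) (simp_all add: algebra_simps)

lemma enc_less: "xs \<in> lists_below N m \<Longrightarrow> enc N xs < N ^ m"
proof (induction m arbitrary: xs)
  case (Suc m)
  then obtain x ys where xs: "xs = x # ys" "x < N" "ys \<in> lists_below N m"
    by (auto simp: lists_below_def length_Suc_conv)
  have "x * N ^ m + enc N ys < Suc x * N ^ m" using Suc.IH[OF xs(3)] by simp
  also have "\<dots> \<le> N * N ^ m" using xs(2) by (intro mult_right_mono) auto
  finally show ?case using xs by (simp add: lists_below_def)
qed simp

lemma sum_enc: "(\<Sum>w<N ^ m. g w) = (\<Sum>xs\<in>lists_below N m. g (enc N xs))"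
proof (induction m arbitrary: g)
  case (Suc m)
  have "(\<Sum>xs\<in>lists_below N m. g (i * N ^ m + enc N xs)) =
      (\<Sum>xs\<in>lists_below N m. g (enc N (i # xs)))" for i
    by (rule sum.cong) (auto simp: lists_below_def)
  then show ?case
    by (simp add: sum_mult_lessThan Suc sum_lists_Cons del: enc.simps)
qed simp

lemma enc_inj: "inj_on (enc N) (lists_below N m)"
proof (induction m)
  case (Suc m)
  show ?case
  proof (rule inj_onI)
    fix xs ys assume xs: "xs \<in> lists_below N (Suc m)" and ys: "ys \<in> lists_below N (Suc m)"
      and eq: "enc N xs = enc N ys"
    obtain x xs' where x: "xs = x # xs'" "xs' \<in> lists_below N m" "length xs' = m"
      using xs by (auto simp: lists_below_def length_Suc_conv)
    obtain y ys' where y: "ys = y # ys'" "ys' \<in> lists_below N m" "length ys' = m"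
      using ys by (auto simp: lists_below_def length_Suc_conv)
    have less: "enc N xs' < N ^ m" "enc N ys' < N ^ m" using x y enc_less by auto
    have e: "enc N xs' + N ^ m * x = enc N ys' + N ^ m * y"
      using eq x y by (simp add: algebra_simps)
    have "N ^ m \<noteq> 0" using less by linarith
    then have "x = y" using arg_cong[OF e, of "\<lambda>z. z div N ^ m"] less by simp
    moreover have "enc N xs' = enc N ys'" using e calculation by simp
    ultimately show "xs = ys" using Suc x y by (auto dest: inj_onD)
  qed
qed simp

text \<open>Directions are numbered from the end of the list: a contraction removes the head, and
  the tensor of order \<open>m\<close> is contracted with \<open>Y m\<close>.\<close>

primrec tprod :: "(nat \<Rightarrow> nat \<Rightarrow> real) \<Rightarrow> nat list \<Rightarrow> real" where
  "tprod Y [] = 1"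
| "tprod Y (v # xs) = Y (Suc (length xs)) v * tprod Y xs"

text \<open>This is \<open>D\<close> of \<open>greedy_contraction\<close> for a tensor in a flat
  array: the entry with head \<open>j\<close>, middle indices encoded by \<open>q\<close> and last
  index \<open>v\<close> is at \<open>j * (L * N) + (q * N + v)\<close>, where \<open>L\<close>
  counts the tuples of middle indices.\<close>

definition greedy_gap :: "nat \<Rightarrow> nat \<Rightarrow> (nat \<Rightarrow> real) \<Rightarrow> (nat \<Rightarrow> real) \<Rightarrow> nat \<Rightarrow> real" where
  "greedy_gap N L X Y i =
    (let U = \<lambda>w. \<Sum>j<i. Y j * X (j * (L * N) + w);
         a = \<lambda>v. \<Sum>p<N * L. (X (p * N + v))\<^sup>2;
         b = \<lambda>j v. \<Sum>q<L. (X (j * (L * N) + (q * N + v)))\<^sup>2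
     in \<Sum>v<N. (\<Sum>q<L. U (q * N + v) * X (i * (L * N) + (q * N + v))) *
          (9 * a v - 2 * ((\<Sum>q<L. (U (q * N + v))\<^sup>2) + b i v + 3 * (a v - (\<Sum>j<Suc i. b j v)))) /
          (a v * sqrt (a v)))"

definition greedy :: "nat \<Rightarrow> nat \<Rightarrow> (nat \<Rightarrow> real) \<Rightarrow> (nat \<Rightarrow> real) \<Rightarrow> (nat \<Rightarrow> real) \<Rightarrow> bool" where
  "greedy N L X Y U \<longleftrightarrow>
     (\<forall>i<N. Y i = (if greedy_gap N L X Y i < 0 then - 1 else 1)) \<and>
     (\<forall>w<L * N. U w = (\<Sum>j<N. Y j * X (j * (L * N) + w)))"

lemma greedy_norm:
  assumes "greedy N L X Y U"
  shows "(\<Sum>v<N. sqrt (\<Sum>p<N * L. (X (p * N + v))\<^sup>2)) \<le>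
    sqrt 3 * (\<Sum>v<N. sqrt (\<Sum>q<L. (U (q * N + v))\<^sup>2))"
proof -
  have a: "(\<Sum>p<N * L. (X (p * N + v))\<^sup>2) = (\<Sum>i<N. \<Sum>q<L. (X (i * (L * N) + (q * N + v)))\<^sup>2)" for v
    unfolding sum_mult_lessThan by (simp add: algebra_simps)
  have w: "q * N + v < L * N" if "q < L" "v < N" for q v
  proof -
    have "q * N + v < Suc q * N" using that by simp
    also have "\<dots> \<le> L * N" using that by (intro mult_right_mono) auto
    finally show ?thesis .
  qed
  have "(\<Sum>v<N. sqrt (\<Sum>p<N * L. (X (p * N + v))\<^sup>2)) \<le> sqrt 3 *
    (\<Sum>v<N. sqrt (\<Sum>q<L. (\<Sum>j<N. Y j * X (j * (L * N) + (q * N + v)))\<^sup>2))"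
    unfolding a using assms
    by (intro greedy_contraction[where B = "\<lambda>i q v. X (i * (L * N) + (q * N + v))"])
      (simp only: greedy_def greedy_gap_def Let_def a)
  also have "\<dots> = sqrt 3 * (\<Sum>v<N. sqrt (\<Sum>q<L. (U (q * N + v))\<^sup>2))"
    using assms w by (intro arg_cong2[of _ _ _ _ "(*)"] refl sum.cong arg_cong[of _ _ sqrt])
      (auto simp: greedy_def)
  finally show ?thesis .
qed

text \<open>A multilinear form can be evaluated one slot at a time, the head first, so its value at
  all directions is determined by the vector that remains at order 1.\<close>

lemma contraction_value:
  assumes "\<And>m w. 1 \<le> m \<Longrightarrow> m < \<kappa> \<Longrightarrow> w < N ^ m \<Longrightarrow>
      U m w = (\<Sum>j<N. Y (Suc m) j * U (Suc m) (j * N ^ m + w))"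
    and "1 \<le> \<kappa>"
  shows "(\<Sum>xs\<in>lists_below N \<kappa>. U \<kappa> (enc N xs) * tprod Y xs) = (\<Sum>v<N. Y 1 v * U 1 v)"
proof -
  have "1 \<le> m \<Longrightarrow> m \<le> \<kappa> \<Longrightarrow>
      (\<Sum>xs\<in>lists_below N m. U m (enc N xs) * tprod Y xs) = (\<Sum>v<N. Y 1 v * U 1 v)" for m
  proof (induction m)
    case (Suc m)
    show ?case
    proof (cases "m = 0")
      case True
      then show ?thesis by (simp add: sum_lists_Cons mult.commute)
    next
      case False
      have "(\<Sum>xs\<in>lists_below N (Suc m). U (Suc m) (enc N xs) * tprod Y xs) =
          (\<Sum>i<N. \<Sum>xs\<in>lists_below N m. Y (Suc m) i * U (Suc m) (i * N ^ m + enc N xs) * tprod Y xs)"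
        unfolding sum_lists_Cons by (intro sum.cong refl) (auto simp: lists_below_def)
      also have "\<dots> = (\<Sum>xs\<in>lists_below N m. U m (enc N xs) * tprod Y xs)"
        using False Suc.prems enc_less
        by (subst sum.swap) (auto simp: assms(1) sum_distrib_right intro!: sum.cong)
      finally show ?thesis using Suc False by simp
    qed
  qed simp
  then show ?thesis using assms(2) by simp
qed

text \<open>A homogeneous multilinear polynomial of degree \<open>\<kappa>\<close> in
  \<open>N\<close> variables, where \<open>W P\<close> is the monomial of the term \<open>P\<close>.
  As distinct terms have distinct monomials, they do not overlap in the coefficient tensor.\<close>

locale term_family =
  fixes Q :: "'p set" and W :: "'p \<Rightarrow> nat set" and \<alpha> :: "'p \<Rightarrow> real" and \<kappa> N :: nat
  assumes finite_Q: "finite Q"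
    and W_sub: "\<And>P. P \<in> Q \<Longrightarrow> W P \<subseteq> {..<N}"
    and card_W: "\<And>P. P \<in> Q \<Longrightarrow> card (W P) = \<kappa>"
    and inj_W: "inj_on W Q"
    and \<kappa>_pos: "1 \<le> \<kappa>"
begin

text \<open>Each ordering of a monomial carries the full coefficient, without division by
  \<open>fact \<kappa>\<close>; on the diagonal the form is therefore \<open>fact \<kappa>\<close>
  times the polynomial.\<close>

definition tensor :: "nat list \<Rightarrow> real" where
  "tensor xs = (\<Sum>P\<in>Q. if xs \<in> permutations_of_set (W P) then \<alpha> P else 0)"

text \<open>Euclidean norm of the coefficients of the partial derivative with respect to variable
  \<open>v\<close>.\<close>

definition infl :: "nat \<Rightarrow> real" where
  "infl v = sqrt (\<Sum>P\<in>{P \<in> Q. v \<in> W P}. (\<alpha> P)\<^sup>2)"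

definition total_infl :: real where
  "total_infl = (\<Sum>v<N. infl v)"

lemma infl_nonneg: "0 \<le> infl v"
  by (simp add: infl_def sum_nonneg)

lemma total_infl_nonneg: "0 \<le> total_infl"
  by (simp add: total_infl_def sum_nonneg infl_nonneg)

lemma infl_sq: "(infl v)\<^sup>2 = (\<Sum>P\<in>{P \<in> Q. v \<in> W P}. (\<alpha> P)\<^sup>2)"
  by (simp add: infl_def sum_nonneg)

lemma finite_W: "P \<in> Q \<Longrightarrow> finite (W P)"
  using W_sub finite_subset by blast

lemma perm_unique:
  "P \<in> Q \<Longrightarrow> P' \<in> Q \<Longrightarrow> xs \<in> permutations_of_set (W P) \<Longrightarrow>
   xs \<in> permutations_of_set (W P') \<Longrightarrow> P = P'"
  using inj_W by (auto simp: permutations_of_set_def inj_on_def)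

lemma perm_lists: "P \<in> Q \<Longrightarrow> permutations_of_set (W P) \<subseteq> lists_below N \<kappa>"
  using W_sub card_W by (auto simp: permutations_of_set_def lists_below_def simp flip: distinct_card)

lemma sum_if_perm:
  assumes "P \<in> Q" "xs \<in> permutations_of_set (W P)"
  shows "(\<Sum>P\<in>Q. if xs \<in> permutations_of_set (W P) then f P else 0) = f P"
proof -
  have "(\<Sum>P'\<in>Q. if xs \<in> permutations_of_set (W P') then f P' else 0) =
      (\<Sum>P'\<in>Q. if P' = P then f P' else 0)"
    by (intro sum.cong refl if_cong) (use assms perm_unique in blast)
  then show ?thesis using assms finite_Q by simp
qed

lemma tensor_sq:
  "(tensor xs)\<^sup>2 = (\<Sum>P\<in>Q. if xs \<in> permutations_of_set (W P) then (\<alpha> P)\<^sup>2 else 0)"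
proof (cases "\<exists>P\<in>Q. xs \<in> permutations_of_set (W P)")
  case True
  then show ?thesis by (auto simp: tensor_def sum_if_perm)
next
  case False
  then have "(\<Sum>P\<in>Q. if xs \<in> permutations_of_set (W P) then f P else 0) = 0" for f :: "'p \<Rightarrow> real"
    by (intro sum.neutral) auto
  then show ?thesis by (simp add: tensor_def)
qed

text \<open>A term that contains \<open>v\<close> has \<open>fact (\<kappa> - 1)\<close> orderings
  with \<open>v\<close> in the last place, and no entry belongs to two terms.\<close>

lemma sum_tensor_snoc:
  assumes v: "v < N"
  shows "(\<Sum>xs\<in>lists_below N (\<kappa> - 1). (tensor (xs @ [v]))\<^sup>2) = fact (\<kappa> - 1) * (infl v)\<^sup>2"
proof -
  have inner: "(\<Sum>xs\<in>lists_below N (\<kappa> - 1). if xs @ [v] \<in> permutations_of_set (W P) then (\<alpha> P)\<^sup>2 else 0) =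
      (if v \<in> W P then fact (\<kappa> - 1) * (\<alpha> P)\<^sup>2 else 0)" if P: "P \<in> Q" for P
  proof (cases "v \<in> W P")
    case True
    have eq: "{xs \<in> lists_below N (\<kappa> - 1). xs @ [v] \<in> permutations_of_set (W P)} =
        permutations_of_set (W P - {v})"
      using True W_sub[OF P] card_W[OF P] finite_W[OF P]
      by (auto simp: permutations_of_set_def lists_below_def distinct_card[symmetric])
    have "(\<Sum>xs\<in>lists_below N (\<kappa> - 1). if xs @ [v] \<in> permutations_of_set (W P) then (\<alpha> P)\<^sup>2 else 0) =
        (\<Sum>xs\<in>permutations_of_set (W P - {v}). (\<alpha> P)\<^sup>2)"
      unfolding eq[symmetric] by (subst sum.inter_filter) auto
    then show ?thesis using True card_W[OF P] finite_W[OF P] by simp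
  next
    case False
    then have "xs @ [v] \<notin> permutations_of_set (W P)" for xs
      by (auto simp: permutations_of_set_def)
    then show ?thesis using False by simp
  qed
  have "(\<Sum>xs\<in>lists_below N (\<kappa> - 1). (tensor (xs @ [v]))\<^sup>2) =
      (\<Sum>P\<in>Q. if v \<in> W P then fact (\<kappa> - 1) * (\<alpha> P)\<^sup>2 else 0)"
    unfolding tensor_sq by (subst sum.swap) (intro sum.cong refl inner)
  also have "\<dots> = fact (\<kappa> - 1) * (infl v)\<^sup>2"
    unfolding infl_sq sum_distrib_left using finite_Q
    by (simp add: sum.inter_filter del: One_nat_def)
  finally show ?thesis .
qed

lemma sum_lists_tensor:
  "(\<Sum>xs\<in>lists_below N \<kappa>. tensor xs * h xs) = (\<Sum>P\<in>Q. \<alpha> P * (\<Sum>xs\<in>permutations_of_set (W P). h xs))"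
proof -
  have "(\<Sum>xs\<in>lists_below N \<kappa>. tensor xs * h xs) =
      (\<Sum>P\<in>Q. \<Sum>xs\<in>lists_below N \<kappa>. if xs \<in> permutations_of_set (W P) then \<alpha> P * h xs else 0)"
    unfolding tensor_def sum_distrib_right by (subst sum.swap) (auto intro!: sum.cong)
  also have "\<dots> = (\<Sum>P\<in>Q. \<Sum>xs\<in>permutations_of_set (W P). \<alpha> P * h xs)"
  proof (rule sum.cong[OF refl])
    fix P assume "P \<in> Q"
    then show "(\<Sum>xs\<in>lists_below N \<kappa>. if xs \<in> permutations_of_set (W P) then \<alpha> P * h xs else 0) =
        (\<Sum>xs\<in>permutations_of_set (W P). \<alpha> P * h xs)"
      by (subst sum.inter_restrict[symmetric]) (simp_all add: Int_absorb1 perm_lists)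
  qed
  finally show ?thesis by (simp add: sum_distrib_left)
qed

text \<open>\<open>G m\<close> adds up the norms of the slices with fixed last index. It starts at
  \<open>sqrt (fact (\<kappa> - 1)) * total_infl\<close>, and every contraction divides it by at
  most \<open>sqrt 3\<close>. At order 1 the slices are numbers, whose absolute values are reached
  without loss by taking their signs as the last direction. Thus only \<open>\<kappa> - 1\<close>
  factors are lost.\<close>

lemma greedy_directions:
  assumes U: "\<And>xs. xs \<in> lists_below N \<kappa> \<Longrightarrow> U \<kappa> (enc N xs) = tensor xs"
    and greedy: "\<And>m. 1 \<le> m \<Longrightarrow> m < \<kappa> \<Longrightarrow> greedy N (N ^ (m - 1)) (U (Suc m)) (Y (Suc m)) (U m)"
    and Y1: "\<And>v. v < N \<Longrightarrow> Y 1 v = sgn (U 1 v)"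
  shows "sqrt (fact (\<kappa> - 1)) * total_infl \<le>
    sqrt 3 ^ (\<kappa> - 1) * (\<Sum>P\<in>Q. \<alpha> P * (\<Sum>xs\<in>permutations_of_set (W P). tprod Y xs))"
proof -
  define G where "G m = (\<Sum>v<N. sqrt (\<Sum>p<N ^ (m - 1). (U m (p * N + v))\<^sup>2))" for m
  have pow: "N ^ (m - 1) * N = N ^ m" if "1 \<le> m" for m
    using that by (cases m) auto
  have G_step: "G (Suc m) \<le> sqrt 3 * G m" if "1 \<le> m" "m < \<kappa>" for m
    using greedy_norm[OF greedy[OF that]] pow[OF that(1)] by (simp add: G_def mult.commute)
  have "1 \<le> m \<Longrightarrow> m \<le> \<kappa> \<Longrightarrow> G m \<le> sqrt 3 ^ (m - 1) * G 1" for m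
  proof (induction m)
    case (Suc m)
    show ?case
    proof (cases "m = 0")
      case False
      then have "G (Suc m) \<le> sqrt 3 * G m" using Suc.prems by (intro G_step) auto
      also have "\<dots> \<le> sqrt 3 * (sqrt 3 ^ (m - 1) * G 1)"
        using Suc False by (intro mult_left_mono) auto
      also have "\<dots> = sqrt 3 ^ (Suc m - 1) * G 1" using False by (cases m) auto
      finally show ?thesis .
    qed simp
  qed simp
  then have G\<kappa>: "G \<kappa> \<le> sqrt 3 ^ (\<kappa> - 1) * G 1" using \<kappa>_pos by simp
  have "(\<Sum>p<N ^ (\<kappa> - 1). (U \<kappa> (p * N + v))\<^sup>2) = fact (\<kappa> - 1) * (infl v)\<^sup>2" if v: "v < N" for v
  proof -
    have "U \<kappa> (enc N xs * N + v) = tensor (xs @ [v])" if "xs \<in> lists_below N (\<kappa> - 1)" for xs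
      using U[of "xs @ [v]"] that v \<kappa>_pos by (auto simp: enc_snoc lists_below_def)
    then show ?thesis unfolding sum_enc sum_tensor_snoc[OF v, symmetric] by (intro sum.cong) auto
  qed
  then have "G \<kappa> = (\<Sum>v<N. sqrt (fact (\<kappa> - 1) * (infl v)\<^sup>2))" by (simp add: G_def)
  also have "\<dots> = sqrt (fact (\<kappa> - 1)) * total_infl"
    by (simp add: total_infl_def real_sqrt_mult sum_distrib_left infl_nonneg)
  finally have G1: "G \<kappa> = sqrt (fact (\<kappa> - 1)) * total_infl" .
  have "(\<Sum>P\<in>Q. \<alpha> P * (\<Sum>xs\<in>permutations_of_set (W P). tprod Y xs)) =
      (\<Sum>xs\<in>lists_below N \<kappa>. U \<kappa> (enc N xs) * tprod Y xs)"
    unfolding sum_lists_tensor[symmetric] by (simp add: U)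
  also have "\<dots> = (\<Sum>v<N. Y 1 v * U 1 v)"
  proof (rule contraction_value[OF _ \<kappa>_pos])
    fix m w assume m: "1 \<le> m" "m < \<kappa>" and w: "w < N ^ m"
    show "U m w = (\<Sum>j<N. Y (Suc m) j * U (Suc m) (j * N ^ m + w))"
      using greedy[OF m] w pow[OF m(1)] by (simp add: greedy_def)
  qed
  also have "\<dots> = G 1"
    unfolding G_def by (intro sum.cong) (auto simp: Y1[unfolded One_nat_def] sgn_if)
  finally show ?thesis using G\<kappa> G1 by simp
qed

lemma sum_lists_prod: "(\<Sum>xs\<in>lists_below N m. \<Prod>v\<leftarrow>xs. f v) = (\<Sum>v<N. f v) ^ m" for f :: "nat \<Rightarrow> real"
  by (induction m) (simp_all add: sum_lists_Cons flip: sum_product)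

text \<open>The power expands into a sum over all lists of variables. Keeping only the orderings of
  the monomials, which are pairwise disjoint sets of lists, discards nonnegative terms.\<close>

lemma sum_prod_infl: "fact \<kappa> * (\<Sum>P\<in>Q. \<Prod>v\<in>W P. infl v) \<le> total_infl ^ \<kappa>"
proof -
  let ?g = "\<lambda>xs. \<Prod>v\<leftarrow>xs. infl v"
  have g0: "0 \<le> ?g xs" for xs by (induction xs) (auto simp: infl_nonneg)
  have "(\<Sum>xs\<in>permutations_of_set (W P). ?g xs) = fact \<kappa> * (\<Prod>v\<in>W P. infl v)" if P: "P \<in> Q" for P
  proof -
    have "?g xs = (\<Prod>v\<in>W P. infl v)" if "xs \<in> permutations_of_set (W P)" for xs
      using that prod.distinct_set_conv_list[of xs infl] by (simp add: permutations_of_set_def)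
    then show ?thesis using P card_W finite_W by simp
  qed
  then have "fact \<kappa> * (\<Sum>P\<in>Q. \<Prod>v\<in>W P. infl v) = (\<Sum>P\<in>Q. \<Sum>xs\<in>permutations_of_set (W P). ?g xs)"
    by (simp add: sum_distrib_left)
  also have "\<dots> = sum ?g (\<Union>P\<in>Q. permutations_of_set (W P))"
    using finite_Q perm_unique by (intro sum.UNION_disjoint[symmetric]) auto
  also have "\<dots> \<le> sum ?g (lists_below N \<kappa>)"
    using perm_lists g0 by (intro sum_mono2) auto
  finally show ?thesis by (simp add: sum_lists_prod total_infl_def)
qed

text \<open>
  The inequality between the arithmetic and geometric means of \<open>k + 1\<close> suitable numbers for each
  coefficient replaces the mixed-norm inequality in the proof of the Bohnenblust--Hille inequality.
\<close>

lemma sum_coeff_powr: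
  assumes k: "\<kappa> \<le> k"
  shows "(\<Sum>P\<in>Q. \<bar>\<alpha> P\<bar> powr (2 * real k / (real k + 1))) \<le>
    total_infl powr (2 * real k / (real k + 1)) / real \<kappa>"
proof -
  define S where "S = total_infl"
  define r where "r = 2 * real k / (real k + 1)"
  have k1: "k \<ge> 1" using k \<kappa>_pos by simp
  have infl_pos: "0 < infl v" if P: "P \<in> Q" "v \<in> W P" "\<alpha> P \<noteq> 0" for P v
  proof -
    have "0 < (\<alpha> P)\<^sup>2" using P by simp
    also have "\<dots> \<le> (\<Sum>P\<in>{P \<in> Q. v \<in> W P}. (\<alpha> P)\<^sup>2)"
      using P finite_Q by (intro member_le_sum) auto
    finally show ?thesis by (simp add: infl_def)
  qed
  have infl_le: "infl v \<le> S" if "v < N" for v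
    unfolding S_def total_infl_def using that infl_nonneg by (intro member_le_sum) auto
  show ?thesis
  proof (cases "S = 0")
    case True
    have "\<alpha> P = 0" if P: "P \<in> Q" for P
    proof (rule ccontr)
      assume "\<alpha> P \<noteq> 0"
      moreover obtain v where v: "v \<in> W P" using card_W[OF P] \<kappa>_pos by fastforce
      ultimately have "0 < infl v" "v < N" using infl_pos P W_sub by auto
      then show False using infl_le[of v] True by simp
    qed
    then show ?thesis by simp
  next
    case False
    then have S: "S > 0" using total_infl_nonneg by (simp add: S_def)
    \<comment> \<open>This weight makes \<open>c * S\<close> and \<open>S ^ k / c ^ k\<close> both
      equal to \<open>S powr r\<close>, so that all kinds of summands below scale alike.\<close>
    define c where "c = S powr ((real k - 1) / (real k + 1))"
    have c: "c > 0" using S by (simp add: c_def)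
    have cS: "c * S = S powr r"
    proof -
      have "c * S = S powr ((real k - 1) / (real k + 1) + 1)"
        using S by (simp add: c_def powr_add)
      also have "(real k - 1) / (real k + 1) + 1 = r" by (simp add: r_def field_simps)
      finally show ?thesis .
    qed
    have Sc: "S ^ k / c ^ k = S powr r"
    proof -
      have "S ^ k / c ^ k = S powr (real k - (real k - 1) / (real k + 1) * real k)"
        using S by (simp add: c_def powr_diff powr_realpow[symmetric] powr_powr)
      also have "real k - (real k - 1) / (real k + 1) * real k = r"
        by (simp add: r_def field_simps)
      finally show ?thesis .
    qed
    have mean: "\<bar>\<alpha> P\<bar> powr r \<le> (c * (\<Sum>v\<in>W P. (\<alpha> P)\<^sup>2 / infl v) +
        (S ^ (k - \<kappa>) / c ^ k * (\<Prod>v\<in>W P. infl v) + real (k - \<kappa>) * (c * (\<alpha> P)\<^sup>2 / S))) / (real k + 1)"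
      (is "_ \<le> ?R P") if P: "P \<in> Q" for P
    proof (cases "\<alpha> P = 0")
      case True
      have "0 \<le> (\<Prod>v\<in>W P. infl v)" by (intro prod_nonneg) (simp add: infl_nonneg)
      then show ?thesis using True c S by simp
    next
      case False
      define a where "a = (\<alpha> P)\<^sup>2"
      have a: "a > 0" using False by (simp add: a_def)
      \<comment> \<open>The \<open>k + 1\<close> numbers are \<open>\<kappa>\<close> quotients by
        influences, one product of the influences, and \<open>k - \<kappa>\<close> copies of
        \<open>c * a / S\<close>. In their product the influences and the powers of \<open>S\<close>
        and \<open>c\<close> cancel, which leaves \<open>a ^ k\<close>. The copies are what allows
        the exponent belonging to \<open>k\<close> at a level of lower degree.\<close>
      define T where "T = W P <+> {..<Suc (k - \<kappa>)}"
      define x :: "nat + nat \<Rightarrow> real" where "x = case_sum (\<lambda>v. c * a / infl v)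
        (\<lambda>i. if i = 0 then S ^ (k - \<kappa>) / c ^ k * (\<Prod>v\<in>W P. infl v) else c * a / S)"
      have fin: "finite (W P)" using finite_W[OF P] .
      have card: "card T = Suc k"
        using fin card_W[OF P] k by (simp add: T_def card_Plus)
      have \<Pi>: "(\<Prod>v\<in>W P. infl v) > 0"
        using infl_pos[OF P _ False] by (intro prod_pos) auto
      have "(\<Prod>i\<in>T. x i) = (\<Prod>v\<in>W P. c * a / infl v) *
          (S ^ (k - \<kappa>) / c ^ k * (\<Prod>v\<in>W P. infl v) * (c * a / S) ^ (k - \<kappa>))"
        unfolding T_def using fin
        by (subst prod.Plus) (simp_all add: x_def comp_def prod.lessThan_Suc_shift del: prod.lessThan_Suc)
      also have "\<dots> = ((c * a) ^ \<kappa> * (c * a) ^ (k - \<kappa>)) / c ^ k"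
        using \<Pi> S card_W[OF P] by (simp add: prod_dividef power_divide)
      also have "\<dots> = a ^ k"
        using k c by (simp add: power_mult_distrib[of c a k] flip: power_add)
      also have "\<dots> = \<bar>\<alpha> P\<bar> powr (2 * real k)"
        using False by (simp add: a_def powr_realpow[symmetric] powr_powr[symmetric] powr_numeral)
      finally have prod: "(\<Prod>i\<in>T. x i) powr (1 / card T) = \<bar>\<alpha> P\<bar> powr r"
        by (simp add: powr_powr card r_def add.commute)
      have "\<bar>\<alpha> P\<bar> powr r \<le> (\<Sum>i\<in>T. x i / card T)"
        unfolding prod[symmetric]
      proof (rule arith_geom_mean)
        show "finite T" using fin by (simp add: T_def)
        show "T \<noteq> {}" using card by auto
        show "x i \<ge> 0" for i
          using c a S \<Pi> infl_nonneg by (auto simp: x_def split: sum.split)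
      qed
      also have "(\<Sum>i\<in>T. x i / card T) = (\<Sum>i\<in>T. x i) / (real k + 1)"
        by (simp add: sum_divide_distrib card add.commute)
      also have "(\<Sum>i\<in>T. x i) = (\<Sum>v\<in>W P. c * a / infl v) +
          (S ^ (k - \<kappa>) / c ^ k * (\<Prod>v\<in>W P. infl v) + real (k - \<kappa>) * (c * a / S))"
        unfolding T_def using fin
        by (subst sum.Plus) (simp_all add: x_def comp_def sum.lessThan_Suc_shift del: sum.lessThan_Suc)
      finally show ?thesis by (simp add: a_def sum_distrib_left)
    qed
    have swap: "(\<Sum>P\<in>Q. \<Sum>v\<in>W P. f P v) = (\<Sum>v<N. \<Sum>P\<in>{P \<in> Q. v \<in> W P}. f P v)"
      for f :: "'p \<Rightarrow> nat \<Rightarrow> real"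
    proof -
      have "(\<Sum>P\<in>Q. \<Sum>v\<in>W P. f P v) = (\<Sum>P\<in>Q. \<Sum>v<N. if v \<in> W P then f P v else 0)"
      proof (rule sum.cong[OF refl])
        fix P assume "P \<in> Q"
        then show "(\<Sum>v\<in>W P. f P v) = (\<Sum>v<N. if v \<in> W P then f P v else 0)"
          by (subst sum.inter_restrict[symmetric]) (simp_all add: Int_absorb1 W_sub)
      qed
      also have "\<dots> = (\<Sum>v<N. \<Sum>P\<in>{P \<in> Q. v \<in> W P}. f P v)"
        using finite_Q by (subst sum.swap) (simp add: sum.inter_filter)
      finally show ?thesis .
    qed
    have 1: "(\<Sum>P\<in>Q. \<Sum>v\<in>W P. (\<alpha> P)\<^sup>2 / infl v) = S"
      unfolding swap S_def total_infl_def
      by (intro sum.cong refl)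
        (simp only: sum_divide_distrib[symmetric] infl_sq[symmetric], simp add: power2_eq_square)
    \<comment> \<open>Every term is counted once for each of its \<open>\<kappa>\<close> variables,
      and each influence is at most their sum \<open>S\<close>.\<close>
    have 2: "(\<Sum>P\<in>Q. (\<alpha> P)\<^sup>2) \<le> S\<^sup>2 / real \<kappa>"
    proof -
      have "real \<kappa> * (\<Sum>P\<in>Q. (\<alpha> P)\<^sup>2) = (\<Sum>P\<in>Q. \<Sum>v\<in>W P. (\<alpha> P)\<^sup>2)"
        by (simp add: sum_distrib_left card_W)
      also have "\<dots> = (\<Sum>v<N. infl v * infl v)"
        unfolding swap by (simp only: infl_sq[symmetric], simp add: power2_eq_square)
      also have "\<dots> \<le> (\<Sum>v<N. S * infl v)"
        by (intro sum_mono mult_right_mono infl_le infl_nonneg) auto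
      also have "\<dots> = S\<^sup>2"
        by (simp add: sum_distrib_left[symmetric] S_def total_infl_def power2_eq_square)
      finally show ?thesis using \<kappa>_pos by (simp add: field_simps)
    qed
    \<comment> \<open>The factor \<open>fact \<kappa>\<close> of \<open>sum_prod_infl\<close> is
      weakened to \<open>\<kappa>\<close> in order to match the bound before it.\<close>
    have 3: "(\<Sum>P\<in>Q. \<Prod>v\<in>W P. infl v) \<le> S ^ \<kappa> / real \<kappa>"
    proof -
      have "0 \<le> (\<Sum>P\<in>Q. \<Prod>v\<in>W P. infl v)" by (intro sum_nonneg prod_nonneg) (simp add: infl_nonneg)
      then have "real \<kappa> * (\<Sum>P\<in>Q. \<Prod>v\<in>W P. infl v) \<le> fact \<kappa> * (\<Sum>P\<in>Q. \<Prod>v\<in>W P. infl v)"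
        by (intro mult_right_mono) (metis fact_ge_self of_nat_fact of_nat_mono)
      also have "\<dots> \<le> S ^ \<kappa>" unfolding S_def by (rule sum_prod_infl)
      finally show ?thesis using \<kappa>_pos by (simp add: field_simps)
    qed
    have "(\<Sum>P\<in>Q. \<bar>\<alpha> P\<bar> powr r) \<le> (\<Sum>P\<in>Q. ?R P)"
      by (intro sum_mono mean)
    also have "\<dots> = (c * (\<Sum>P\<in>Q. \<Sum>v\<in>W P. (\<alpha> P)\<^sup>2 / infl v) +
        (S ^ (k - \<kappa>) / c ^ k * (\<Sum>P\<in>Q. \<Prod>v\<in>W P. infl v) +
         real (k - \<kappa>) * (c / S) * (\<Sum>P\<in>Q. (\<alpha> P)\<^sup>2))) / (real k + 1)"
      by (simp add: sum_divide_distrib[symmetric] sum.distrib sum_distrib_left mult.assoc)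
    also have "\<dots> \<le> (c * S + (S ^ (k - \<kappa>) / c ^ k * (S ^ \<kappa> / real \<kappa>) +
         real (k - \<kappa>) * (c / S) * (S\<^sup>2 / real \<kappa>))) / (real k + 1)"
      unfolding 1 using c S 2 3
      by (intro divide_right_mono add_mono mult_left_mono) auto
    also have "S ^ (k - \<kappa>) / c ^ k * (S ^ \<kappa> / real \<kappa>) = S powr r / real \<kappa>"
      using k by (simp add: Sc[symmetric] power_add[symmetric])
    also have "real (k - \<kappa>) * (c / S) * (S\<^sup>2 / real \<kappa>) = real (k - \<kappa>) / real \<kappa> * S powr r"
      using S by (simp add: cS[symmetric] power2_eq_square)
    \<comment> \<open>The contributions \<open>1\<close>, \<open>1 / \<kappa>\<close> and
      \<open>(k - \<kappa>) / \<kappa>\<close> add up to \<open>(k + 1) / \<kappa>\<close>, so the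
      size of the mean cancels.\<close>
    also have "(c * S + (S powr r / real \<kappa> + real (k - \<kappa>) / real \<kappa> * S powr r)) / (real k + 1) =
        S powr r / real \<kappa>"
    proof -
      have "c * S + (S powr r / real \<kappa> + real (k - \<kappa>) / real \<kappa> * S powr r) =
          S powr r / real \<kappa> * (real k + 1)"
        unfolding cS using \<kappa>_pos k by (simp add: of_nat_diff field_simps)
      then show ?thesis by simp
    qed
    finally show ?thesis by (simp add: r_def S_def)
  qed
qed

end

section \<open>Polarization of multilinear polynomials by sums over signs\<close>

section \<open>Polarization\<close>

definition signs :: "nat \<Rightarrow> (nat \<Rightarrow> real) set" where
  "signs \<kappa> = {1..\<kappa>} \<rightarrow>\<^sub>E {- 1, 1}"

lemma finite_signs [simp]: "finite (signs \<kappa>)"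
  by (simp add: signs_def finite_PiE)

lemma card_signs: "card (signs \<kappa>) = 2 ^ \<kappa>"
  by (simp add: signs_def card_PiE numeral_2_eq_2)

text \<open>Each map \<open>g\<close> records from which summand the factor at \<open>v\<close> is
  taken. The sum over independent signs factorizes over \<open>j\<close>, where the exponent of
  \<open>\<epsilon> j\<close> is one plus the size of the fibre of \<open>g\<close> over
  \<open>j\<close>; an odd exponent gives zero.\<close>

lemma signs_expansion:
  fixes Y :: "nat \<Rightarrow> nat \<Rightarrow> real"
  assumes "finite W"
  shows "(\<Sum>\<epsilon>\<in>signs \<kappa>. (\<Prod>j\<in>{1..\<kappa>}. \<epsilon> j) * (\<Prod>v\<in>W. \<Sum>j\<in>{1..\<kappa>}. \<epsilon> j * Y j v)) =
    (\<Sum>g\<in>W \<rightarrow>\<^sub>E {1..\<kappa>}. (\<Prod>j\<in>{1..\<kappa>}. if even (card {v \<in> W. g v = j}) then 0 else 2) *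
       (\<Prod>v\<in>W. Y (g v) v))"
proof -
  have "(\<Sum>\<epsilon>\<in>signs \<kappa>. (\<Prod>j\<in>{1..\<kappa>}. \<epsilon> j) * (\<Prod>v\<in>W. \<Sum>j\<in>{1..\<kappa>}. \<epsilon> j * Y j v)) =
      (\<Sum>\<epsilon>\<in>signs \<kappa>. \<Sum>g\<in>W \<rightarrow>\<^sub>E {1..\<kappa>}.
         (\<Prod>j\<in>{1..\<kappa>}. \<epsilon> j) * (\<Prod>v\<in>W. \<epsilon> (g v)) * (\<Prod>v\<in>W. Y (g v) v))"
    using assms by (simp add: prod_sum_PiE sum_distrib_left prod.distrib mult.assoc)
  also have "\<dots> = (\<Sum>g\<in>W \<rightarrow>\<^sub>E {1..\<kappa>}.
      (\<Sum>\<epsilon>\<in>signs \<kappa>. (\<Prod>j\<in>{1..\<kappa>}. \<epsilon> j) * (\<Prod>v\<in>W. \<epsilon> (g v))) * (\<Prod>v\<in>W. Y (g v) v))"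
    by (subst sum.swap) (simp add: sum_distrib_right)
  also have "\<dots> = (\<Sum>g\<in>W \<rightarrow>\<^sub>E {1..\<kappa>}.
      (\<Prod>j\<in>{1..\<kappa>}. if even (card {v \<in> W. g v = j}) then 0 else 2) * (\<Prod>v\<in>W. Y (g v) v))"
  proof (intro sum.cong refl arg_cong2[of _ _ _ _ "(*)"])
    fix g assume g: "g \<in> W \<rightarrow>\<^sub>E {1..\<kappa>}"
    have "(\<Prod>v\<in>W. \<epsilon> (g v)) = (\<Prod>j\<in>{1..\<kappa>}. \<epsilon> j ^ card {v \<in> W. g v = j})" for \<epsilon> :: "nat \<Rightarrow> real"
    proof -
      have "(\<Prod>v\<in>W. \<epsilon> (g v)) = (\<Prod>j\<in>{1..\<kappa>}. \<Prod>v\<in>{v \<in> W. g v = j}. \<epsilon> (g v))"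
        using assms g by (intro prod.group[symmetric]) auto
      also have "\<dots> = (\<Prod>j\<in>{1..\<kappa>}. \<Prod>v\<in>{v \<in> W. g v = j}. \<epsilon> j)"
        by (intro prod.cong) auto
      finally show ?thesis by simp
    qed
    then have "(\<Sum>\<epsilon>\<in>signs \<kappa>. (\<Prod>j\<in>{1..\<kappa>}. \<epsilon> j) * (\<Prod>v\<in>W. \<epsilon> (g v))) =
        (\<Sum>\<epsilon>\<in>signs \<kappa>. \<Prod>j\<in>{1..\<kappa>}. \<epsilon> j ^ Suc (card {v \<in> W. g v = j}))"
      by (simp add: prod.distrib)
    also have "\<dots> = (\<Prod>j\<in>{1..\<kappa>}. \<Sum>e\<in>{- 1, 1}. e ^ Suc (card {v \<in> W. g v = j}))"
      unfolding signs_def by (rule prod_sum_PiE[symmetric]) auto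
    also have "\<dots> = (\<Prod>j\<in>{1..\<kappa>}. if even (card {v \<in> W. g v = j}) then 0 else 2)"
      by (intro prod.cong refl) (auto simp: minus_one_power_iff)
    finally show "(\<Sum>\<epsilon>\<in>signs \<kappa>. (\<Prod>j\<in>{1..\<kappa>}. \<epsilon> j) * (\<Prod>v\<in>W. \<epsilon> (g v))) =
        (\<Prod>j\<in>{1..\<kappa>}. if even (card {v \<in> W. g v = j}) then 0 else 2)" .
  qed
  finally show ?thesis .
qed

lemma not_surj_coeff:
  fixes g :: "'b \<Rightarrow> nat"
  assumes "j \<in> {1..\<kappa>}" "j \<notin> g ` W"
  shows "(\<Prod>j\<in>{1..\<kappa>}. if even (card {v \<in> W. g v = j}) then 0 else 2) = (0 :: real)"
proof -
  have "{v \<in> W. g v = j} = {}" using assms by auto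
  then have "card {v \<in> W. g v = j} = 0" by (simp only: card.empty)
  then show ?thesis using assms(1) by (intro prod_zero bexI[of _ j]) simp_all
qed

text \<open>A map on fewer than \<open>\<kappa>\<close> elements misses some \<open>j\<close>, and
  an empty fibre has even size.\<close>

lemma polarization_less:
  fixes Y :: "nat \<Rightarrow> nat \<Rightarrow> real"
  assumes "finite W" "card W < \<kappa>"
  shows "(\<Sum>\<epsilon>\<in>signs \<kappa>. (\<Prod>j\<in>{1..\<kappa>}. \<epsilon> j) * (\<Prod>v\<in>W. \<Sum>j\<in>{1..\<kappa>}. \<epsilon> j * Y j v)) = 0"
  unfolding signs_expansion[OF assms(1)]
proof (rule sum.neutral, rule ballI)
  fix g assume g: "g \<in> W \<rightarrow>\<^sub>E {1..\<kappa>}"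
  have "card (g ` W) < card {1..\<kappa>}" using card_image_le[OF assms(1), of g] assms(2) by simp
  then have "\<not> {1..\<kappa>} \<subseteq> g ` W" using card_mono[of "g ` W" "{1..\<kappa>}"] assms(1) by auto
  then obtain j where "j \<in> {1..\<kappa>}" "j \<notin> g ` W" by blast
  then show "(\<Prod>j\<in>{1..\<kappa>}. if even (card {v \<in> W. g v = j}) then 0 else 2) * (\<Prod>v\<in>W. Y (g v) v) = 0"
    using not_surj_coeff[of j \<kappa> g W] by simp
qed

lemma tprod_map_rev: "tprod Y (map h (rev [1..<Suc m])) = (\<Prod>j\<in>{1..m}. Y j (h j))"
  by (induction m) (simp_all add: upt_Suc_append del: upt_Suc)

text \<open>Only surjective maps survive. Between two sets of \<open>\<kappa>\<close> elements these
  are the bijections, whose fibres all have size one, and a bijection amounts to an ordering of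
  \<open>W\<close>.\<close>

lemma polarization_eq:
  fixes Y :: "nat \<Rightarrow> nat \<Rightarrow> real"
  assumes W: "finite W" "card W = \<kappa>"
  shows "(\<Sum>\<epsilon>\<in>signs \<kappa>. (\<Prod>j\<in>{1..\<kappa>}. \<epsilon> j) * (\<Prod>v\<in>W. \<Sum>j\<in>{1..\<kappa>}. \<epsilon> j * Y j v)) =
    2 ^ \<kappa> * (\<Sum>xs\<in>permutations_of_set W. tprod Y xs)"
proof -
  define G where "G = {g \<in> W \<rightarrow>\<^sub>E {1..\<kappa>}. bij_betw g W {1..\<kappa>}}"
  \<comment> \<open>The list is reversed because \<open>tprod\<close> numbers its directions from
    the end.\<close>
  define F where "F g = map (inv_into W g) (rev [1..<Suc \<kappa>])" for g
  have set_rev: "set (rev [1..<Suc \<kappa>]) = {1..\<kappa>}" by auto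
  have coeff: "(\<Prod>j\<in>{1..\<kappa>}. if even (card {v \<in> W. g v = j}) then 0 else 2) = (2 :: real) ^ \<kappa>"
    if "g \<in> G" for g
  proof -
    have g: "bij_betw g W {1..\<kappa>}" using that by (simp add: G_def)
    have "{v \<in> W. g v = j} = {inv_into W g j}" if j: "j \<in> {1..\<kappa>}" for j
      using g j by (auto simp: bij_betw_def inv_into_into f_inv_into_f)
    then have "(\<Prod>j\<in>{1..\<kappa>}. if even (card {v \<in> W. g v = j}) then 0 else 2) = (\<Prod>j\<in>{1..\<kappa>}. 2 :: real)"
      by (intro prod.cong) auto
    then show ?thesis by simp
  qed
  have "(\<Sum>\<epsilon>\<in>signs \<kappa>. (\<Prod>j\<in>{1..\<kappa>}. \<epsilon> j) * (\<Prod>v\<in>W. \<Sum>j\<in>{1..\<kappa>}. \<epsilon> j * Y j v)) =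
      (\<Sum>g\<in>G. (\<Prod>j\<in>{1..\<kappa>}. if even (card {v \<in> W. g v = j}) then 0 else 2) * (\<Prod>v\<in>W. Y (g v) v))"
    unfolding signs_expansion[OF W(1)]
  proof (rule sum.mono_neutral_right)
    show "finite (W \<rightarrow>\<^sub>E {1..\<kappa>})" using W by (simp add: finite_PiE)
    show "G \<subseteq> W \<rightarrow>\<^sub>E {1..\<kappa>}" by (auto simp: G_def)
    show "\<forall>g\<in>(W \<rightarrow>\<^sub>E {1..\<kappa>}) - G.
        (\<Prod>j\<in>{1..\<kappa>}. if even (card {v \<in> W. g v = j}) then 0 else 2) * (\<Prod>v\<in>W. Y (g v) v) = 0"
    proof
      fix g assume g: "g \<in> (W \<rightarrow>\<^sub>E {1..\<kappa>}) - G"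
      have "g ` W \<noteq> {1..\<kappa>}"
      proof
        assume "g ` W = {1..\<kappa>}"
        then have "bij_betw g W {1..\<kappa>}"
          using W by (simp add: bij_betw_def eq_card_imp_inj_on)
        then show False using g by (simp add: G_def)
      qed
      moreover have "g ` W \<subseteq> {1..\<kappa>}" using g by (auto simp: PiE_def Pi_def)
      ultimately obtain j where "j \<in> {1..\<kappa>}" "j \<notin> g ` W" by blast
      then show "(\<Prod>j\<in>{1..\<kappa>}. if even (card {v \<in> W. g v = j}) then 0 else 2) * (\<Prod>v\<in>W. Y (g v) v) = 0"
        using not_surj_coeff[of j \<kappa> g W] by simp
    qed
  qed
  also have "\<dots> = (\<Sum>g\<in>G. 2 ^ \<kappa> * tprod Y (F g))"
  proof (intro sum.cong refl arg_cong2[of _ _ _ _ "(*)"] coeff)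
    fix g assume "g \<in> G"
    then have g: "bij_betw g W {1..\<kappa>}" by (simp add: G_def)
    have "tprod Y (F g) = (\<Prod>j\<in>{1..\<kappa>}. Y j (inv_into W g j))"
      unfolding F_def by (rule tprod_map_rev)
    also have "\<dots> = (\<Prod>v\<in>W. Y (g v) (inv_into W g (g v)))"
      by (rule prod.reindex_bij_betw[OF g, symmetric])
    also have "\<dots> = (\<Prod>v\<in>W. Y (g v) v)"
      using g by (intro prod.cong) (auto simp: bij_betw_def)
    finally show "(\<Prod>v\<in>W. Y (g v) v) = tprod Y (F g)" by simp
  qed
  also have "\<dots> = 2 ^ \<kappa> * (\<Sum>xs\<in>F ` G. tprod Y xs)"
  proof -
    have "inj_on F G"
    proof (rule inj_onI, rule ext)
      fix g h v assume gh: "g \<in> G" "h \<in> G" "F g = F h"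
      have eq: "inv_into W g j = inv_into W h j" if "j \<in> {1..\<kappa>}" for j
        using gh(3) that set_rev unfolding F_def by (metis map_eq_conv)
      show "g v = h v"
      proof (cases "v \<in> W")
        case True
        then have "g v \<in> {1..\<kappa>}" "v = inv_into W g (g v)"
          using gh(1) by (auto simp: G_def bij_betw_def)
        then have "v = inv_into W h (g v)" "g v \<in> h ` W"
          using eq gh(2) by (auto simp: G_def bij_betw_def)
        then show ?thesis by (metis f_inv_into_f)
      next
        case False
        then show ?thesis using gh by (auto simp: G_def PiE_def extensional_def)
      qed
    qed
    then show ?thesis by (simp add: sum.reindex sum_distrib_left)
  qed
  also have "F ` G = permutations_of_set W"
  proof (intro equalityI subsetI)
    fix xs assume "xs \<in> F ` G"
    then obtain g where g: "xs = F g" "bij_betw g W {1..\<kappa>}" by (auto simp: G_def)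
    have "bij_betw (inv_into W g) {1..\<kappa>} W" using g(2) by (rule bij_betw_inv_into)
    then show "xs \<in> permutations_of_set W"
      unfolding g(1) F_def permutations_of_set_def mem_Collect_eq distinct_map set_map set_rev
      by (simp add: bij_betw_def)
  next
    fix xs assume "xs \<in> permutations_of_set W"
    then have xs: "set xs = W" "distinct xs" "length xs = \<kappa>"
      using W by (auto simp: permutations_of_set_def distinct_card[symmetric])
    define h where "h j = xs ! (\<kappa> - j)" for j
    have map_h: "map h (rev [1..<Suc \<kappa>]) = xs"
      by (rule nth_equalityI) (use xs in \<open>auto simp: h_def rev_nth simp del: upt_Suc\<close>)
    then have "inj_on h {1..\<kappa>}" "h ` {1..\<kappa>} = W"
      using xs set_rev by (metis distinct_map, metis set_map)
    then have h: "bij_betw h {1..\<kappa>} W" by (simp add: bij_betw_def)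
    define g where "g = restrict (inv_into {1..\<kappa>} h) W"
    have bij: "bij_betw g W {1..\<kappa>}"
      using bij_betw_inv_into[OF h] by (simp add: g_def cong: bij_betw_cong)
    then have "g \<in> G" by (auto simp: G_def bij_betw_def g_def)
    moreover have "F g = xs"
    proof -
      have "inv_into W g j = h j" if j: "j \<in> {1..\<kappa>}" for j
      proof (rule inv_into_f_eq)
        show "inj_on g W" using bij by (simp add: bij_betw_def)
        show "h j \<in> W" "g (h j) = j" using h j by (auto simp: bij_betw_def g_def)
      qed
      then have "F g = map h (rev [1..<Suc \<kappa>])" unfolding F_def using set_rev by (metis map_cong)
      then show ?thesis using map_h by simp
    qed
    ultimately show "xs \<in> F ` G" by blast
  qed
  finally show ?thesis .
qed

section \<open>Homogeneous levels of the energy and the gain of the best candidate\<close>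

section \<open>The energy as a polynomial in the Bloch coordinates\<close>

text \<open>Four cells per qubit make the variable number a plain combination of position and
  letter. The identity has code 0, so the variables \<open>4 * i\<close> occur in no monomial, and
  variable 0 is free to serve as padding.\<close>

definition pauli_vars :: "pauli list \<Rightarrow> nat list" where
  "pauli_vars P = map (\<lambda>i. 4 * i + pauli_code (P ! i)) (pauli_support P)"

definition var_set :: "pauli list \<Rightarrow> nat set" where
  "var_set P = set (pauli_vars P)"

definition bloch_poly :: "nat \<Rightarrow> nat \<Rightarrow> (pauli list \<Rightarrow> real) \<Rightarrow> (nat \<Rightarrow> real) \<Rightarrow> real" where
  "bloch_poly k n \<alpha> x = (\<Sum>P\<in>local_paulis k n. \<alpha> P * (\<Prod>v\<in>var_set P. x v))"

definition level :: "nat \<Rightarrow> nat \<Rightarrow> pauli list set" where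
  "level n \<kappa> = {P. length P = n \<and> pauli_weight P = \<kappa>}"

lemma pauli_code_less: "pauli_code p < 4"
  by (cases p) auto

lemma pauli_code_eq_0_iff [simp]: "pauli_code p = 0 \<longleftrightarrow> p = PI"
  by (cases p) auto

lemma pauli_code_inject [simp]: "pauli_code p = pauli_code q \<longleftrightarrow> p = q"
  by (cases p; cases q) auto

lemma set_pauli_support: "set (pauli_support P) = {i. i < length P \<and> P ! i \<noteq> PI}"
  by (auto simp: pauli_support_def)

lemma distinct_pauli_support: "distinct (pauli_support P)"
  by (simp add: pauli_support_def)

lemma length_pauli_vars [simp]: "length (pauli_vars P) = pauli_weight P"
  by (simp add: pauli_vars_def pauli_weight_def)

lemma inj_var: "inj_on (\<lambda>i. 4 * i + pauli_code (P ! i)) A"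
proof (rule inj_onI)
  fix i j assume "4 * i + pauli_code (P ! i) = 4 * j + pauli_code (P ! j)"
  then have "(4 * i + pauli_code (P ! i)) div 4 = (4 * j + pauli_code (P ! j)) div 4" by simp
  then show "i = j" using pauli_code_less by simp
qed

lemma distinct_pauli_vars: "distinct (pauli_vars P)"
  by (simp add: pauli_vars_def distinct_map distinct_pauli_support inj_var)

lemma card_var_set [simp]: "card (var_set P) = pauli_weight P"
  using distinct_card[OF distinct_pauli_vars] by (simp add: var_set_def)

lemma finite_var_set [simp]: "finite (var_set P)"
  by (simp add: var_set_def)

lemma in_var_set_iff:
  assumes "c < 4"
  shows "4 * i + c \<in> var_set P \<longleftrightarrow> i < length P \<and> P ! i \<noteq> PI \<and> pauli_code (P ! i) = c"
proof -
  have "4 * i + c = 4 * j + pauli_code p \<longleftrightarrow> i = j \<and> c = pauli_code p" for j p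
  proof
    assume eq: "4 * i + c = 4 * j + pauli_code p"
    then have "(4 * i + c) div 4 = (4 * j + pauli_code p) div 4" by simp
    then have "i = j" using assms pauli_code_less by simp
    then show "i = j \<and> c = pauli_code p" using eq by simp
  qed simp
  then show ?thesis
    unfolding var_set_def pauli_vars_def set_map set_pauli_support image_iff by auto
qed

lemma var_set_less: "v \<in> var_set P \<Longrightarrow> v < 4 * length P"
proof -
  assume "v \<in> var_set P"
  then obtain i where i: "i < length P" "v = 4 * i + pauli_code (P ! i)"
    by (auto simp: var_set_def pauli_vars_def set_pauli_support)
  then show "v < 4 * length P" using pauli_code_less[of "P ! i"] by simp
qed

lemma zero_notin_var_set: "0 \<notin> var_set P"
  using in_var_set_iff[of 0 0 P] by auto

lemma var_set_inject:
  assumes "length P = length P'" "var_set P = var_set P'"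
  shows "P = P'"
proof (rule nth_equalityI[OF assms(1)])
  fix i assume i: "i < length P"
  have "P ! i \<noteq> PI \<Longrightarrow> P' ! i = P ! i" "P' ! i \<noteq> PI \<Longrightarrow> P' ! i = P ! i"
    using i assms in_var_set_iff[of "pauli_code (P ! i)" i] in_var_set_iff[of "pauli_code (P' ! i)" i]
      pauli_code_less pauli_code_inject by metis+
  then show "P ! i = P' ! i" by metis
qed

lemma finite_paulis: "finite {P :: pauli list. length P = n}"
proof -
  have "UNIV = {PI, PX, PY, PZ}" using pauli.exhaust by auto
  then have "finite (UNIV :: pauli set)" by (metis finite.emptyI finite.insertI)
  then show ?thesis using finite_lists_length_eq[of "UNIV :: pauli set" n] by simp
qed

lemma finite_local_paulis [simp]: "finite (local_paulis k n)"
  using finite_paulis[of n] by (rule rev_finite_subset) (auto simp: local_paulis_def)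

lemma finite_level [simp]: "finite (level n \<kappa>)"
  using finite_paulis[of n] by (rule rev_finite_subset) (auto simp: level_def)

lemma pauli_weight_eq_0_iff: "pauli_weight P = 0 \<longleftrightarrow> P = replicate (length P) PI"
proof
  assume "pauli_weight P = 0"
  then have "\<forall>i<length P. P ! i = PI"
    using set_pauli_support[of P] by (auto simp: pauli_weight_def)
  then show "P = replicate (length P) PI" by (intro nth_equalityI) auto
next
  assume "P = replicate (length P) PI"
  then have "\<forall>i<length P. P ! i = PI" by (metis nth_replicate)
  then show "pauli_weight P = 0"
    using set_pauli_support[of P] by (auto simp: pauli_weight_def simp flip: set_empty)
qed

lemma level_0: "level n 0 = {replicate n PI}"
  using pauli_weight_eq_0_iff[of "replicate n PI"] by (auto simp: level_def pauli_weight_eq_0_iff)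

lemma sum_local_paulis:
  "(\<Sum>P\<in>local_paulis k n. f P) = f (replicate n PI) + (\<Sum>\<kappa>\<in>{1..k}. \<Sum>P\<in>level n \<kappa>. f P)"
  for f :: "pauli list \<Rightarrow> 'a :: comm_monoid_add"
proof -
  have "local_paulis k n = (\<Union>\<kappa>\<in>{0..k}. level n \<kappa>)"
    by (auto simp: local_paulis_def level_def)
  then have "(\<Sum>P\<in>local_paulis k n. f P) = (\<Sum>\<kappa>\<in>{0..k}. \<Sum>P\<in>level n \<kappa>. f P)"
    by (simp only:) (rule sum.UNION_disjoint, simp, simp, auto simp: level_def)
  also have "\<dots> = (\<Sum>P\<in>level n 0. f P) + (\<Sum>\<kappa>\<in>{1..k}. \<Sum>P\<in>level n \<kappa>. f P)"
    by (subst sum.atLeast_Suc_atMost) auto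
  finally show ?thesis by (simp add: level_0)
qed

lemma sum_nonidentity_paulis:
  "(\<Sum>P\<in>local_paulis k n - {replicate n PI}. f P) = (\<Sum>\<kappa>\<in>{1..k}. \<Sum>P\<in>level n \<kappa>. f P)"
  for f :: "pauli list \<Rightarrow> real"
proof -
  have "replicate n PI \<in> local_paulis k n"
    using pauli_weight_eq_0_iff[of "replicate n PI"] by (simp add: local_paulis_def)
  then show ?thesis using sum_local_paulis[of f k n] by (simp add: sum_diff1)
qed

lemma bloch_poly_levels:
  "bloch_poly k n \<alpha> x = \<alpha> (replicate n PI) + (\<Sum>\<kappa>\<in>{1..k}. \<Sum>P\<in>level n \<kappa>. \<alpha> P * (\<Prod>v\<in>var_set P. x v))"
proof -
  have "card (var_set (replicate n PI)) = 0"
    using pauli_weight_eq_0_iff[of "replicate n PI"] by simp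
  then have "var_set (replicate n PI) = {}" by (simp del: card_var_set)
  then show ?thesis by (simp add: bloch_poly_def sum_local_paulis)
qed

lemma term_family_level:
  assumes "1 \<le> \<kappa>"
  shows "term_family (level n \<kappa>) var_set \<kappa> (4 * n)"
proof
  show "finite (level n \<kappa>)" by simp
  show "inj_on var_set (level n \<kappa>)"
    by (rule inj_onI, rule var_set_inject) (auto simp: level_def)
qed (use assms var_set_less in \<open>auto simp: level_def\<close>)

definition level_infl :: "nat \<Rightarrow> (pauli list \<Rightarrow> real) \<Rightarrow> nat \<Rightarrow> real" where
  "level_infl n \<alpha> \<kappa> = term_family.total_infl (level n \<kappa>) var_set \<alpha> (4 * n)"

definition directional_sum :: "nat \<Rightarrow> (pauli list \<Rightarrow> real) \<Rightarrow> nat \<Rightarrow> (nat \<Rightarrow> nat \<Rightarrow> real) \<Rightarrow> real" where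
  "directional_sum n \<alpha> \<kappa> Y = (\<Sum>P\<in>level n \<kappa>. \<alpha> P * (\<Sum>xs\<in>permutations_of_set (var_set P). tprod Y xs))"

text \<open>Division by \<open>\<kappa>\<close> compensates for the number of summands, and division
  by \<open>sqrt 3\<close> leads into the cube of means that the rounding can realize.\<close>

definition candidate :: "nat \<Rightarrow> nat \<Rightarrow> (nat \<Rightarrow> real) \<Rightarrow> nat \<Rightarrow> (nat \<Rightarrow> nat \<Rightarrow> real) \<Rightarrow> nat \<Rightarrow> real" where
  "candidate k \<kappa> \<epsilon> l Y v = scale (k - \<kappa>) l / (real \<kappa> * sqrt 3) * (\<Sum>j\<in>{1..\<kappa>}. \<epsilon> j * Y j v)"

text \<open>In the signed average of the deviations at the candidates, the parts below degree
  \<open>\<kappa>\<close> vanish, so \<open>s ^ \<kappa>\<close> divides it as a polynomial in the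
  scale \<open>s\<close>. The quotient has degree at most \<open>k - \<kappa>\<close>, and its
  constant term is the directional sum divided by
  \<open>(real \<kappa> * sqrt 3) ^ \<kappa>\<close>; \<open>extrapolation_bound\<close> controls
  this term by the values at the nodes.\<close>

lemma directional_sum_le:
  assumes \<kappa>: "1 \<le> \<kappa>" "\<kappa> \<le> k"
    and G: "\<And>\<epsilon> l. \<epsilon> \<in> signs \<kappa> \<Longrightarrow> l \<le> k - \<kappa> \<Longrightarrow>
      \<bar>bloch_poly k n \<alpha> (candidate k \<kappa> \<epsilon> l Y) - \<alpha> (replicate n PI)\<bar> \<le> G"
  shows "directional_sum n \<alpha> \<kappa> Y \<le>
    (real \<kappa> * sqrt 3) ^ \<kappa> * (G * (5 / 3) ^ \<kappa> * ((5 * real (k - \<kappa>)) ^ (k - \<kappa>) / fact (k - \<kappa>)))"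
proof -
  define j where "j = k - \<kappa>"
  define z where "z = real \<kappa> * sqrt 3"
  have z: "z > 0" using \<kappa> by (simp add: z_def)
  define L where "L \<epsilon> v = (\<Sum>j\<in>{1..\<kappa>}. \<epsilon> j * Y j v)" for \<epsilon> :: "nat \<Rightarrow> real" and v
  define A where "A d = (\<Sum>\<epsilon>\<in>signs \<kappa>. (\<Prod>j\<in>{1..\<kappa>}. \<epsilon> j) *
    (\<Sum>P\<in>level n d. \<alpha> P * (\<Prod>v\<in>var_set P. L \<epsilon> v)))" for d
  have A_swap: "A d = (\<Sum>P\<in>level n d. \<alpha> P *
      (\<Sum>\<epsilon>\<in>signs \<kappa>. (\<Prod>j\<in>{1..\<kappa>}. \<epsilon> j) * (\<Prod>v\<in>var_set P. L \<epsilon> v)))" for d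
    unfolding A_def sum_distrib_left by (subst sum.swap) (simp add: mult.left_commute)
  have A_less: "A d = 0" if "d < \<kappa>" for d
    unfolding A_swap L_def
    by (rule sum.neutral) (use that in \<open>simp add: level_def polarization_less[unfolded One_nat_def]\<close>)
  have A_eq: "A \<kappa> = 2 ^ \<kappa> * directional_sum n \<alpha> \<kappa> Y"
    unfolding A_swap L_def directional_sum_def sum_distrib_left[of "2 ^ \<kappa>"]
  proof (rule sum.cong[OF refl])
    fix P assume "P \<in> level n \<kappa>"
    then show "\<alpha> P * (\<Sum>\<epsilon>\<in>signs \<kappa>. (\<Prod>j\<in>{1..\<kappa>}. \<epsilon> j) * (\<Prod>v\<in>var_set P. \<Sum>j\<in>{1..\<kappa>}. \<epsilon> j * Y j v)) =
        2 ^ \<kappa> * (\<alpha> P * (\<Sum>xs\<in>permutations_of_set (var_set P). tprod Y xs))"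
      using polarization_eq[of "var_set P" \<kappa> Y] by (simp add: level_def)
  qed
  \<comment> \<open>Coefficients of the signed average as a polynomial in the scale, after division
    by \<open>s ^ \<kappa>\<close>.\<close>
  define c where "c i = A (\<kappa> + i) / 2 ^ \<kappa> / z ^ (\<kappa> + i)" for i
  have bound: "\<bar>\<Sum>i\<le>j. c i * scale j l ^ i\<bar> \<le> G * (5 / 3) ^ \<kappa>" if l: "l \<le> j" for l
  proof -
    define s where "s = scale j l"
    have s: "3 / 5 \<le> s" "s \<le> 1" using scale_bounds[OF l] by (auto simp: s_def)
    have scaled: "(\<Sum>P\<in>level n d. \<alpha> P * (\<Prod>v\<in>var_set P. u * L \<epsilon> v)) =
        u ^ d * (\<Sum>P\<in>level n d. \<alpha> P * (\<Prod>v\<in>var_set P. L \<epsilon> v))" for d u \<epsilon>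
      unfolding sum_distrib_left by (intro sum.cong refl) (simp add: prod.distrib level_def)
    have diff: "bloch_poly k n \<alpha> (candidate k \<kappa> \<epsilon> l Y) - \<alpha> (replicate n PI) =
        (\<Sum>d\<in>{1..k}. (s / z) ^ d * (\<Sum>P\<in>level n d. \<alpha> P * (\<Prod>v\<in>var_set P. L \<epsilon> v)))" for \<epsilon>
      unfolding bloch_poly_levels candidate_def j_def[symmetric] s_def[symmetric] z_def[symmetric]
        L_def[symmetric] scaled by simp
    have "(\<Sum>\<epsilon>\<in>signs \<kappa>. (\<Prod>j\<in>{1..\<kappa>}. \<epsilon> j) *
        (bloch_poly k n \<alpha> (candidate k \<kappa> \<epsilon> l Y) - \<alpha> (replicate n PI))) = (\<Sum>d\<in>{1..k}. (s / z) ^ d * A d)"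
      unfolding diff A_def sum_distrib_left[of "(s / z) ^ d" for d]
      by (simp add: sum_distrib_left, subst sum.swap) (simp add: mult.left_commute)
    also have "\<dots> = (\<Sum>d\<in>{\<kappa>..k}. (s / z) ^ d * A d)"
      using \<kappa> A_less by (intro sum.mono_neutral_right) auto
    also have "\<dots> = (\<Sum>i\<le>j. (s / z) ^ (\<kappa> + i) * A (\<kappa> + i))"
      using \<kappa> by (intro sum.reindex_bij_witness[of _ "\<lambda>i. \<kappa> + i" "\<lambda>d. d - \<kappa>"]) (auto simp: j_def)
    also have "\<dots> = 2 ^ \<kappa> * s ^ \<kappa> * (\<Sum>i\<le>j. c i * s ^ i)"
      unfolding sum_distrib_left by (intro sum.cong refl) (simp add: c_def power_divide power_add)
    finally have eq: "2 ^ \<kappa> * s ^ \<kappa> * (\<Sum>i\<le>j. c i * s ^ i) = (\<Sum>\<epsilon>\<in>signs \<kappa>. (\<Prod>j\<in>{1..\<kappa>}. \<epsilon> j) *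
        (bloch_poly k n \<alpha> (candidate k \<kappa> \<epsilon> l Y) - \<alpha> (replicate n PI)))" ..
    have "2 ^ \<kappa> * s ^ \<kappa> * \<bar>\<Sum>i\<le>j. c i * s ^ i\<bar> = \<bar>2 ^ \<kappa> * s ^ \<kappa> * (\<Sum>i\<le>j. c i * s ^ i)\<bar>"
      using s by (simp add: abs_mult)
    also have "\<dots> \<le> (\<Sum>\<epsilon>\<in>signs \<kappa>. \<bar>(\<Prod>j\<in>{1..\<kappa>}. \<epsilon> j) *
        (bloch_poly k n \<alpha> (candidate k \<kappa> \<epsilon> l Y) - \<alpha> (replicate n PI))\<bar>)"
      unfolding eq by (rule sum_abs)
    also have "\<dots> \<le> (\<Sum>\<epsilon>\<in>signs \<kappa>. G)"
    proof (rule sum_mono)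
      fix \<epsilon> assume \<epsilon>: "\<epsilon> \<in> signs \<kappa>"
      have "\<bar>\<Prod>j\<in>{1..\<kappa>}. \<epsilon> j\<bar> = (\<Prod>j\<in>{1..\<kappa>}. 1)"
        unfolding abs_prod
      proof (rule prod.cong[OF refl])
        fix j assume "j \<in> {1..\<kappa>}"
        then have "\<epsilon> j \<in> {- 1, 1}" using \<epsilon> unfolding signs_def by (rule PiE_mem[rotated])
        then show "\<bar>\<epsilon> j\<bar> = 1" by auto
      qed
      then show "\<bar>(\<Prod>j\<in>{1..\<kappa>}. \<epsilon> j) *
          (bloch_poly k n \<alpha> (candidate k \<kappa> \<epsilon> l Y) - \<alpha> (replicate n PI))\<bar> \<le> G"
        using G[OF \<epsilon>] l by (simp add: abs_mult j_def)
    qed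
    also have "\<dots> = 2 ^ \<kappa> * G" by (simp add: card_signs)
    finally have 1: "s ^ \<kappa> * \<bar>\<Sum>i\<le>j. c i * s ^ i\<bar> \<le> G" by simp
    \<comment> \<open>All nodes are at least 3/5, so dividing by \<open>s ^ \<kappa>\<close> costs
      at most \<open>(5 / 3) ^ \<kappa>\<close>.\<close>
    have "(3 / 5) ^ \<kappa> * \<bar>\<Sum>i\<le>j. c i * s ^ i\<bar> \<le> s ^ \<kappa> * \<bar>\<Sum>i\<le>j. c i * s ^ i\<bar>"
      using s by (intro mult_right_mono power_mono) auto
    then have "(5 / 3) ^ \<kappa> * ((3 / 5) ^ \<kappa> * \<bar>\<Sum>i\<le>j. c i * s ^ i\<bar>) \<le> (5 / 3) ^ \<kappa> * G"
      using 1 by (intro mult_left_mono) auto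
    then show ?thesis
      by (simp add: s_def power_mult_distrib[symmetric] mult.assoc[symmetric] mult.commute)
  qed
  have "\<bar>c 0\<bar> \<le> G * (5 / 3) ^ \<kappa> * ((5 * real j) ^ j / fact j)"
    by (rule extrapolation_bound[OF bound])
  moreover have "c 0 = directional_sum n \<alpha> \<kappa> Y / z ^ \<kappa>" by (simp add: c_def A_eq)
  ultimately have "directional_sum n \<alpha> \<kappa> Y / z ^ \<kappa> \<le> G * (5 / 3) ^ \<kappa> * ((5 * real j) ^ j / fact j)"
    by linarith
  then have "z ^ \<kappa> * (directional_sum n \<alpha> \<kappa> Y / z ^ \<kappa>) \<le>
      z ^ \<kappa> * (G * (5 / 3) ^ \<kappa> * ((5 * real j) ^ j / fact j))"
    using z by (intro mult_left_mono) auto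
  moreover have "z ^ \<kappa> * (directional_sum n \<alpha> \<kappa> Y / z ^ \<kappa>) = directional_sum n \<alpha> \<kappa> Y"
    using z by simp
  ultimately show ?thesis unfolding j_def z_def by simp
qed

lemma opt_const_pos: "1 \<le> k \<Longrightarrow> 0 < opt_const k"
  by (auto simp: opt_const_def intro!: divide_pos_pos mult_pos_pos add_pos_pos zero_less_power)

text \<open>If no candidate deviates by more than \<open>G\<close>, every level has a small total
  influence and hence small coefficients. Each level receives the share \<open>1 / k\<close> of
  \<open>(G / C) powr r\<close>, so the \<open>k\<close> levels add up exactly to what is
  claimed.\<close>

lemma best_candidate_bound:
  assumes k: "1 \<le> k"
    and Y: "\<And>\<kappa>. \<kappa> \<in> {1..k} \<Longrightarrow>
      sqrt (fact (\<kappa> - 1)) * level_infl n \<alpha> \<kappa> \<le> sqrt 3 ^ (\<kappa> - 1) * directional_sum n \<alpha> \<kappa> (Y \<kappa>)"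
    and G: "\<And>\<kappa> \<epsilon> l. \<kappa> \<in> {1..k} \<Longrightarrow> \<epsilon> \<in> signs \<kappa> \<Longrightarrow> l \<le> k - \<kappa> \<Longrightarrow>
      \<bar>bloch_poly k n \<alpha> (candidate k \<kappa> \<epsilon> l (Y \<kappa>)) - \<alpha> (replicate n PI)\<bar> \<le> G"
  shows "opt_const k * (\<Sum>P\<in>local_paulis k n - {replicate n PI}.
      \<bar>\<alpha> P\<bar> powr (2 * real k / (real k + 1))) powr ((real k + 1) / (2 * real k)) \<le> G"
proof -
  define r where "r = 2 * real k / (real k + 1)"
  define e where "e = (real k + 1) / (2 * real k)"
  have "real k > 0" "real k + 1 > 0" using k by auto
  then have re: "e * r = 1" "r > 0" "e > 0" by (simp_all add: r_def e_def)
  define C where "C = opt_const k"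
  have C: "C > 0" using opt_const_pos[OF k] by (simp add: C_def)
  \<comment> \<open>Level 1 has at least one candidate, so \<open>G\<close> bounds an absolute
    value.\<close>
  have "(\<lambda>_\<in>{1..1}. 1) \<in> signs 1" by (auto simp: signs_def)
  then have G0: "G \<ge> 0" using G[of 1 "\<lambda>_\<in>{1..1}. 1" 0] k by fastforce
  \<comment> \<open>The factor \<open>\<kappa> powr e\<close> is what the division by
    \<open>\<kappa>\<close> in \<open>sum_coeff_powr\<close> can absorb: raised to the power
    \<open>r\<close>, the reciprocal of \<open>e\<close>, it becomes \<open>\<kappa>\<close> and
    cancels, while \<open>k powr e\<close> turns into the share \<open>1 / k\<close>.\<close>
  have infl: "level_infl n \<alpha> \<kappa> \<le> G / C * (real \<kappa> powr e / real k powr e)" if \<kappa>: "\<kappa> \<in> {1..k}" for \<kappa>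
  proof -
    define j where "j = k - \<kappa>"
    define M where "M = 5 ^ \<kappa> * real \<kappa> ^ \<kappa> * ((5 * real j) ^ j / fact j)"
    have M0: "M \<ge> 0" by (simp add: M_def)
    have "sqrt (fact (\<kappa> - 1)) * level_infl n \<alpha> \<kappa> \<le> sqrt 3 ^ (\<kappa> - 1) * directional_sum n \<alpha> \<kappa> (Y \<kappa>)"
      by (rule Y[OF \<kappa>])
    also have "\<dots> \<le> sqrt 3 ^ (\<kappa> - 1) * ((real \<kappa> * sqrt 3) ^ \<kappa> *
        (G * (5 / 3) ^ \<kappa> * ((5 * real j) ^ j / fact j)))"
      unfolding j_def using \<kappa> G[OF \<kappa>] by (intro mult_left_mono directional_sum_le) auto
    finally have "sqrt 3 * (sqrt (fact (\<kappa> - 1)) * level_infl n \<alpha> \<kappa>) \<le> sqrt 3 * (sqrt 3 ^ (\<kappa> - 1) *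
        ((real \<kappa> * sqrt 3) ^ \<kappa> * (G * (5 / 3) ^ \<kappa> * ((5 * real j) ^ j / fact j))))"
      by (intro mult_left_mono) auto
    also have "\<dots> = (sqrt 3 * sqrt 3 ^ (\<kappa> - 1)) * ((real \<kappa> * sqrt 3) ^ \<kappa> *
        (G * (5 / 3) ^ \<kappa> * ((5 * real j) ^ j / fact j)))" by simp
    also have "sqrt 3 * sqrt 3 ^ (\<kappa> - 1) = sqrt 3 ^ \<kappa>"
      using \<kappa> by (cases \<kappa>) auto
    also have "sqrt 3 ^ \<kappa> * ((real \<kappa> * sqrt 3) ^ \<kappa> * (G * (5 / 3) ^ \<kappa> * ((5 * real j) ^ j / fact j))) =
        (sqrt 3 * sqrt 3 * (5 / 3)) ^ \<kappa> * real \<kappa> ^ \<kappa> * ((5 * real j) ^ j / fact j) * G"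
      unfolding power_mult_distrib by (simp only: ac_simps)
    also have "\<dots> = M * G" by (simp add: M_def)
    finally have 1: "sqrt 3 * (sqrt (fact (\<kappa> - 1)) * level_infl n \<alpha> \<kappa>) \<le> M * G" .
    have "C * real k powr e * (sqrt 3 * (sqrt (fact (\<kappa> - 1)) * level_infl n \<alpha> \<kappa>)) \<le>
        C * real k powr e * (M * G)"
      using 1 C by (intro mult_left_mono) auto
    also have "\<dots> = C * real k powr e * M * G" by simp
    also have "\<dots> \<le> sqrt 3 * sqrt (fact \<kappa>) * G"
      using opt_const_le[of \<kappa> j k] \<kappa> G0 by (intro mult_right_mono) (auto simp: C_def e_def M_def j_def)
    also have "sqrt (fact \<kappa>) = sqrt (fact (\<kappa> - 1)) * sqrt (real \<kappa>)"
      using \<kappa> by (cases \<kappa>) (auto simp: real_sqrt_mult[symmetric] mult.commute)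
    finally have "(sqrt 3 * sqrt (fact (\<kappa> - 1))) * (C * real k powr e * level_infl n \<alpha> \<kappa>) \<le>
        (sqrt 3 * sqrt (fact (\<kappa> - 1))) * (sqrt (real \<kappa>) * G)"
      by (simp only: ac_simps)
    then have 2: "C * real k powr e * level_infl n \<alpha> \<kappa> \<le> sqrt (real \<kappa>) * G"
      by (subst (asm) mult_le_cancel_left_pos) auto
    \<comment> \<open>The surplus \<open>sqrt \<kappa>\<close>, left over from
      \<open>fact \<kappa> = \<kappa> * fact (\<kappa> - 1)\<close>, fits below
      \<open>\<kappa> powr e\<close> because the exponent is at least one half.\<close>
    have "1 / 2 \<le> e" using k by (simp add: e_def field_simps)
    then have "sqrt (real \<kappa>) \<le> real \<kappa> powr e"
      using \<kappa> by (subst powr_half_sqrt[symmetric]) (auto intro: powr_mono)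
    then have "C * real k powr e * level_infl n \<alpha> \<kappa> \<le> real \<kappa> powr e * G"
      using 2 G0 mult_right_mono order_trans by blast
    then show ?thesis using C k by (simp add: field_simps)
  qed
  have level: "(\<Sum>P\<in>level n \<kappa>. \<bar>\<alpha> P\<bar> powr r) \<le> (G / C) powr r / real k" if \<kappa>: "\<kappa> \<in> {1..k}" for \<kappa>
  proof -
    interpret term_family "level n \<kappa>" var_set \<alpha> \<kappa> "4 * n"
      using term_family_level \<kappa> by auto
    have "(\<Sum>P\<in>level n \<kappa>. \<bar>\<alpha> P\<bar> powr r) \<le> total_infl powr r / real \<kappa>"
      unfolding r_def using \<kappa> by (intro sum_coeff_powr) auto
    also have "\<dots> \<le> (G / C * (real \<kappa> powr e / real k powr e)) powr r / real \<kappa>"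
      using infl[OF \<kappa>] total_infl_nonneg re
      by (intro divide_right_mono powr_mono2) (auto simp: level_infl_def)
    also have "\<dots> = (G / C) powr r * (real \<kappa> / real k) / real \<kappa>"
      using G0 C k re by (simp add: powr_mult powr_divide powr_powr)
    also have "\<dots> = (G / C) powr r / real k" using \<kappa> by simp
    finally show ?thesis .
  qed
  have "(\<Sum>P\<in>local_paulis k n - {replicate n PI}. \<bar>\<alpha> P\<bar> powr r) \<le> (\<Sum>\<kappa>\<in>{1..k}. (G / C) powr r / real k)"
    unfolding sum_nonidentity_paulis by (intro sum_mono level)
  also have "\<dots> = (G / C) powr r" using k by simp
  finally have "(\<Sum>P\<in>local_paulis k n - {replicate n PI}. \<bar>\<alpha> P\<bar> powr r) powr e \<le> ((G / C) powr r) powr e"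
    using re by (intro powr_mono2 sum_nonneg) auto
  also have "\<dots> = G / C" using re G0 C by (simp add: powr_powr mult.commute)
  finally show ?thesis using C by (simp add: r_def e_def C_def field_simps)
qed

section \<open>Kronecker products and expectation values of Pauli observables\<close>

section \<open>Tensor products\<close>

lemma sum_mult_atLeast0LessThan:
  fixes g :: "nat \<Rightarrow> nat \<Rightarrow> 'a :: comm_monoid_add"
  shows "(\<Sum>l = 0..<a * b. g (l div b) (l mod b)) = (\<Sum>i = 0..<a. \<Sum>j = 0..<b. g i j)"
proof -
  have "(\<Sum>l = 0..<a * b. g (l div b) (l mod b)) =
      (\<Sum>i<a. \<Sum>j<b. g ((i * b + j) div b) ((i * b + j) mod b))"
    using sum_mult_lessThan[of "\<lambda>l. g (l div b) (l mod b)" a b] by (simp add: lessThan_atLeast0)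
  also have "\<dots> = (\<Sum>i<a. \<Sum>j<b. g i j)"
    by (intro sum.cong refl) auto
  finally show ?thesis by (simp add: lessThan_atLeast0)
qed

lemma div_mod_less:
  assumes "i < a * (b :: nat)"
  shows "i div b < a" "i mod b < b"
  using assms by (auto simp: less_mult_imp_div_less intro!: mod_less_divisor gr0I)

lemma kron_mat_carrier [simp]:
  "A \<in> carrier_mat a a' \<Longrightarrow> B \<in> carrier_mat b b' \<Longrightarrow> kron_mat A B \<in> carrier_mat (a * b) (a' * b')"
  by (auto simp: kron_mat_def)

lemma kron_vec_carrier [simp]:
  "v \<in> carrier_vec a \<Longrightarrow> w \<in> carrier_vec b \<Longrightarrow> kron_vec v w \<in> carrier_vec (a * b)"
  by (auto simp: kron_vec_def)

lemma kron_mat_index: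
  assumes "A \<in> carrier_mat a a'" "B \<in> carrier_mat b b'" "i < a * b" "j < a' * b'"
  shows "kron_mat A B $$ (i, j) = A $$ (i div b, j div b') * B $$ (i mod b, j mod b')"
  using assms by (auto simp: kron_mat_def)

lemma kron_mat_mult_vec:
  assumes A: "A \<in> carrier_mat a a" and B: "B \<in> carrier_mat b b"
    and v: "v \<in> carrier_vec a" and w: "w \<in> carrier_vec b"
  shows "kron_mat A B *\<^sub>v kron_vec v w = kron_vec (A *\<^sub>v v) (B *\<^sub>v w)"
proof (rule eq_vecI)
  fix i assume "i < dim_vec (kron_vec (A *\<^sub>v v) (B *\<^sub>v w))"
  then have i: "i < a * b" using A B by (simp add: kron_vec_def)
  note less = div_mod_less[OF i]
  have "(kron_mat A B *\<^sub>v kron_vec v w) $ i =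
      (\<Sum>l = 0..<a * b. A $$ (i div b, l div b) * B $$ (i mod b, l mod b) * (v $ (l div b) * w $ (l mod b)))"
    using A B v w i
    by (auto simp: scalar_prod_def kron_vec_def kron_mat_index[OF A B] mult_mat_vec_def kron_mat_def)
  also have "\<dots> = (\<Sum>p = 0..<a. \<Sum>q = 0..<b. A $$ (i div b, p) * B $$ (i mod b, q) * (v $ p * w $ q))"
    by (rule sum_mult_atLeast0LessThan)
  also have "\<dots> = (\<Sum>p = 0..<a. A $$ (i div b, p) * v $ p) * (\<Sum>q = 0..<b. B $$ (i mod b, q) * w $ q)"
    by (simp add: sum_product mult_ac)
  also have "\<dots> = kron_vec (A *\<^sub>v v) (B *\<^sub>v w) $ i"
    using A B v w i less by (auto simp: kron_vec_def scalar_prod_def)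
  finally show "(kron_mat A B *\<^sub>v kron_vec v w) $ i = kron_vec (A *\<^sub>v v) (B *\<^sub>v w) $ i" .
qed (use assms in \<open>simp add: kron_vec_def kron_mat_def\<close>)

text \<open>Mixed-product property: splitting the summation index into quotient and remainder
  separates the two factors.\<close>

lemma kron_mat_mult:
  assumes A: "A \<in> carrier_mat a a" and B: "B \<in> carrier_mat b b"
    and C: "C \<in> carrier_mat a a" and D: "D \<in> carrier_mat b b"
  shows "kron_mat A B * kron_mat C D = kron_mat (A * C) (B * D)"
proof (rule eq_matI)
  fix i j assume "i < dim_row (kron_mat (A * C) (B * D))" "j < dim_col (kron_mat (A * C) (B * D))"
  then have i: "i < a * b" and j: "j < a * b" using A B C D by (auto simp: kron_mat_def)
  note less = div_mod_less[OF i] div_mod_less[OF j]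
  have "(kron_mat A B * kron_mat C D) $$ (i, j) =
      (\<Sum>l = 0..<a * b. A $$ (i div b, l div b) * B $$ (i mod b, l mod b) *
         (C $$ (l div b, j div b) * D $$ (l mod b, j mod b)))"
    using A B C D i j by (auto simp: scalar_prod_def kron_mat_def)
  also have "\<dots> = (\<Sum>p = 0..<a. \<Sum>q = 0..<b. A $$ (i div b, p) * B $$ (i mod b, q) *
      (C $$ (p, j div b) * D $$ (q, j mod b)))"
    by (rule sum_mult_atLeast0LessThan)
  also have "\<dots> = (\<Sum>p = 0..<a. A $$ (i div b, p) * C $$ (p, j div b)) *
      (\<Sum>q = 0..<b. B $$ (i mod b, q) * D $$ (q, j mod b))"
    by (simp add: sum_product mult_ac)
  also have "\<dots> = kron_mat (A * C) (B * D) $$ (i, j)"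
    using A B C D i j less by (auto simp: kron_mat_def scalar_prod_def)
  finally show "(kron_mat A B * kron_mat C D) $$ (i, j) = kron_mat (A * C) (B * D) $$ (i, j)" .
qed (use assms in \<open>auto simp: kron_mat_def\<close>)

lemma kron_vec_cscalar_prod:
  assumes "v \<in> carrier_vec a" "v' \<in> carrier_vec a" "w \<in> carrier_vec b" "w' \<in> carrier_vec b"
  shows "kron_vec v w \<bullet>c kron_vec v' w' = (v \<bullet>c v') * (w \<bullet>c w')"
proof -
  have "kron_vec v w \<bullet>c kron_vec v' w' =
      (\<Sum>l = 0..<a * b. v $ (l div b) * w $ (l mod b) * cnj (v' $ (l div b) * w' $ (l mod b)))"
    using assms by (auto simp: scalar_prod_def kron_vec_def)
  also have "\<dots> = (\<Sum>p = 0..<a. \<Sum>q = 0..<b. v $ p * w $ q * cnj (v' $ p * w' $ q))"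
    by (rule sum_mult_atLeast0LessThan)
  also have "\<dots> = (\<Sum>p = 0..<a. v $ p * cnj (v' $ p)) * (\<Sum>q = 0..<b. w $ q * cnj (w' $ q))"
    by (simp add: sum_product mult_ac)
  finally show ?thesis using assms by (simp add: scalar_prod_def)
qed

lemma tensor_mats_carrier:
  "\<forall>A\<in>set As. A \<in> carrier_mat 2 2 \<Longrightarrow> tensor_mats As \<in> carrier_mat (2 ^ length As) (2 ^ length As)"
  by (induction As) (auto simp: tensor_mats_def)

lemma tensor_vecs_carrier:
  "\<forall>v\<in>set vs. v \<in> carrier_vec 2 \<Longrightarrow> tensor_vecs vs \<in> carrier_vec (2 ^ length vs)"
  by (induction vs) (auto simp: tensor_vecs_def)

lemma pauli_mat_carrier [simp]: "pauli_mat p \<in> carrier_mat 2 2"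
  by (cases p) (auto simp: mat_of_rows_list_def)

lemma pauli_op_carrier [simp]: "pauli_op P \<in> carrier_mat (2 ^ length P) (2 ^ length P)"
  using tensor_mats_carrier[of "map pauli_mat P"] by (auto simp: pauli_op_def)

lemma pauli_op_Cons: "pauli_op (p # P) = kron_mat (pauli_mat p) (pauli_op P)"
  by (simp add: pauli_op_def tensor_mats_def)

lemma tensor_vecs_Cons: "tensor_vecs (v # vs) = kron_vec v (tensor_vecs vs)"
  by (simp add: tensor_vecs_def)

lemma pauli_op_expectation:
  "length P = length vs \<Longrightarrow> \<forall>v\<in>set vs. v \<in> carrier_vec 2 \<Longrightarrow>
   (pauli_op P *\<^sub>v tensor_vecs vs) \<bullet>c tensor_vecs vs =
   (\<Prod>i<length P. (pauli_mat (P ! i) *\<^sub>v vs ! i) \<bullet>c (vs ! i))"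
proof (induction P vs rule: list_induct2)
  case Nil
  then show ?case
    by (simp add: pauli_op_def tensor_mats_def tensor_vecs_def scalar_prod_def)
next
  case (Cons p P v vs)
  have c: "v \<in> carrier_vec 2" "tensor_vecs vs \<in> carrier_vec (2 ^ length P)"
      "pauli_op P \<in> carrier_mat (2 ^ length P) (2 ^ length P)"
    using Cons tensor_vecs_carrier[of vs] pauli_op_carrier[of P] by simp_all
  have m: "pauli_mat p *\<^sub>v v \<in> carrier_vec 2" "pauli_op P *\<^sub>v tensor_vecs vs \<in> carrier_vec (2 ^ length P)"
    using mult_mat_vec_carrier[OF pauli_mat_carrier c(1)] mult_mat_vec_carrier[OF c(3,2)] by auto
  show ?case
    using Cons c m unfolding pauli_op_Cons tensor_vecs_Cons
    by (simp add: kron_mat_mult_vec[OF pauli_mat_carrier c(3) c(1,2)]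
        kron_vec_cscalar_prod[OF m(1) c(1) m(2) c(2)] prod.lessThan_Suc_shift
        del: prod.lessThan_Suc)
qed

section \<open>The energy as a function of the state\<close>

lemma cscalar_prod_expand:
  fixes A :: "complex mat"
  assumes "A \<in> carrier_mat m m" "\<psi> \<in> carrier_vec m"
  shows "(A *\<^sub>v \<psi>) \<bullet>c \<psi> = (\<Sum>i<m. \<Sum>j<m. A $$ (i, j) * \<psi> $ j * cnj (\<psi> $ i))"
  using assms by (auto simp: scalar_prod_def sum_distrib_right lessThan_atLeast0)

lemma energy_hamiltonian:
  assumes \<psi>: "\<psi> \<in> carrier_vec (2 ^ n)"
  shows "energy (hamiltonian k n \<alpha>) \<psi> = (\<Sum>P\<in>local_paulis k n. \<alpha> P * energy (pauli_op P) \<psi>)"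
proof -
  have "hamiltonian k n \<alpha> \<in> carrier_mat (2 ^ n) (2 ^ n)" by (simp add: hamiltonian_def)
  then have "(hamiltonian k n \<alpha> *\<^sub>v \<psi>) \<bullet>c \<psi> = (\<Sum>i<2 ^ n. \<Sum>j<2 ^ n. \<Sum>P\<in>local_paulis k n.
      of_real (\<alpha> P) * (pauli_op P $$ (i, j) * \<psi> $ j * cnj (\<psi> $ i)))"
    by (subst cscalar_prod_expand[OF _ \<psi>])
      (auto simp: hamiltonian_def sum_distrib_right mult.assoc intro!: sum.cong)
  also have "\<dots> = (\<Sum>P\<in>local_paulis k n. of_real (\<alpha> P) *
      (\<Sum>i<2 ^ n. \<Sum>j<2 ^ n. pauli_op P $$ (i, j) * \<psi> $ j * cnj (\<psi> $ i)))"
    unfolding sum_distrib_left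
    by (subst (2) sum.swap, subst sum.swap) simp
  also have "\<dots> = (\<Sum>P\<in>local_paulis k n. of_real (\<alpha> P) * ((pauli_op P *\<^sub>v \<psi>) \<bullet>c \<psi>))"
  proof (rule sum.cong[OF refl])
    fix P assume "P \<in> local_paulis k n"
    then have "pauli_op P \<in> carrier_mat (2 ^ n) (2 ^ n)"
      using pauli_op_carrier[of P] by (auto simp: local_paulis_def)
    then show "of_real (\<alpha> P) * (\<Sum>i<2 ^ n. \<Sum>j<2 ^ n. pauli_op P $$ (i, j) * \<psi> $ j * cnj (\<psi> $ i)) =
        of_real (\<alpha> P) * ((pauli_op P *\<^sub>v \<psi>) \<bullet>c \<psi>)"
      by (simp add: cscalar_prod_expand[OF _ \<psi>])
  qed
  finally show ?thesis by (simp add: energy_def)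
qed

text \<open>On a product state the expectation of an observable is a product over the qubits in
  which identity letters contribute 1; the other factors form the monomial of the
  observable.\<close>

lemma energy_product_state:
  assumes q: "\<And>i. i < n \<Longrightarrow> q i \<in> carrier_vec 2"
    and bloch: "\<And>i p. i < n \<Longrightarrow> (pauli_mat p *\<^sub>v q i) \<bullet>c q i =
      complex_of_real (if p = PI then 1 else b (4 * i + pauli_code p))"
  shows "energy (hamiltonian k n \<alpha>) (tensor_vecs (map q [0..<n])) = bloch_poly k n \<alpha> b"
proof -
  let ?\<psi> = "tensor_vecs (map q [0..<n])"
  have \<psi>: "?\<psi> \<in> carrier_vec (2 ^ n)"
    using tensor_vecs_carrier[of "map q [0..<n]"] q by auto
  have "energy (pauli_op P) ?\<psi> = (\<Prod>v\<in>var_set P. b v)" if "P \<in> local_paulis k n" for P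
  proof -
    have P: "length P = n" using that by (simp add: local_paulis_def)
    have "(pauli_op P *\<^sub>v ?\<psi>) \<bullet>c ?\<psi> = (\<Prod>i<n. (pauli_mat (P ! i) *\<^sub>v map q [0..<n] ! i) \<bullet>c (map q [0..<n] ! i))"
      using pauli_op_expectation[of P "map q [0..<n]"] P q by auto
    also have "\<dots> = (\<Prod>i<n. complex_of_real (if P ! i = PI then 1 else b (4 * i + pauli_code (P ! i))))"
      by (intro prod.cong refl) (simp add: bloch)
    also have "\<dots> = complex_of_real (\<Prod>i<n. if P ! i = PI then 1 else b (4 * i + pauli_code (P ! i)))"
      by (simp only: of_real_prod)
    finally have "energy (pauli_op P) ?\<psi> = (\<Prod>i<n. if P ! i = PI then 1 else b (4 * i + pauli_code (P ! i)))"
      by (simp only: energy_def Re_complex_of_real)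
    also have "\<dots> = (\<Prod>i<n. if P ! i \<noteq> PI then b (4 * i + pauli_code (P ! i)) else 1)"
      by (intro prod.cong) auto
    also have "\<dots> = (\<Prod>i\<in>set (pauli_support P). b (4 * i + pauli_code (P ! i)))"
      unfolding set_pauli_support P by (subst prod.inter_filter[symmetric]) (auto intro!: prod.cong)
    also have "\<dots> = (\<Prod>v\<in>var_set P. b v)"
      unfolding var_set_def pauli_vars_def set_map
      by (subst prod.reindex) (auto simp: inj_var)
    finally show ?thesis .
  qed
  then show ?thesis by (simp add: energy_hamiltonian[OF \<psi>] bloch_poly_def)
qed

text \<open>Parametrization of a pure qubit state by its Bloch vector, with a real first amplitude
  and with square roots as the only irrational operation. The denominator \<open>2 * u\<close>
  excludes the pole \<open>z = - 1\<close>.\<close>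

lemma pauli_mat_expectation:
  fixes x y z :: real
  assumes "x\<^sup>2 + y\<^sup>2 + z\<^sup>2 = 1" "- 1 < z"
  defines "u \<equiv> sqrt ((1 + z) / 2)"
  defines "q \<equiv> vec_of_list [Complex u 0, Complex (x / (2 * u)) (y / (2 * u))]"
  shows "(pauli_mat p *\<^sub>v q) \<bullet>c q = complex_of_real (case p of PI \<Rightarrow> 1 | PX \<Rightarrow> x | PY \<Rightarrow> y | PZ \<Rightarrow> z)"
proof -
  define a b where "a = x / (2 * u)" and "b = y / (2 * u)"
  have u2: "u * u = (1 + z) / 2" and u: "u \<noteq> 0" using assms(2) by (auto simp: u_def)
  have ab: "a * a + b * b = (1 - z) / 2"
  proof -
    have xy2: "x\<^sup>2 + y\<^sup>2 = (1 - z) * (1 + z)"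
      using assms(1) by (simp add: power2_eq_square algebra_simps)
    have "a * a + b * b = (x\<^sup>2 + y\<^sup>2) / (4 * (u * u))"
      by (simp add: a_def b_def power2_eq_square add_divide_distrib)
    also have "\<dots> = (1 - z) * (1 + z) / (2 * (1 + z))"
      unfolding xy2 u2 by (rule arg_cong2[of _ _ _ _ "(/)"]) auto
    also have "\<dots> = (1 - z) / 2"
      by (rule nonzero_mult_divide_mult_cancel_right) (use assms(2) in simp)
    finally show ?thesis .
  qed
  have xy: "2 * u * a = x" "2 * u * b = y" using u by (auto simp: a_def b_def)
  have dim: "dim_vec q = 2" "q $ 0 = Complex u 0" "q $ 1 = Complex a b"
    by (auto simp: q_def a_def b_def)
  have "(pauli_mat p *\<^sub>v q) \<bullet>c q =
      (pauli_mat p $$ (0, 0) * q $ 0 + pauli_mat p $$ (0, 1) * q $ 1) * cnj (q $ 0) +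
      (pauli_mat p $$ (1, 0) * q $ 0 + pauli_mat p $$ (1, 1) * q $ 1) * cnj (q $ 1)"
  proof -
    have "q \<in> carrier_vec 2" using dim(1) by (rule carrier_vecI)
    moreover have "(\<Sum>i<2. f i) = f 0 + f 1" for f :: "nat \<Rightarrow> complex"
      by (simp add: numeral_2_eq_2)
    ultimately show ?thesis
      by (simp only: cscalar_prod_expand[OF pauli_mat_carrier] distrib_right)
  qed
  also have "\<dots> = complex_of_real (case p of PI \<Rightarrow> u * u + (a * a + b * b) | PX \<Rightarrow> 2 * u * a
      | PY \<Rightarrow> 2 * u * b | PZ \<Rightarrow> u * u - (a * a + b * b))"
    unfolding dim by (cases p) (auto simp: mat_of_rows_list_def complex_eq_iff)
  also have "\<dots> = complex_of_real (case p of PI \<Rightarrow> 1 | PX \<Rightarrow> x | PY \<Rightarrow> y | PZ \<Rightarrow> z)"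
    unfolding u2 ab xy by (cases p) (auto simp: field_simps)
  finally show ?thesis .
qed

section \<open>Haar averages of traceless observables\<close>

section \<open>The Haar average\<close>

lemma mat_adjoint_carrier:
  fixes A :: "complex mat"
  assumes "A \<in> carrier_mat m m"
  shows "mat_adjoint A \<in> carrier_mat m m"
  using carrier_matD[OF assms] unfolding mat_adjoint_def by (intro carrier_matI) simp_all

lemma mat_adjoint_index:
  fixes A :: "complex mat"
  shows "A \<in> carrier_mat m m \<Longrightarrow> i < m \<Longrightarrow> j < m \<Longrightarrow> mat_adjoint A $$ (i, j) = cnj (A $$ (j, i))"
  by (auto simp: mat_adjoint_def mat_of_rows_index)

lemma mat_adjoint_pauli_op: "mat_adjoint (pauli_op P) = pauli_op P"
proof -
  have pauli: "cnj (pauli_mat p $$ (j, i)) = pauli_mat p $$ (i, j)" if "i < 2" "j < 2" for p i j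
    using that by (cases p) (auto simp: mat_of_rows_list_def less_2_cases_iff)
  have entry: "cnj (pauli_op P $$ (j, i)) = pauli_op P $$ (i, j)"
    if "i < 2 ^ length P" "j < 2 ^ length P" for i j
    using that
  proof (induction P arbitrary: i j)
    case Nil
    then show ?case by (simp add: pauli_op_def tensor_mats_def)
  next
    case (Cons p P)
    then have ij: "i < 2 * 2 ^ length P" "j < 2 * 2 ^ length P" by auto
    show ?case
      unfolding pauli_op_Cons kron_mat_index[OF pauli_mat_carrier pauli_op_carrier ij]
        kron_mat_index[OF pauli_mat_carrier pauli_op_carrier ij(2,1)]
      using div_mod_less[OF ij(1)] div_mod_less[OF ij(2)] Cons.IH by (simp add: pauli)
  qed
  show ?thesis
  proof (rule eq_matI)
    fix i j assume "i < dim_row (pauli_op P)" "j < dim_col (pauli_op P)"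
    then have "i < 2 ^ length P" "j < 2 ^ length P"
      using carrier_matD[OF pauli_op_carrier[of P]] by simp_all
    then show "mat_adjoint (pauli_op P) $$ (i, j) = pauli_op P $$ (i, j)"
      by (simp add: mat_adjoint_index[OF pauli_op_carrier] entry)
  qed (use carrier_matD[OF mat_adjoint_carrier[OF pauli_op_carrier[of P]]]
      carrier_matD[OF pauli_op_carrier[of P]] in simp_all)
qed

text \<open>Different nonidentity Pauli matrices anticommute, all other pairs commute; conjugation
  by a tensor product multiplies by the product of these signs.\<close>

definition commutation_sign :: "pauli \<Rightarrow> pauli \<Rightarrow> complex" where
  "commutation_sign q p = (if q = PI \<or> p = PI \<or> q = p then 1 else - 1)"

lemma kron_mat_smult:
  "kron_mat (c \<cdot>\<^sub>m A) (d \<cdot>\<^sub>m B) = (c * d) \<cdot>\<^sub>m kron_mat A B"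
proof (rule eq_matI)
  fix i j assume "i < dim_row ((c * d) \<cdot>\<^sub>m kron_mat A B)" "j < dim_col ((c * d) \<cdot>\<^sub>m kron_mat A B)"
  then have ij: "i < dim_row A * dim_row B" "j < dim_col A * dim_col B"
    by (auto simp: kron_mat_def)
  show "kron_mat (c \<cdot>\<^sub>m A) (d \<cdot>\<^sub>m B) $$ (i, j) = ((c * d) \<cdot>\<^sub>m kron_mat A B) $$ (i, j)"
    using ij div_mod_less[OF ij(1)] div_mod_less[OF ij(2)] by (simp add: kron_mat_def)
qed (auto simp: kron_mat_def)

lemma pauli_mat_conj: "pauli_mat q * pauli_mat p * pauli_mat q = commutation_sign q p \<cdot>\<^sub>m pauli_mat p"
  by (rule eq_matI; cases p; cases q)
    (auto simp: commutation_sign_def mat_of_rows_list_def scalar_prod_def less_Suc_eq numeral_2_eq_2)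

lemma pauli_mat_square: "pauli_mat q * pauli_mat q = 1\<^sub>m 2"
  by (rule eq_matI; cases q)
    (auto simp: mat_of_rows_list_def scalar_prod_def less_Suc_eq numeral_2_eq_2)

lemma kron_mat_one: "kron_mat (1\<^sub>m a) (1\<^sub>m b) = 1\<^sub>m (a * b)"
proof (rule eq_matI)
  fix i j assume "i < dim_row (1\<^sub>m (a * b) :: complex mat)" "j < dim_col (1\<^sub>m (a * b) :: complex mat)"
  then have ij: "i < a * b" "j < a * b" by auto
  have "i = j \<longleftrightarrow> i div b = j div b \<and> i mod b = j mod b" by (metis div_mult_mod_eq)
  then show "kron_mat (1\<^sub>m a) (1\<^sub>m b) $$ (i, j) = 1\<^sub>m (a * b) $$ (i, j)"
    using ij div_mod_less[OF ij(1)] div_mod_less[OF ij(2)] by (auto simp: kron_mat_def)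
qed (auto simp: kron_mat_def)

lemma pauli_op_conj:
  "length Q = length P \<Longrightarrow> pauli_op Q * pauli_op P * pauli_op Q =
   (\<Prod>(q, p)\<leftarrow>zip Q P. commutation_sign q p) \<cdot>\<^sub>m pauli_op P"
proof (induction Q P rule: list_induct2)
  case Nil
  show ?case by (rule eq_matI) (auto simp: pauli_op_def tensor_mats_def)
next
  case (Cons q Q p P)
  have c: "pauli_op Q \<in> carrier_mat (2 ^ length P) (2 ^ length P)"
    using pauli_op_carrier[of Q] Cons by simp
  show ?case
    unfolding pauli_op_Cons
    by (simp add: kron_mat_mult[OF pauli_mat_carrier c pauli_mat_carrier pauli_op_carrier]
      kron_mat_mult[OF mult_carrier_mat[OF pauli_mat_carrier pauli_mat_carrier]
        mult_carrier_mat[OF c pauli_op_carrier] pauli_mat_carrier c]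
      Cons.IH pauli_mat_conj kron_mat_smult)
qed

lemma pauli_op_square: "pauli_op Q * pauli_op Q = 1\<^sub>m (2 ^ length Q)"
proof (induction Q)
  case Nil
  then show ?case by (simp add: pauli_op_def tensor_mats_def)
next
  case (Cons q Q)
  then show ?case
    by (simp add: pauli_op_Cons kron_mat_mult[OF pauli_mat_carrier pauli_op_carrier
      pauli_mat_carrier pauli_op_carrier] pauli_mat_square kron_mat_one)
qed

text \<open>One qubit with a nonidentity letter suffices: a different nonidentity letter is taken
  there, \<open>PZ\<close> against \<open>PX\<close> and \<open>PX\<close> otherwise, and the
  identity everywhere else.\<close>

lemma anticommuting_pauli:
  "P \<noteq> replicate (length P) PI \<Longrightarrow>
   \<exists>Q. length Q = length P \<and> (\<Prod>(q, p)\<leftarrow>zip Q P. commutation_sign q p) = - 1"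
proof (induction P)
  case (Cons p P)
  show ?case
  proof (cases "p = PI")
    case True
    then obtain Q where "length Q = length P" "(\<Prod>(q, p)\<leftarrow>zip Q P. commutation_sign q p) = - 1"
      using Cons by auto
    then show ?thesis by (intro exI[of _ "PI # Q"]) (auto simp: commutation_sign_def)
  next
    case False
    define q where "q = (if p = PX then PZ else PX)"
    have "(\<Prod>(q, p)\<leftarrow>zip (replicate (length P) PI) P. commutation_sign q p) = 1"
      by (induction P) (auto simp: commutation_sign_def)
    then show ?thesis
      using False by (intro exI[of _ "q # replicate (length P) PI"]) (auto simp: commutation_sign_def q_def)
  qed
qed simp

lemma cscalar_prod_hermitian:
  fixes A :: "complex mat"
  assumes "A \<in> carrier_mat m m" "mat_adjoint A = A" "v \<in> carrier_vec m" "w \<in> carrier_vec m"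
  shows "v \<bullet>c (A *\<^sub>v w) = (A *\<^sub>v v) \<bullet>c w"
proof -
  have adj: "cnj (A $$ (i, j)) = A $$ (j, i)" if "i < m" "j < m" for i j
    using mat_adjoint_index[OF assms(1) that(2,1)] assms(2) by simp
  have "v \<bullet>c (A *\<^sub>v w) = (\<Sum>i<m. \<Sum>j<m. v $ i * (cnj (A $$ (i, j)) * cnj (w $ j)))"
    using assms by (auto simp: scalar_prod_def sum_distrib_left lessThan_atLeast0)
  also have "\<dots> = (\<Sum>j<m. \<Sum>i<m. A $$ (j, i) * v $ i * cnj (w $ j))"
    by (subst sum.swap) (simp add: adj mult_ac)
  also have "\<dots> = (A *\<^sub>v v) \<bullet>c w"
    using assms by (auto simp: scalar_prod_def sum_distrib_right lessThan_atLeast0)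
  finally show ?thesis .
qed

context
  fixes n :: nat and \<mu> :: "complex vec measure"
  assumes haar: "is_haar_measure n \<mu>"
begin

interpretation prob_space \<mu>
  using haar by (simp add: is_haar_measure_def)

definition coords :: "complex vec \<Rightarrow> nat \<Rightarrow> complex" where
  "coords \<phi> = (\<lambda>i\<in>{..<2 ^ n}. \<phi> $ i)"

lemma coords_PiE: "coords \<phi> \<in> space (\<Pi>\<^sub>M i\<in>{..<2 ^ n}. (borel :: complex measure))"
  by (auto simp: coords_def space_PiM)

lemma sets_haar: "sets \<mu> = sets (vimage_algebra (pure_states n) coords
    (\<Pi>\<^sub>M i\<in>{..<2 ^ n}. (borel :: complex measure)))"
  using haar by (simp add: is_haar_measure_def coords_def[abs_def])

lemma space_haar: "space \<mu> = pure_states n"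
  using sets_eq_imp_space_eq[OF sets_haar] by simp

lemma measurable_coordinate:
  assumes "i < 2 ^ n"
  shows "(\<lambda>\<phi>. \<phi> $ i) \<in> borel_measurable \<mu>"
proof -
  have "coords \<in> measurable \<mu> (\<Pi>\<^sub>M i\<in>{..<2 ^ n}. (borel :: complex measure))"
    unfolding measurable_cong_sets[OF sets_haar refl]
    by (rule measurable_vimage_algebra1) (use coords_PiE in auto)
  moreover have "(\<lambda>f. f i) \<in> measurable (\<Pi>\<^sub>M i\<in>{..<2 ^ n}. (borel :: complex measure)) borel"
    using assms by (intro measurable_component_singleton) auto
  ultimately have "(\<lambda>\<phi>. coords \<phi> i) \<in> borel_measurable \<mu>" by (rule measurable_compose)
  then show ?thesis using assms by (simp add: coords_def)
qed

lemma pure_state_carrier: "\<phi> \<in> pure_states n \<Longrightarrow> \<phi> \<in> carrier_vec (2 ^ n)"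
  by (simp add: pure_states_def)

lemma pure_state_entry_le:
  assumes \<phi>: "\<phi> \<in> pure_states n" and i: "i < 2 ^ n"
  shows "cmod (\<phi> $ i) \<le> 1"
proof -
  have "1 = Re (\<phi> \<bullet>c \<phi>)" using \<phi> by (simp add: pure_states_def)
  also have "\<dots> = (\<Sum>j<2 ^ n. (cmod (\<phi> $ j))\<^sup>2)"
    using pure_state_carrier[OF \<phi>]
    by (auto simp: scalar_prod_def lessThan_atLeast0 complex_norm_square[symmetric] simp flip: of_real_power)
  also have "(cmod (\<phi> $ i))\<^sup>2 \<le> (\<Sum>j<2 ^ n. (cmod (\<phi> $ j))\<^sup>2)"
    using i by (intro member_le_sum) auto
  finally have "(cmod (\<phi> $ i))\<^sup>2 \<le> 1" by simp
  then show ?thesis by (simp add: power_le_one_iff abs_square_le_1)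
qed

lemma measurable_energy:
  assumes A: "A \<in> carrier_mat (2 ^ n) (2 ^ n)"
  shows "energy A \<in> borel_measurable \<mu>"
proof -
  have cnj: "cnj \<in> borel_measurable borel"
    by (intro borel_measurable_continuous_onI continuous_intros)
  have "(\<lambda>\<phi>. \<Sum>i<2 ^ n. \<Sum>j<2 ^ n. A $$ (i, j) * \<phi> $ j * cnj (\<phi> $ i)) \<in> borel_measurable \<mu>"
    by (intro borel_measurable_sum borel_measurable_times borel_measurable_const measurable_coordinate
      measurable_compose[OF measurable_coordinate cnj]) auto
  then have "(\<lambda>\<phi>. Re (\<Sum>i<2 ^ n. \<Sum>j<2 ^ n. A $$ (i, j) * \<phi> $ j * cnj (\<phi> $ i))) \<in> borel_measurable \<mu>"
    by (rule measurable_compose)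
      (intro borel_measurable_continuous_onI continuous_intros)
  then show ?thesis
    by (rule measurable_cong[THEN iffD1, rotated])
      (simp add: energy_def cscalar_prod_expand[OF A] space_haar pure_state_carrier)
qed

text \<open>Entries of a unit vector have modulus at most 1, which bounds the quadratic form
  uniformly on a space of total mass 1.\<close>

lemma integrable_energy:
  assumes A: "A \<in> carrier_mat (2 ^ n) (2 ^ n)"
  shows "integrable \<mu> (energy A)"
proof (rule integrable_const_bound[where B = "\<Sum>i<2 ^ n. \<Sum>j<2 ^ n. cmod (A $$ (i, j))"])
  show "AE \<phi> in \<mu>. norm (energy A \<phi>) \<le> (\<Sum>i<2 ^ n. \<Sum>j<2 ^ n. cmod (A $$ (i, j)))"
  proof (rule AE_I2)
    fix \<phi> assume "\<phi> \<in> space \<mu>"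
    then have \<phi>: "\<phi> \<in> pure_states n" by (simp add: space_haar)
    have "norm (energy A \<phi>) \<le> cmod (\<Sum>i<2 ^ n. \<Sum>j<2 ^ n. A $$ (i, j) * \<phi> $ j * cnj (\<phi> $ i))"
      unfolding energy_def cscalar_prod_expand[OF A pure_state_carrier[OF \<phi>]]
      by (simp only: real_norm_def abs_Re_le_cmod)
    also have "\<dots> \<le> (\<Sum>i<2 ^ n. \<Sum>j<2 ^ n. cmod (A $$ (i, j)) * 1 * 1)"
      by (intro sum_norm_le order_trans[OF norm_sum] sum_mono)
        (simp only: norm_mult complex_mod_cnj, intro mult_mono,
          auto intro!: mult_nonneg_nonneg pure_state_entry_le[OF \<phi>])
    finally show "norm (energy A \<phi>) \<le> (\<Sum>i<2 ^ n. \<Sum>j<2 ^ n. cmod (A $$ (i, j)))" by simp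
  qed
qed (rule measurable_energy[OF A])

lemma integral_energy_pauli:
  assumes P: "length P = n" "P \<noteq> replicate n PI"
  shows "(\<integral>\<phi>. energy (pauli_op P) \<phi> \<partial>\<mu>) = 0"
proof -
  obtain Q where Q: "length Q = n" "(\<Prod>(q, p)\<leftarrow>zip Q P. commutation_sign q p) = - 1"
    using anticommuting_pauli[of P] P by auto
  define U where "U = pauli_op Q"
  define A where "A = pauli_op P"
  have U: "U \<in> carrier_mat (2 ^ n) (2 ^ n)" and A: "A \<in> carrier_mat (2 ^ n) (2 ^ n)"
    using pauli_op_carrier[of Q] pauli_op_carrier[of P] Q P by (auto simp: U_def A_def)
  have adj: "mat_adjoint U = U" by (simp add: U_def mat_adjoint_pauli_op)
  have UU: "U * U = 1\<^sub>m (2 ^ n)" using pauli_op_square[of Q] Q by (simp add: U_def)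
  have UAU: "U * A * U = - 1 \<cdot>\<^sub>m A" using pauli_op_conj[of Q P] P Q by (simp add: U_def A_def)
  have pure: "U *\<^sub>v \<phi> \<in> pure_states n" if \<phi>: "\<phi> \<in> pure_states n" for \<phi>
  proof -
    have c: "\<phi> \<in> carrier_vec (2 ^ n)" by (rule pure_state_carrier[OF \<phi>])
    have "(U *\<^sub>v \<phi>) \<bullet>c (U *\<^sub>v \<phi>) = (U *\<^sub>v (U *\<^sub>v \<phi>)) \<bullet>c \<phi>"
      using c U by (intro cscalar_prod_hermitian[OF U adj]) auto
    also have "U *\<^sub>v (U *\<^sub>v \<phi>) = \<phi>"
      using assoc_mult_mat_vec[OF U U c] UU c by simp
    finally show ?thesis using \<phi> U c by (auto simp: pure_states_def)
  qed
  have conj: "energy A (U *\<^sub>v \<phi>) = - energy A \<phi>" if \<phi>: "\<phi> \<in> pure_states n" for \<phi>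
  proof -
    have c: "\<phi> \<in> carrier_vec (2 ^ n)" by (rule pure_state_carrier[OF \<phi>])
    have "(A *\<^sub>v (U *\<^sub>v \<phi>)) \<bullet>c (U *\<^sub>v \<phi>) = (U *\<^sub>v (A *\<^sub>v (U *\<^sub>v \<phi>))) \<bullet>c \<phi>"
      using c U A by (intro cscalar_prod_hermitian[OF U adj]) auto
    also have "U *\<^sub>v (A *\<^sub>v (U *\<^sub>v \<phi>)) = (U * A * U) *\<^sub>v \<phi>"
      using U A c by (simp add: assoc_mult_mat_vec[of _ "2 ^ n" "2 ^ n" _ "2 ^ n"] mult_carrier_mat[of _ "2 ^ n" "2 ^ n"])
    also have "\<dots> = - 1 \<cdot>\<^sub>v (A *\<^sub>v \<phi>)"
      unfolding UAU by (rule eq_vecI) (use A c in \<open>auto simp: scalar_prod_def sum_negf\<close>)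
    finally have "(A *\<^sub>v (U *\<^sub>v \<phi>)) \<bullet>c (U *\<^sub>v \<phi>) = - ((A *\<^sub>v \<phi>) \<bullet>c \<phi>)"
      using A c by (simp add: scalar_prod_def sum_negf)
    then show ?thesis by (simp add: energy_def)
  qed
  \<comment> \<open>The measurable sets are pulled back along the coordinate map, so it suffices
    that each entry of \<open>U *\<^sub>v \<phi>\<close> is a linear combination of
    coordinates.\<close>
  have meas: "(\<lambda>\<phi>. U *\<^sub>v \<phi>) \<in> measurable \<mu> \<mu>"
    unfolding measurable_cong_sets[OF refl sets_haar]
  proof (rule measurable_vimage_algebra2)
    show "(\<lambda>\<phi>. U *\<^sub>v \<phi>) \<in> space \<mu> \<rightarrow> pure_states n" using pure by (auto simp: space_haar)
    show "(\<lambda>\<phi>. coords (U *\<^sub>v \<phi>)) \<in> measurable \<mu> (\<Pi>\<^sub>M i\<in>{..<2 ^ n}. borel)"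
      unfolding coords_def
    proof (rule measurable_restrict)
      fix i :: nat assume i: "i \<in> {..<2 ^ n}"
      have "(\<lambda>\<phi>. \<Sum>j<2 ^ n. U $$ (i, j) * \<phi> $ j) \<in> borel_measurable \<mu>"
        by (intro borel_measurable_sum borel_measurable_times borel_measurable_const measurable_coordinate) auto
      then show "(\<lambda>\<phi>. (U *\<^sub>v \<phi>) $ i) \<in> borel_measurable \<mu>"
        by (rule measurable_cong[THEN iffD1, rotated])
          (use i U in \<open>auto simp: space_haar scalar_prod_def lessThan_atLeast0 dest!: pure_state_carrier\<close>)
    qed
  qed
  have "distr \<mu> \<mu> (\<lambda>\<phi>. U *\<^sub>v \<phi>) = \<mu>"
    using haar U UU adj by (simp add: is_haar_measure_def)
  then have "(\<integral>\<phi>. energy A \<phi> \<partial>\<mu>) = (\<integral>\<phi>. energy A \<phi> \<partial>distr \<mu> \<mu> (\<lambda>\<phi>. U *\<^sub>v \<phi>))" by simp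
  also have "\<dots> = (\<integral>\<phi>. energy A (U *\<^sub>v \<phi>) \<partial>\<mu>)"
    by (rule integral_distr[OF meas measurable_energy[OF A]])
  also have "\<dots> = (\<integral>\<phi>. - energy A \<phi> \<partial>\<mu>)"
    by (rule Bochner_Integration.integral_cong) (auto simp: space_haar conj)
  finally show ?thesis by (simp add: A_def)
qed

lemma haar_average: "(\<integral>\<phi>. energy (hamiltonian k n \<alpha>) \<phi> \<partial>\<mu>) = \<alpha> (replicate n PI)"
proof -
  define I where "I = replicate n PI"
  have I: "I \<in> local_paulis k n"
    using pauli_weight_eq_0_iff[of I] by (simp add: local_paulis_def I_def)
  have carrier: "pauli_op P \<in> carrier_mat (2 ^ n) (2 ^ n)" if "P \<in> local_paulis k n" for P
    using pauli_op_carrier[of P] that by (auto simp: local_paulis_def)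
  have op_I: "pauli_op (replicate m PI) = 1\<^sub>m (2 ^ m)" for m
  proof (induction m)
    case (Suc m)
    have "pauli_mat PI = 1\<^sub>m 2"
      by (rule eq_matI) (auto simp: mat_of_rows_list_def less_2_cases_iff)
    then show ?case using Suc by (simp add: pauli_op_Cons kron_mat_one del: pauli_mat.simps)
  qed (simp add: pauli_op_def tensor_mats_def)
  have "(\<integral>\<phi>. energy (hamiltonian k n \<alpha>) \<phi> \<partial>\<mu>) =
      (\<integral>\<phi>. (\<Sum>P\<in>local_paulis k n. \<alpha> P * energy (pauli_op P) \<phi>) \<partial>\<mu>)"
    by (rule Bochner_Integration.integral_cong)
      (auto simp: space_haar energy_hamiltonian pure_state_carrier)
  also have "\<dots> = (\<Sum>P\<in>local_paulis k n. \<alpha> P * (\<integral>\<phi>. energy (pauli_op P) \<phi> \<partial>\<mu>))"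
    using integrable_energy[OF carrier] by (subst Bochner_Integration.integral_sum) auto
  also have "\<dots> = (\<Sum>P\<in>local_paulis k n. if P = I then \<alpha> I * (\<integral>\<phi>. energy (pauli_op I) \<phi> \<partial>\<mu>) else 0)"
    by (intro sum.cong refl) (auto simp: I_def integral_energy_pauli local_paulis_def)
  also have "\<dots> = \<alpha> I * (\<integral>\<phi>. energy (pauli_op I) \<phi> \<partial>\<mu>)"
    using I by simp
  also have "(\<integral>\<phi>. energy (pauli_op I) \<phi> \<partial>\<mu>) = (\<integral>\<phi>. 1 \<partial>\<mu>)"
    by (rule Bochner_Integration.integral_cong)
      (auto simp: space_haar I_def op_I energy_def pure_states_def)
  finally show ?thesis by (simp add: I_def prob_space)
qed

end

section \<open>The deterministic search as a real RAM program\<close>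

section \<open>The program\<close>

text \<open>
  Counters are kept in the integer array 0 behind the input. Real array 5 holds scalars, arrays 6
  and 7 the total and the remaining squared norms during a contraction, arrays 8 and 9 the current
  and the best candidate. The \<open>m\<close>-th partially contracted tensor, of order \<open>m\<close>, and the signs chosen
  in contracting it are in the arrays \<open>tensor_arr m\<close> and \<open>dir_arr m\<close>. The final coin flips overwrite
  the weights in the integer array 1.
\<close>

definition tensor_arr :: "nat \<Rightarrow> nat" where "tensor_arr m = 2 * m + 10"

definition dir_arr :: "nat \<Rightarrow> nat" where "dir_arr m = 2 * m + 11"

lemma arr_simps [simp]:
  "tensor_arr m = tensor_arr m' \<longleftrightarrow> m = m'" "dir_arr m = dir_arr m' \<longleftrightarrow> m = m'"
  "tensor_arr m \<noteq> dir_arr m'" "dir_arr m' \<noteq> tensor_arr m"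
  "5 \<le> tensor_arr m" "5 \<le> dir_arr m"
  "tensor_arr m \<noteq> 5" "tensor_arr m \<noteq> 6" "tensor_arr m \<noteq> 7" "tensor_arr m \<noteq> 8" "tensor_arr m \<noteq> 9"
  "5 \<noteq> tensor_arr m" "6 \<noteq> tensor_arr m" "7 \<noteq> tensor_arr m" "8 \<noteq> tensor_arr m" "9 \<noteq> tensor_arr m"
  "dir_arr m \<noteq> 5" "dir_arr m \<noteq> 6" "dir_arr m \<noteq> 7" "dir_arr m \<noteq> 8" "dir_arr m \<noteq> 9"
  "5 \<noteq> dir_arr m" "6 \<noteq> dir_arr m" "7 \<noteq> dir_arr m" "8 \<noteq> dir_arr m" "9 \<noteq> dir_arr m"
  unfolding tensor_arr_def dir_arr_def by presburger+

definition rnat :: "nat \<Rightarrow> rexp" where "rnat c = OfNat (IConst c)"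

lemma rval_rnat [simp]: "rval (rnat c) s = real c"
  by (simp add: rnat_def)

definition num_vars :: iexp where "num_vars = IMul (IConst 4) (counter 0)"

lemma ival_num_vars [simp]: "ival num_vars s = 4 * ints s 0 0"
  by (simp add: num_vars_def)

primrec num_vars_pow :: "nat \<Rightarrow> iexp" where
  "num_vars_pow 0 = IConst 1"
| "num_vars_pow (Suc m) = IMul num_vars (num_vars_pow m)"

lemma ival_num_vars_pow [simp]: "ival (num_vars_pow m) s = (4 * ints s 0 0) ^ m"
  by (induction m) auto

definition var_exp :: "nat \<Rightarrow> iexp" where
  "var_exp r = IAdd (IMul (IConst 4) (IRead (2 * r + 2) (counter 2))) (IRead (2 * r + 3) (counter 2))"

text \<open>
  The factors that an observable of lower weight lacks are encoded as position 0 and letter 0, which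
  is variable 0. No observable uses this variable, and the value 1 of its cell makes them harmless.
\<close>

definition eval_prog :: "nat \<Rightarrow> com" where
  "eval_prog k = SumLoop 2 5 (counter 1)
     (foldr (\<lambda>r e. RMul (RRead 8 (var_exp r)) e) [0..<k] (RRead 0 (counter 2)))"

primrec enc_exp :: "nat list \<Rightarrow> iexp" where
  "enc_exp [] = IConst 0"
| "enc_exp (r # rs) = IAdd (IMul (var_exp r) (num_vars_pow (length rs))) (enc_exp rs)"

text \<open>A fixed enumeration, chosen when the program for a given \<open>k\<close> is written
  down: the permutations are part of the program text and cost no running time to find. The same
  holds for \<open>cand_list\<close>.\<close>

definition perm_list :: "nat \<Rightarrow> nat list list" where
  "perm_list \<kappa> = (SOME ps. set ps = permutations_of_set {..<\<kappa>} \<and> distinct ps)"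

lemma perm_list: "set (perm_list \<kappa>) = permutations_of_set {..<\<kappa>}" "distinct (perm_list \<kappa>)"
  using someI_ex[OF finite_distinct_list[OF finite_permutations_of_set[of "{..<\<kappa>}"]]]
  by (auto simp: perm_list_def)

definition add_cmd :: "nat \<Rightarrow> nat list \<Rightarrow> com" where
  "add_cmd \<kappa> \<pi> = RAssign (tensor_arr \<kappa>) (enc_exp \<pi>)
     (RAdd (RRead (tensor_arr \<kappa>) (enc_exp \<pi>)) (RRead 0 (counter 2)))"

definition fill_prog :: "nat \<Rightarrow> com" where
  "fill_prog \<kappa> = Seq (MapLoop 3 (num_vars_pow \<kappa>) (tensor_arr \<kappa>) (rnat 0))
     (For 2 (counter 1)
       (Cond (BAnd (BNot (ILess (IRead 1 (counter 2)) (IConst \<kappa>))) (BNot (ILess (IConst \<kappa>) (IRead 1 (counter 2)))))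
         (Seqs (map (add_cmd \<kappa>) (perm_list \<kappa>))) Skip))"

definition prefix_exp :: "nat \<Rightarrow> rexp" where
  "prefix_exp l = RRead (tensor_arr (Suc l)) (IAdd (IMul (counter 4) num_vars) (counter 3))"

definition slice_exp :: "nat \<Rightarrow> rexp" where
  "slice_exp l = RRead (tensor_arr (Suc (Suc l)))
     (IAdd (IMul (counter 2) (num_vars_pow (Suc l))) (IAdd (IMul (counter 4) num_vars) (counter 3)))"

definition gap_term :: rexp where
  "gap_term = RDiv
     (RMul (RRead 5 (IConst 1)) (RSub (RMul (rnat 9) (RRead 6 (counter 3)))
       (RMul (rnat 2) (RAdd (RAdd (RRead 5 (IConst 3)) (RRead 5 (IConst 2)))
         (RMul (rnat 3) (RRead 7 (counter 3)))))))
     (RMul (RRead 6 (counter 3)) (RRoot 2 (RRead 6 (counter 3))))"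

text \<open>Array 7 keeps the squared norms of the slices not yet treated, and each call subtracts
  the current slice; adding up all earlier slices anew in every round would exceed the time budget
  by a factor of order \<open>N\<close>. For the current \<open>v\<close>, cells 1, 2 and 3 of array
  5 hold the inner product and the squared norms of slice and partial sum; cell 0 accumulates the
  gap.\<close>

definition gap_prog :: "nat \<Rightarrow> com" where
  "gap_prog l = Seq (RAssign 5 (IConst 0) (rnat 0)) (For 3 num_vars
     (Seq (SumLoop 4 1 (num_vars_pow l) (RMul (prefix_exp l) (slice_exp l)))
     (Seq (SumLoop 4 2 (num_vars_pow l) (RMul (slice_exp l) (slice_exp l)))
     (Seq (SumLoop 4 3 (num_vars_pow l) (RMul (prefix_exp l) (prefix_exp l)))
     (Seq (RAssign 7 (counter 3) (RSub (RRead 7 (counter 3)) (RRead 5 (IConst 2))))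
       (RAssign 5 (IConst 0) (RAdd (RRead 5 (IConst 0)) gap_term)))))))"

definition norms_prog :: "nat \<Rightarrow> com" where
  "norms_prog l = For 3 num_vars
     (Seq (SumLoop 4 2 (num_vars_pow (Suc l))
       (RMul (RRead (tensor_arr (Suc (Suc l))) (IAdd (IMul (counter 4) num_vars) (counter 3)))
         (RRead (tensor_arr (Suc (Suc l))) (IAdd (IMul (counter 4) num_vars) (counter 3)))))
     (Seq (RAssign 6 (counter 3) (RRead 5 (IConst 2))) (RAssign 7 (counter 3) (RRead 5 (IConst 2)))))"

text \<open>The array of the lower tensor holds the partial sum over the slices treated so far. It
  serves as \<open>U\<close> in the choice of the next sign and has become the contracted tensor
  when the loop ends.\<close>

definition choose_prog :: "nat \<Rightarrow> com" where
  "choose_prog l = Seq (gap_prog l)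
     (Seq (Cond (RLess (RRead 5 (IConst 0)) (rnat 0))
         (RAssign (dir_arr (Suc (Suc l))) (counter 2) (RSub (rnat 0) (rnat 1)))
         (RAssign (dir_arr (Suc (Suc l))) (counter 2) (rnat 1)))
       (MapLoop 3 (num_vars_pow (Suc l)) (tensor_arr (Suc l))
         (RAdd (RRead (tensor_arr (Suc l)) (counter 3))
           (RMul (RRead (dir_arr (Suc (Suc l))) (counter 2))
             (RRead (tensor_arr (Suc (Suc l))) (IAdd (IMul (counter 2) (num_vars_pow (Suc l))) (counter 3)))))))"

text \<open>The given tensor has order \<open>l + 2\<close> and \<open>l\<close> middle indices;
  this numbering avoids truncated subtraction in the exponents.\<close>

definition contract_prog :: "nat \<Rightarrow> com" where
  "contract_prog l = Seq (MapLoop 3 (num_vars_pow (Suc l)) (tensor_arr (Suc l)) (rnat 0))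
     (Seq (norms_prog l) (For 2 num_vars (choose_prog l)))"

text \<open>Since \<open>x / 0 = 0\<close>, this expression computes the sign of \<open>x\<close> also for \<open>x = 0\<close>.\<close>

definition sign_prog :: com where
  "sign_prog = (let x = RRead (tensor_arr 1) (counter 3)
     in MapLoop 3 num_vars (dir_arr 1) (RDiv x (RRoot 2 (RMul x x))))"

text \<open>Sign patterns are part of the program text: \<open>\<epsilon>\<close> is compiled into
  additions and subtractions.\<close>

primrec comb_exp :: "(nat \<Rightarrow> real) \<Rightarrow> nat \<Rightarrow> rexp" where
  "comb_exp \<epsilon> 0 = rnat 0"
| "comb_exp \<epsilon> (Suc j) = (if \<epsilon> (Suc j) < 0 then RSub (comb_exp \<epsilon> j) (RRead (dir_arr (Suc j)) (counter 3))
     else RAdd (comb_exp \<epsilon> j) (RRead (dir_arr (Suc j)) (counter 3)))"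

text \<open>The square orders the candidates like the absolute deviation and avoids a case
  distinction on the sign.\<close>

definition gain_exp :: rexp where
  "gain_exp = RMul (RSub (RRead 5 (IConst 5)) (RRead 5 (IConst 4))) (RSub (RRead 5 (IConst 5)) (RRead 5 (IConst 4)))"

text \<open>For \<open>\<kappa> = k\<close> the quotient in the scale is a division by zero with
  value 0, as in \<open>scale\<close>. Cell 0 is set to 1 only after the candidate has been written,
  because \<open>eval_prog\<close> multiplies this cell into terms of weight below
  \<open>k\<close>.\<close>

definition try_prog :: "nat \<Rightarrow> nat \<Rightarrow> (nat \<Rightarrow> real) \<times> nat \<Rightarrow> com" where
  "try_prog k \<kappa> = (\<lambda>(\<epsilon>, l).
     Seq (MapLoop 3 num_vars 8
       (RMul (RDiv (RSub (rnat 1) (RDiv (rnat (2 * l)) (rnat (5 * (k - \<kappa>))))) (RMul (rnat \<kappa>) (RRoot 2 (rnat 3))))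
         (comb_exp \<epsilon> \<kappa>)))
     (Seq (RAssign 8 (IConst 0) (rnat 1)) (Seq (eval_prog k)
       (Cond (RLess (RRead 5 (IConst 6)) gain_exp)
         (Seq (RAssign 5 (IConst 6) gain_exp) (MapLoop 3 num_vars 9 (RRead 8 (counter 3)))) Skip))))"

definition cand_list :: "nat \<Rightarrow> nat \<Rightarrow> ((nat \<Rightarrow> real) \<times> nat) list" where
  "cand_list k \<kappa> = (SOME cs. set cs = signs \<kappa> \<times> {..k - \<kappa>})"

lemma set_cand_list: "set (cand_list k \<kappa>) = signs \<kappa> \<times> {..k - \<kappa>}"
  unfolding cand_list_def by (rule someI_ex) (auto intro!: finite_list)

definition phase_prog :: "nat \<Rightarrow> nat \<Rightarrow> com" where
  "phase_prog k \<kappa> = Seq (fill_prog \<kappa>) (Seq (Seqs (map contract_prog (rev [0..<\<kappa> - 1])))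
     (Seq sign_prog (Seqs (map (try_prog k \<kappa>) (cand_list k \<kappa>)))))"

definition init_prog :: "nat \<Rightarrow> com" where
  "init_prog k = Seq (MapLoop 3 num_vars 8 (rnat 0)) (Seq (RAssign 8 (IConst 0) (rnat 1)) (Seq (eval_prog k)
     (Seq (RAssign 5 (IConst 4) (RRead 5 (IConst 5))) (Seq (RAssign 5 (IConst 6) (rnat 0))
       (MapLoop 3 num_vars 9 (RRead 8 (counter 3)))))))"

text \<open>The final assignment removes the padding value 1 from cell 0: the rounding treats every
  cell as a mean \<open>x\<close> with \<open>\<bar>sqrt 3 * x\<bar> \<le> 1\<close>.\<close>

definition search_prog :: "nat \<Rightarrow> com" where
  "search_prog k = Seq (init_prog k) (Seq (Seqs (map (phase_prog k) [1..<Suc k])) (RAssign 9 (IConst 0) (rnat 0)))"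

section \<open>Correctness and running time of the search\<close>

section \<open>Correctness of the search\<close>

text \<open>Cells 0 and 1 of integer array 0 hold the sizes; the other integer arrays and real array
  0 hold the terms. The search keeps all of them, so every phase can read the input again.\<close>

definition respects_input :: "com \<Rightarrow> bool" where
  "respects_input c \<longleftrightarrow> int_writes c \<subseteq> {0} \<times> {2..} \<and> real_writes c \<subseteq> {5..} \<times> UNIV"

lemma respects_input_simps [simp]:
  "respects_input Skip"
  "respects_input (Seq c d) \<longleftrightarrow> respects_input c \<and> respects_input d"
  "respects_input (Cond t c d) \<longleftrightarrow> respects_input c \<and> respects_input d"
  "respects_input (For i b c) \<longleftrightarrow> 2 \<le> i \<and> respects_input c"
  "respects_input (SumLoop i r b e) \<longleftrightarrow> 2 \<le> i"
  "respects_input (MapLoop i b a e) \<longleftrightarrow> 2 \<le> i \<and> 5 \<le> a"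
  "respects_input (Seqs cs) \<longleftrightarrow> (\<forall>c\<in>set cs. respects_input c)"
  by (auto simp: respects_input_def)

lemma respects_input_RAssign [simp]: "5 \<le> a \<Longrightarrow> respects_input (RAssign a i e)"
  by (auto simp: respects_input_def)

lemma respects_input_progs [simp]:
  "respects_input (eval_prog k)" "respects_input (fill_prog \<kappa>)" "respects_input (gap_prog l)"
  "respects_input (norms_prog l)" "respects_input (choose_prog l)" "respects_input (contract_prog l)"
  "respects_input sign_prog" "respects_input (try_prog k \<kappa> c)" "respects_input (phase_prog k \<kappa>)"
  "respects_input (init_prog k)" "respects_input (search_prog k)"
  by (auto simp: eval_prog_def fill_prog_def add_cmd_def gap_prog_def norms_prog_def choose_prog_def
    contract_prog_def sign_prog_def try_prog_def phase_prog_def init_prog_def search_prog_def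
    case_prod_unfold Let_def)

lemma same_outside_array:
  "same_outside c s s' \<Longrightarrow> {a} \<times> UNIV \<inter> real_writes c = {} \<Longrightarrow> reals s' a = reals s a"
  by (rule ext, rule same_outside_real) auto

lemma greedy_gap_cong:
  assumes "\<And>j. j < i \<Longrightarrow> Y j = Y' j"
  shows "greedy_gap N L X Y i = greedy_gap N L X Y' i"
  using assms by (simp add: greedy_gap_def)

lemma bloch_poly_cong:
  assumes "\<And>v. 1 \<le> v \<Longrightarrow> v < 4 * n \<Longrightarrow> x v = y v"
  shows "bloch_poly k n \<alpha> x = bloch_poly k n \<alpha> y"
  unfolding bloch_poly_def
proof (intro sum.cong refl arg_cong2[of _ _ _ _ "(*)"] prod.cong)
  fix P v assume "P \<in> local_paulis k n" "v \<in> var_set P"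
  moreover from this have "v \<noteq> 0" using zero_notin_var_set by metis
  ultimately show "x v = y v"
    using var_set_less[of v P] by (intro assms) (auto simp: local_paulis_def)
qed

locale problem =
  fixes k n :: nat and \<alpha> :: "pauli list \<Rightarrow> real" and Ps :: "pauli list list"
  assumes k: "1 \<le> k" and n: "1 \<le> n"
    and Ps: "distinct Ps" "set Ps = local_paulis k n"
begin

abbreviation N :: nat where "N \<equiv> 4 * n"

definition K :: nat where "K = N ^ k"

definition entry :: "pauli list \<Rightarrow> nat \<Rightarrow> nat" where
  "entry P r = (if r < pauli_weight P then pauli_vars P ! r else 0)"

text \<open>Position and letter enter only through the variable number, which is 0 for the factors
  that an observable lacks.\<close>

definition loaded :: "store \<Rightarrow> bool" where
  "loaded s \<longleftrightarrow> ints s 0 0 = n \<and> ints s 0 1 = length Ps \<and>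
     (\<forall>j<length Ps. ints s 1 j = pauli_weight (Ps ! j) \<and> reals s 0 j = \<alpha> (Ps ! j) \<and>
       (\<forall>r<k. 4 * ints s (2 * r + 2) j + ints s (2 * r + 3) j = entry (Ps ! j) r))"

lemma loaded_mono:
  assumes "loaded s" "same_outside c s s'" "respects_input c"
  shows "loaded s'"
proof -
  have "ints s' a j = ints s a j" if "a \<noteq> 0 \<or> j < 2" for a j
    using assms(2,3) that by (intro same_outside_int) (auto simp: respects_input_def)
  moreover have "reals s' 0 j = reals s 0 j" for j
    using assms(2,3) by (intro same_outside_real) (auto simp: respects_input_def)
  ultimately show ?thesis using assms(1) by (simp add: loaded_def)
qed

lemma K_ge: "m \<le> k \<Longrightarrow> N ^ m \<le> K" "1 \<le> K" "N \<le> K"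
proof -
  show "m \<le> k \<Longrightarrow> N ^ m \<le> K" for m
    unfolding K_def using n by (intro power_increasing) auto
  from this[of 0] this[of 1] show "1 \<le> K" "N \<le> K" using k by simp_all
qed

lemma entry_less: "j < length Ps \<Longrightarrow> entry (Ps ! j) r < N"
proof -
  assume "j < length Ps"
  then have "length (Ps ! j) = n" using Ps nth_mem[of j Ps] by (auto simp: local_paulis_def)
  then show ?thesis
    using n var_set_less[of "pauli_vars (Ps ! j) ! r" "Ps ! j"] by (auto simp: entry_def var_set_def)
qed

text \<open>Padding the variables of an observable with zeros to a list of length \<open>k\<close>
  is injective, because the nonzero entries give back the set of variables.\<close>

lemma length_Ps: "length Ps \<le> K"
proof -
  have set: "set (map (entry P) [0..<k]) - {0} = var_set P" if "P \<in> local_paulis k n" for P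
  proof -
    have "pauli_weight P \<le> k" using that by (simp add: local_paulis_def)
    then show ?thesis
      using zero_notin_var_set[of P]
      by (fastforce simp: entry_def var_set_def in_set_conv_nth image_iff split: if_splits)
  qed
  have "inj_on (\<lambda>P. map (entry P) [0..<k]) (local_paulis k n)"
  proof (rule inj_onI)
    fix P P' assume P: "P \<in> local_paulis k n" "P' \<in> local_paulis k n"
      and "map (entry P) [0..<k] = map (entry P') [0..<k]"
    then have "var_set P = var_set P'" by (metis set)
    then show "P = P'" using P by (intro var_set_inject) (auto simp: local_paulis_def)
  qed
  moreover have "(\<lambda>P. map (entry P) [0..<k]) ` local_paulis k n \<subseteq> lists_below N k"
    using entry_less Ps by (auto simp: lists_below_def) (metis in_set_conv_nth)
  ultimately have "card (local_paulis k n) \<le> card (lists_below N k)"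
    by (intro card_inj_on_le) auto
  also have "card (lists_below N k) = N ^ k"
    using sum_enc[of "\<lambda>_. 1 :: nat" N k] by simp
  finally show ?thesis using distinct_card[OF Ps(1)] Ps(2) by (simp add: K_def)
qed

lemma ival_var_exp:
  assumes "loaded s" "ints s 0 2 = j" "j < length Ps" "r < k"
  shows "ival (var_exp r) s = entry (Ps ! j) r"
  using assms by (simp add: var_exp_def loaded_def)

lemma sum_Ps: "(\<Sum>j<length Ps. f (Ps ! j)) = (\<Sum>P\<in>local_paulis k n. f P)"
  using sum.reindex_bij_betw[OF bij_betw_nth[OF Ps(1), of "{..<length Ps}" "local_paulis k n"], of f]
  by (simp add: Ps(2))

text \<open>Missing factors read the cell with value 1, so a product of the fixed length
  \<open>k\<close> computes every monomial.\<close>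

lemma does_eval:
  assumes s0: "loaded s0" and x0: "reals s0 8 0 = 1"
  shows "does (13 * K) (eval_prog k) s0 (\<lambda>s. reals s 5 5 = bloch_poly k n \<alpha> (reals s0 8))"
proof -
  let ?x = "reals s0 8"
  let ?e = "foldr (\<lambda>r e. RMul (RRead 8 (var_exp r)) e) [0..<k] (RRead 0 (counter 2))"
  have prod: "(\<Prod>r<k. ?x (entry P r)) = (\<Prod>v\<in>var_set P. ?x v)" if P: "P \<in> local_paulis k n" for P
  proof -
    have w: "pauli_weight P \<le> k" using P by (simp add: local_paulis_def)
    have "(\<Prod>r<k. ?x (entry P r)) = (\<Prod>r<pauli_weight P. ?x (pauli_vars P ! r))"
      using w x0 by (intro prod.mono_neutral_cong_right) (auto simp: entry_def)
    also have "\<dots> = (\<Prod>v\<in>var_set P. ?x v)"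
      unfolding var_set_def
      by (rule prod.reindex_bij_betw[OF bij_betw_nth[OF distinct_pauli_vars]]) auto
    finally show ?thesis .
  qed
  have "does (length Ps * 6 + 7) (eval_prog k) s0
      (\<lambda>s. reals s 5 5 = (\<Sum>j<length Ps. \<alpha> (Ps ! j) * (\<Prod>r<k. ?x (entry (Ps ! j) r))))"
    unfolding eval_prog_def
  proof (rule does_SumLoop)
    fix s assume s: "same_outside (SumLoop 2 5 (counter 1) ?e) s0 s"
    have l: "loaded s" by (rule loaded_mono[OF s0 s]) simp
    then show "ival (counter 1) s = length Ps" by (simp add: loaded_def)
    fix i assume i: "i < length Ps" "ints s 0 2 = i"
    have x: "reals s 8 = ?x" by (rule same_outside_array[OF s]) auto
    have "rval (foldr (\<lambda>r e. RMul (RRead 8 (var_exp r)) e) rs e) s =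
        (\<Prod>r\<leftarrow>rs. ?x (entry (Ps ! i) r)) * rval e s" if "set rs \<subseteq> {..<k}" for rs e
      using that by (induction rs) (auto simp: ival_var_exp[OF l i(2,1)] x)
    from this[of "[0..<k]"] show "rval ?e s = \<alpha> (Ps ! i) * (\<Prod>r<k. ?x (entry (Ps ! i) r))"
      using l i by (auto simp: loaded_def prod.distinct_set_conv_list[symmetric] lessThan_atLeast0)
  qed
  then show ?thesis
  proof (rule does_mono)
    show "length Ps * 6 + 7 \<le> 13 * K" using length_Ps K_ge by linarith
  next
    fix s assume "reals s 5 5 = (\<Sum>j<length Ps. \<alpha> (Ps ! j) * (\<Prod>r<k. ?x (entry (Ps ! j) r)))"
    then show "reals s 5 5 = bloch_poly k n \<alpha> ?x"
      unfolding sum_Ps[of "\<lambda>P. \<alpha> P * (\<Prod>r<k. ?x (entry P r))"] bloch_poly_def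
      by (simp add: prod)
  qed
qed

lemma ival_enc_exp:
  assumes "loaded s" "ints s 0 2 = j" "j < length Ps" "set rs \<subseteq> {..<k}"
  shows "ival (enc_exp rs) s = enc N (map (entry (Ps ! j)) rs)"
  using assms(4)
proof (induction rs)
  case (Cons r rs)
  then show ?case using ival_var_exp[OF assms(1-3), of r] assms(1) by (simp add: loaded_def)
qed simp

definition fill_time :: "nat \<Rightarrow> nat" where
  "fill_time \<kappa> = 2 * length (perm_list \<kappa>) + 30"

text \<open>Every observable of weight \<open>\<kappa>\<close> adds its coefficient at the addresses
  of all orderings of its variables. As \<open>enc\<close> is injective on lists of this length, the
  cell of \<open>xs\<close> receives a coefficient exactly from an observable whose variables
  \<open>xs\<close> orders.\<close>

lemma does_fill:
  assumes s0: "loaded s0" and \<kappa>: "1 \<le> \<kappa>" "\<kappa> \<le> k"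
  shows "does (fill_time \<kappa> * K) (fill_prog \<kappa>) s0 (\<lambda>s. \<forall>xs\<in>lists_below N \<kappa>.
    reals s (tensor_arr \<kappa>) (enc N xs) = term_family.tensor (level n \<kappa>) var_set \<alpha> xs)"
proof -
  interpret term_family "level n \<kappa>" var_set \<alpha> \<kappa> N
    using term_family_level \<kappa> by blast
  let ?T = "tensor_arr \<kappa>" and ?ps = "perm_list \<kappa>"
  \<comment> \<open>The amount that the visit to \<open>P\<close> adds to the cell with address
    \<open>w\<close>.\<close>
  define c where "c P w = (if pauli_weight P = \<kappa>
    then \<Sum>i<length ?ps. if enc N (map (entry P) (?ps ! i)) = w then \<alpha> P else 0 else 0)" for P w
  define body where "body = Cond (BAnd (BNot (ILess (IRead 1 (counter 2)) (IConst \<kappa>)))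
    (BNot (ILess (IConst \<kappa>) (IRead 1 (counter 2))))) (Seqs (map (add_cmd \<kappa>) ?ps)) Skip"
  have ps: "set \<pi> = {..<\<kappa>}" if "\<pi> \<in> set ?ps" for \<pi>
    using that perm_list(1)[of \<kappa>] by (auto simp: permutations_of_set_def)
  have body_respects: "respects_input body" by (auto simp: body_def add_cmd_def)
  have zero: "does (N ^ \<kappa> * 6 + 5) (MapLoop 3 (num_vars_pow \<kappa>) ?T (rnat 0)) s0
      (\<lambda>s. \<forall>i. reals s ?T i = (if i < N ^ \<kappa> then 0 else reals s0 ?T i))"
  proof (rule does_MapLoop)
    fix s assume "same_outside (MapLoop 3 (num_vars_pow \<kappa>) ?T (rnat 0)) s0 s"
    then have "loaded s" by (rule loaded_mono[OF s0]) simp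
    then show "ival (num_vars_pow \<kappa>) s = N ^ \<kappa>" by (simp add: loaded_def)
  qed simp
  have loop: "does (length Ps * (2 * length ?ps + 1 + 5) + 5) (For 2 (counter 1) body) s1
      (\<lambda>s. \<forall>w. reals s ?T w = reals s1 ?T w + (\<Sum>j<length Ps. c (Ps ! j) w))"
    if s1: "loaded s1" for s1
  proof (rule does_For[where I = "\<lambda>i s. \<forall>w. reals s ?T w = reals s1 ?T w + (\<Sum>j<i. c (Ps ! j) w)"])
    show "(0, 2) \<notin> int_writes body" by (auto simp: body_def add_cmd_def)
  next
    fix s assume "same_outside (For 2 (counter 1) body) s1 s"
    then have "loaded s" by (rule loaded_mono[OF s1]) (simp add: body_respects)
    then show "ival (counter 1) s = length Ps" by (simp add: loaded_def)
  next
    fix i s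
    assume i: "i < length Ps" "ints s 0 2 = i"
      and inv: "\<forall>w. reals s ?T w = reals s1 ?T w + (\<Sum>j<i. c (Ps ! j) w)"
      and same: "same_outside (For 2 (counter 1) body) s1 s"
    have l: "loaded s" by (rule loaded_mono[OF s1 same]) (simp add: body_respects)
    show "does (2 * length ?ps + 1) body s (\<lambda>s. \<forall>w. reals s ?T w = reals s1 ?T w + (\<Sum>j<Suc i. c (Ps ! j) w))"
      unfolding body_def
    proof (rule does_Cond)
      assume "bval (BAnd (BNot (ILess (IRead 1 (counter 2)) (IConst \<kappa>)))
        (BNot (ILess (IConst \<kappa>) (IRead 1 (counter 2))))) s"
      then have w: "pauli_weight (Ps ! i) = \<kappa>" using l i by (simp add: loaded_def)
      have "does (length (map (add_cmd \<kappa>) ?ps) * (1 + 1)) (Seqs (map (add_cmd \<kappa>) ?ps)) s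
        ((\<lambda>m s'. \<forall>w. reals s' ?T w = reals s ?T w +
          (\<Sum>j<m. if enc N (map (entry (Ps ! i)) (?ps ! j)) = w then \<alpha> (Ps ! i) else 0)) (length (map (add_cmd \<kappa>) ?ps)))"
      proof (rule does_Seqs)
        fix m s'
        assume m: "m < length (map (add_cmd \<kappa>) ?ps)"
          and inv: "\<forall>w. reals s' ?T w = reals s ?T w +
            (\<Sum>j<m. if enc N (map (entry (Ps ! i)) (?ps ! j)) = w then \<alpha> (Ps ! i) else 0)"
          and same': "same_outside (Seqs (map (add_cmd \<kappa>) ?ps)) s s'"
        have l': "loaded s'" by (rule loaded_mono[OF l same']) (auto simp: add_cmd_def)
        have i': "ints s' 0 2 = i"
          using same_outside_int[OF same', of 0 2] i by (auto simp: add_cmd_def)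
        have "set (?ps ! m) \<subseteq> {..<k}" using ps[of "?ps ! m"] m \<kappa> by auto
        note e = ival_enc_exp[OF l' i' i(1) this]
        have \<alpha>: "reals s' 0 i = \<alpha> (Ps ! i)" using l' i by (simp add: loaded_def)
        show "does 1 (map (add_cmd \<kappa>) ?ps ! m) s' (\<lambda>s'. \<forall>w. reals s' ?T w = reals s ?T w +
            (\<Sum>j<Suc m. if enc N (map (entry (Ps ! i)) (?ps ! j)) = w then \<alpha> (Ps ! i) else 0))"
          using m inv by (auto simp: add_cmd_def e i' \<alpha> intro!: does_RAssign)
      qed simp
      then show "does (2 * length ?ps) (Seqs (map (add_cmd \<kappa>) ?ps)) s
          (\<lambda>s. \<forall>w. reals s ?T w = reals s1 ?T w + (\<Sum>j<Suc i. c (Ps ! j) w))"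
        by (rule does_mono) (use inv w in \<open>auto simp: c_def\<close>)
    next
      assume "\<not> bval (BAnd (BNot (ILess (IRead 1 (counter 2)) (IConst \<kappa>)))
        (BNot (ILess (IConst \<kappa>) (IRead 1 (counter 2))))) s"
      then have w: "pauli_weight (Ps ! i) \<noteq> \<kappa>" using l i by (auto simp: loaded_def)
      show "does (2 * length ?ps) Skip s
          (\<lambda>s. \<forall>w. reals s ?T w = reals s1 ?T w + (\<Sum>j<Suc i. c (Ps ! j) w))"
        by (rule does_Skip) (use inv w in \<open>auto simp: c_def\<close>)
    qed
  qed auto
  have result: "(\<Sum>j<length Ps. c (Ps ! j) (enc N xs)) = tensor xs" if xs: "xs \<in> lists_below N \<kappa>" for xs
  proof -
    have c: "c P (enc N xs) = (if xs \<in> permutations_of_set (var_set P) then \<alpha> P else 0)"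
      if P: "P \<in> level n \<kappa>" for P
    proof -
      have w: "pauli_weight P = \<kappa>" "length P = n" using P by (auto simp: level_def)
      have bij: "bij_betw (entry P) {..<\<kappa>} (var_set P)"
      proof -
        have "bij_betw ((!) (pauli_vars P)) {..<\<kappa>} (var_set P)"
          by (rule bij_betw_nth[OF distinct_pauli_vars]) (auto simp: var_set_def w)
        then show ?thesis by (rule bij_betw_cong[THEN iffD1, rotated]) (auto simp: entry_def w)
      qed
      have img: "map (entry P) ` permutations_of_set {..<\<kappa>} = permutations_of_set (var_set P)"
        using permutations_of_set_image_inj[of "entry P" "{..<\<kappa>}"] bij by (auto simp: bij_betw_def)
      have inj: "inj_on (map (entry P)) (permutations_of_set {..<\<kappa>})"
      proof (rule inj_onI)
        fix \<pi> \<pi>' assume "\<pi> \<in> permutations_of_set {..<\<kappa>}" "\<pi>' \<in> permutations_of_set {..<\<kappa>}"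
          and eq: "map (entry P) \<pi> = map (entry P) \<pi>'"
        then show "\<pi> = \<pi>'"
          using bij by (intro map_inj_on[OF eq]) (auto simp: bij_betw_def permutations_of_set_def)
      qed
      have mem: "map (entry P) \<pi> \<in> lists_below N \<kappa>" if "\<pi> \<in> permutations_of_set {..<\<kappa>}" for \<pi>
        using perm_lists[OF P] img that by blast
      have "c P (enc N xs) = (\<Sum>\<pi>\<in>set ?ps. if enc N (map (entry P) \<pi>) = enc N xs then \<alpha> P else 0)"
        using sum.reindex_bij_betw[OF bij_betw_nth[OF perm_list(2)[of \<kappa>] refl refl],
          of "\<lambda>\<pi>. if enc N (map (entry P) \<pi>) = enc N xs then \<alpha> P else 0"]
        by (simp add: c_def w)
      also have "\<dots> = (\<Sum>\<pi>\<in>permutations_of_set {..<\<kappa>}. if map (entry P) \<pi> = xs then \<alpha> P else 0)"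
        unfolding perm_list by (intro sum.cong refl if_cong) (metis mem xs enc_inj inj_on_eq_iff)
      also have "\<dots> = (\<Sum>ys\<in>map (entry P) ` permutations_of_set {..<\<kappa>}. if ys = xs then \<alpha> P else 0)"
        by (simp add: sum.reindex[OF inj])
      also have "\<dots> = (if xs \<in> permutations_of_set (var_set P) then \<alpha> P else 0)"
        unfolding img by simp
      finally show ?thesis .
    qed
    have "(\<Sum>j<length Ps. c (Ps ! j) (enc N xs)) = (\<Sum>P\<in>local_paulis k n. c P (enc N xs))"
      by (rule sum_Ps)
    also have "\<dots> = (\<Sum>P\<in>level n \<kappa>. c P (enc N xs))"
      using \<kappa> by (intro sum.mono_neutral_right finite_local_paulis)
        (auto simp: level_def local_paulis_def c_def)
    finally show ?thesis using c by (simp add: tensor_def)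
  qed
  have "does ((N ^ \<kappa> * 6 + 5) + 1 + (length Ps * (2 * length ?ps + 1 + 5) + 5)) (fill_prog \<kappa>) s0
      (\<lambda>s. \<forall>xs\<in>lists_below N \<kappa>. reals s ?T (enc N xs) = tensor xs)"
    unfolding fill_prog_def body_def[symmetric]
  proof (rule does_Seq[OF zero])
    fix s1 assume z: "\<forall>i. reals s1 ?T i = (if i < N ^ \<kappa> then 0 else reals s0 ?T i)"
      and same: "same_outside (MapLoop 3 (num_vars_pow \<kappa>) ?T (rnat 0)) s0 s1"
    have l: "loaded s1" by (rule loaded_mono[OF s0 same]) simp
    show "does (length Ps * (2 * length ?ps + 1 + 5) + 5) (For 2 (counter 1) body) s1
        (\<lambda>s. \<forall>xs\<in>lists_below N \<kappa>. reals s ?T (enc N xs) = tensor xs)"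
      by (rule does_mono[OF loop[OF l]]) (use z result enc_less[of _ N \<kappa>] in auto)
  qed
  then show ?thesis
  proof (rule does_mono)
    have "length Ps * (2 * length ?ps + 6) \<le> K * (2 * length ?ps + 6)"
      using length_Ps by (rule mult_right_mono) simp
    then show "(N ^ \<kappa> * 6 + 5) + 1 + (length Ps * (2 * length ?ps + 1 + 5) + 5) \<le> fill_time \<kappa> * K"
      using K_ge(1)[OF \<kappa>(2)] K_ge(2) by (simp add: fill_time_def algebra_simps)
  qed
qed

lemma N_pow_pos: "1 \<le> N ^ l"
  using n by simp

text \<open>The coefficients 18, 32 and 7 of the expanded left-hand side add up to 57, and each of
  its monomials is at most \<open>p * q\<close>.\<close>

lemma gap_time:
  fixes p q :: nat
  assumes "1 \<le> p" "1 \<le> q"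
  shows "p * ((6 * q + 7) + 1 + ((6 * q + 7) + 1 + ((6 * q + 7) + 1 + (1 + 2))) + 5) + 5 + 2 \<le> 57 * (p * q)"
proof -
  have "p \<le> p * q" "1 \<le> p * q" using assms by simp_all
  moreover have "p * ((6 * q + 7) + 1 + ((6 * q + 7) + 1 + ((6 * q + 7) + 1 + (1 + 2))) + 5) + 5 + 2 =
      18 * (p * q) + 32 * p + 7"
    by (simp add: algebra_simps)
  ultimately show ?thesis by linarith
qed

lemma does_gap:
  fixes l :: nat and s0 :: store
  defines "X \<equiv> reals s0 (tensor_arr (Suc (Suc l)))" and "U \<equiv> reals s0 (tensor_arr (Suc l))"
    and "a \<equiv> reals s0 6" and "S \<equiv> reals s0 7" and "i \<equiv> ints s0 0 2" and "M \<equiv> N ^ Suc l"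
  defines "b \<equiv> \<lambda>v. \<Sum>q<N ^ l. (X (i * M + (q * N + v)))\<^sup>2"
  assumes s0: "loaded s0"
  shows "does (57 * M) (gap_prog l) s0 (\<lambda>s.
    reals s 5 0 = (\<Sum>v<N. (\<Sum>q<N ^ l. U (q * N + v) * X (i * M + (q * N + v))) *
      (9 * a v - 2 * ((\<Sum>q<N ^ l. (U (q * N + v))\<^sup>2) + b v + 3 * (S v - b v))) / (a v * sqrt (a v))) \<and>
    (\<forall>v<N. reals s 7 v = S v - b v))"
proof -
  define dot where "dot v = (\<Sum>q<N ^ l. U (q * N + v) * X (i * M + (q * N + v)))" for v
  define w where "w v = (\<Sum>q<N ^ l. (U (q * N + v))\<^sup>2)" for v
  define g where "g v = dot v * (9 * a v - 2 * (w v + b v + 3 * (S v - b v))) / (a v * sqrt (a v))" for v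
  define body where "body = (Seq (SumLoop 4 1 (num_vars_pow l) (RMul (prefix_exp l) (slice_exp l)))
     (Seq (SumLoop 4 2 (num_vars_pow l) (RMul (slice_exp l) (slice_exp l)))
     (Seq (SumLoop 4 3 (num_vars_pow l) (RMul (prefix_exp l) (prefix_exp l)))
     (Seq (RAssign 7 (counter 3) (RSub (RRead 7 (counter 3)) (RRead 5 (IConst 2))))
       (RAssign 5 (IConst 0) (RAdd (RRead 5 (IConst 0)) gap_term))))))"
  have body_respects: "respects_input body" by (simp add: body_def)
  have loop: "does (N * ((6 * N ^ l + 7) + 1 + ((6 * N ^ l + 7) + 1 + ((6 * N ^ l + 7) + 1 + (1 + 2))) + 5) + 5)
      (For 3 num_vars body) s1
      (\<lambda>s. reals s 5 0 = (\<Sum>v<N. g v) \<and> (\<forall>v. reals s 7 v = (if v < N then S v - b v else S v)))"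
    if s1: "s1 = set_real 5 0 0 s0" for s1
  proof (rule does_For[where I = "\<lambda>m s. reals s 5 0 = (\<Sum>v<m. g v) \<and>
      (\<forall>v. reals s 7 v = (if v < m then S v - b v else S v))"])
    have l1: "loaded s1" using s0 by (simp add: s1 loaded_def)
    show "(0, 3) \<notin> int_writes body" by (auto simp: body_def)
    show "ival num_vars s = N" if "same_outside (For 3 num_vars body) s1 s" for s
    proof -
      have "loaded s" by (rule loaded_mono[OF l1 that]) (simp add: body_respects)
      then show ?thesis by (simp add: loaded_def)
    qed
    fix v s assume v: "v < N" "ints s 0 3 = v"
      and good: "reals s 5 0 = (\<Sum>v<v. g v) \<and> (\<forall>u. reals s 7 u = (if u < v then S u - b u else S u))"
      and same: "same_outside (For 3 num_vars body) s1 s"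
    \<comment> \<open>What all three sums leave intact: they write only counter 4 and one scalar
      cell other than cell 0.\<close>
    define stable where "stable s' \<longleftrightarrow> loaded s' \<and> ints s' 0 2 = i \<and> ints s' 0 3 = v \<and>
      reals s' (tensor_arr (Suc l)) = U \<and> reals s' (tensor_arr (Suc (Suc l))) = X \<and>
      reals s' 6 = a \<and> reals s' 7 = reals s 7 \<and> reals s' 5 0 = reals s 5 0" for s'
    have stable: "stable s"
    proof -
      have "loaded s" by (rule loaded_mono[OF l1 same]) (simp add: body_respects)
      moreover have "ints s 0 2 = ints s1 0 2"
        by (rule same_outside_int[OF same]) (auto simp: body_def)
      moreover have "reals s (tensor_arr (Suc l)) = reals s1 (tensor_arr (Suc l))"
        "reals s (tensor_arr (Suc (Suc l))) = reals s1 (tensor_arr (Suc (Suc l)))"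
        "reals s 6 = reals s1 6"
        by (rule same_outside_array[OF same]; auto simp: body_def)+
      ultimately show ?thesis by (simp add: stable_def v s1 i_def U_def X_def a_def)
    qed
    have stable_mono: "stable s''" if "stable s'" "same_outside (SumLoop 4 r e1 e2) s' s''" "0 < r" for s' s'' r e1 e2
    proof -
      note same' = that(2)
      have "loaded s''" using that loaded_mono[OF _ same'] by (simp add: stable_def)
      moreover have "ints s'' 0 2 = ints s' 0 2" "ints s'' 0 3 = ints s' 0 3"
        by (rule same_outside_int[OF same']; auto)+
      moreover have "reals s'' (tensor_arr (Suc l)) = reals s' (tensor_arr (Suc l))"
        "reals s'' (tensor_arr (Suc (Suc l))) = reals s' (tensor_arr (Suc (Suc l)))"
        "reals s'' 6 = reals s' 6" "reals s'' 7 = reals s' 7"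
        by (rule same_outside_array[OF same']; auto)+
      moreover have "reals s'' 5 0 = reals s' 5 0"
        by (rule same_outside_real[OF same']) (use that(3) in auto)
      ultimately show ?thesis using that(1) by (simp add: stable_def)
    qed
    have sum: "does (6 * N ^ l + 7) (SumLoop 4 r (num_vars_pow l) e) s'
        (\<lambda>s. reals s 5 r = (\<Sum>q<N ^ l. E q))"
      if r: "0 < r" and s': "stable s'" and E: "\<And>s q. stable s \<Longrightarrow> ints s 0 4 = q \<Longrightarrow> rval e s = E q" for s' r e E
    proof (rule does_mono[OF does_SumLoop])
      fix t assume t: "same_outside (SumLoop 4 r (num_vars_pow l) e) s' t"
      have st: "stable t" by (rule stable_mono[OF s' t r])
      then show "ival (num_vars_pow l) t = N ^ l" by (simp add: stable_def loaded_def)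
      show "rval e t = E q" if "ints t 0 4 = q" for q by (rule E[OF st that])
    qed auto
    have prefix: "rval (prefix_exp l) t = U (q * N + v)" if "stable t" "ints t 0 4 = q" for t q
      using that by (simp add: prefix_exp_def stable_def loaded_def)
    have slice: "rval (slice_exp l) t = X (i * M + (q * N + v))" if "stable t" "ints t 0 4 = q" for t q
      using that by (simp add: slice_exp_def stable_def loaded_def M_def)
    let ?c1 = "SumLoop 4 1 (num_vars_pow l) (RMul (prefix_exp l) (slice_exp l))"
    let ?c2 = "SumLoop 4 2 (num_vars_pow l) (RMul (slice_exp l) (slice_exp l))"
    let ?c3 = "SumLoop 4 3 (num_vars_pow l) (RMul (prefix_exp l) (prefix_exp l))"
    let ?upd = "Seq (RAssign 7 (counter 3) (RSub (RRead 7 (counter 3)) (RRead 5 (IConst 2))))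
      (RAssign 5 (IConst 0) (RAdd (RRead 5 (IConst 0)) gap_term))"
    let ?Q = "\<lambda>s. reals s 5 0 = (\<Sum>v<Suc v. g v) \<and> (\<forall>u. reals s 7 u = (if u < Suc v then S u - b u else S u))"
    show "does ((6 * N ^ l + 7) + 1 + ((6 * N ^ l + 7) + 1 + ((6 * N ^ l + 7) + 1 + (1 + 2)))) body s ?Q"
      unfolding body_def
    proof (rule does_Seq[OF sum[OF _ stable]])
      show "0 < (1 :: nat)" by simp
      show "rval (RMul (prefix_exp l) (slice_exp l)) t = U (q * N + v) * X (i * M + (q * N + v))"
        if "stable t" "ints t 0 4 = q" for t q using prefix[OF that] slice[OF that] by simp
      fix s2 assume dot: "reals s2 5 1 = (\<Sum>q<N ^ l. U (q * N + v) * X (i * M + (q * N + v)))"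
        and same2: "same_outside ?c1 s s2"
      have st2: "stable s2" using stable_mono[OF stable same2] by simp
      show "does ((6 * N ^ l + 7) + 1 + ((6 * N ^ l + 7) + 1 + (1 + 2))) (Seq ?c2 (Seq ?c3 ?upd)) s2 ?Q"
      proof (rule does_Seq[OF sum[OF _ st2]])
        show "0 < (2 :: nat)" by simp
        show "rval (RMul (slice_exp l) (slice_exp l)) t = (X (i * M + (q * N + v)))\<^sup>2"
          if "stable t" "ints t 0 4 = q" for t q using slice[OF that] by (simp add: power2_eq_square)
        fix s3 assume b: "reals s3 5 2 = (\<Sum>q<N ^ l. (X (i * M + (q * N + v)))\<^sup>2)"
          and same3: "same_outside ?c2 s2 s3"
        have st3: "stable s3" using stable_mono[OF st2 same3] by simp
        have dot3: "reals s3 5 1 = reals s2 5 1" by (rule same_outside_real[OF same3]) auto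
        show "does ((6 * N ^ l + 7) + 1 + (1 + 2)) (Seq ?c3 ?upd) s3 ?Q"
        proof (rule does_Seq[OF sum[OF _ st3]])
          show "0 < (3 :: nat)" by simp
          show "rval (RMul (prefix_exp l) (prefix_exp l)) t = (U (q * N + v))\<^sup>2"
            if "stable t" "ints t 0 4 = q" for t q using prefix[OF that] by (simp add: power2_eq_square)
          fix s4 assume w: "reals s4 5 3 = (\<Sum>q<N ^ l. (U (q * N + v))\<^sup>2)"
            and same4: "same_outside ?c3 s3 s4"
          have st4: "stable s4" using stable_mono[OF st3 same4] by simp
          have "reals s4 5 1 = reals s3 5 1" "reals s4 5 2 = reals s3 5 2"
            by (rule same_outside_real[OF same4]; auto)+
          then have vals: "reals s4 5 1 = dot v" "reals s4 5 2 = b v" "reals s4 5 3 = w v"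
            using dot b w dot3 by (simp_all add: dot_def b_def w_def)
          \<comment> \<open>Array 7 is updated first, so \<open>gap_term\<close> reads the squared
            norm of what remains after the current slice.\<close>
          show "does (1 + 2) ?upd s4 ?Q"
            using st4 vals good v(1)
            by (intro does_RAssign_Seq does_RAssign)
              (auto simp: stable_def gap_term_def g_def sqrt_def[symmetric])
        qed
      qed
    qed
  qed (auto simp: s1 S_def)
  have "does (57 * M) (gap_prog l) s0
      (\<lambda>s. reals s 5 0 = (\<Sum>v<N. g v) \<and> (\<forall>v. reals s 7 v = (if v < N then S v - b v else S v)))"
    unfolding gap_prog_def body_def[symmetric]
  proof (rule does_mono[OF does_RAssign_Seq[OF loop]])
    show "N * ((6 * N ^ l + 7) + 1 + ((6 * N ^ l + 7) + 1 + ((6 * N ^ l + 7) + 1 + (1 + 2))) + 5) + 5 + 2 \<le> 57 * M"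
      unfolding M_def power_Suc using n N_pow_pos by (intro gap_time) simp_all
  qed auto
  then show ?thesis
    by (rule does_mono) (auto simp: g_def dot_def w_def)
qed

lemma does_norms:
  fixes l :: nat and s0 :: store
  defines "X \<equiv> reals s0 (tensor_arr (Suc (Suc l)))" and "M \<equiv> N ^ Suc l"
  assumes s0: "loaded s0"
  shows "does (N * (M * 6 + 16) + 5) (norms_prog l) s0 (\<lambda>s. \<forall>v<N.
    reals s 6 v = (\<Sum>p<M. (X (p * N + v))\<^sup>2) \<and> reals s 7 v = (\<Sum>p<M. (X (p * N + v))\<^sup>2))"
proof -
  let ?x = "RRead (tensor_arr (Suc (Suc l))) (IAdd (IMul (counter 4) num_vars) (counter 3))"
  let ?sum = "SumLoop 4 2 (num_vars_pow (Suc l)) (RMul ?x ?x)"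
  let ?body = "Seq ?sum (Seq (RAssign 6 (counter 3) (RRead 5 (IConst 2))) (RAssign 7 (counter 3) (RRead 5 (IConst 2))))"
  define computed where "computed m s \<longleftrightarrow> (\<forall>v<m. reals s 6 v = (\<Sum>p<M. (X (p * N + v))\<^sup>2) \<and>
      reals s 7 v = (\<Sum>p<M. (X (p * N + v))\<^sup>2))" for m and s :: store
  have "does (N * ((M * 6 + 7) + 1 + (1 + 2) + 5) + 5) (For 3 num_vars ?body) s0 (computed N)"
  proof (rule does_For[where I = "computed"])
    show "ival num_vars s = N" if "same_outside (For 3 num_vars ?body) s0 s" for s
    proof -
      have "loaded s" by (rule loaded_mono[OF s0 that]) simp
      then show ?thesis by (simp add: loaded_def)
    qed
    fix v s assume v: "v < N" "ints s 0 3 = v"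
      and good: "computed v s"
      and same: "same_outside (For 3 num_vars ?body) s0 s"
    have l: "loaded s" by (rule loaded_mono[OF s0 same]) simp
    have X: "reals s (tensor_arr (Suc (Suc l))) = X"
      unfolding X_def by (rule same_outside_array[OF same]) auto
    show "does ((M * 6 + 7) + 1 + (1 + 2)) ?body s (computed (Suc v))"
    proof (rule does_Seq[OF does_SumLoop])
      fix t assume t: "same_outside ?sum s t"
      have lt: "loaded t" by (rule loaded_mono[OF l t]) simp
      then show "ival (num_vars_pow (Suc l)) t = M"
        by (simp add: loaded_def M_def)
      have Xt: "reals t (tensor_arr (Suc (Suc l))) = X"
        using same_outside_array[OF t, of "tensor_arr (Suc (Suc l))"] X by auto
      have "ints t 0 3 = v" using same_outside_int[OF t, of 0 3] v by auto
      then show "rval (RMul ?x ?x) t = (X (q * N + v))\<^sup>2" if "ints t 0 4 = q" for q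
        using that lt Xt by (simp add: power2_eq_square loaded_def)
    next
      fix t assume sum: "reals t 5 2 = (\<Sum>p<M. (X (p * N + v))\<^sup>2)" and t: "same_outside ?sum s t"
      have "ints t 0 3 = v" using same_outside_int[OF t, of 0 3] v by auto
      moreover have "reals t 6 = reals s 6" "reals t 7 = reals s 7"
        by (rule same_outside_array[OF t]; auto)+
      ultimately show "does (1 + 2)
        (Seq (RAssign 6 (counter 3) (RRead 5 (IConst 2))) (RAssign 7 (counter 3) (RRead 5 (IConst 2)))) t (computed (Suc v))"
        using sum good by (intro does_RAssign_Seq does_RAssign) (auto simp: less_Suc_eq computed_def)
    qed
  qed (auto simp: computed_def)
  then show ?thesis unfolding norms_prog_def by (rule does_mono) (auto simp: computed_def)
qed

text \<open>There are \<open>N\<close> rounds of cost proportional to the size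
  \<open>N ^ Suc l\<close> of the contracted tensor, so the contraction is linear in the size of the
  given one.\<close>

lemma does_contract:
  assumes s0: "loaded s0" and l: "Suc (Suc l) \<le> k"
  shows "does (200 * K) (contract_prog l) s0 (\<lambda>s. greedy N (N ^ l) (reals s (tensor_arr (Suc (Suc l))))
    (reals s (dir_arr (Suc (Suc l)))) (reals s (tensor_arr (Suc l))))"
proof -
  define X where "X = reals s0 (tensor_arr (Suc (Suc l)))"
  define M where "M = N ^ Suc l"
  have NM: "N ^ l * N = M" "N * N ^ l = M" by (simp_all add: M_def)
  define a where "a v = (\<Sum>p<M. (X (p * N + v))\<^sup>2)" for v
  define b where "b j v = (\<Sum>q<N ^ l. (X (j * M + (q * N + v)))\<^sup>2)" for j v
  let ?Y = "\<lambda>s. reals s (dir_arr (Suc (Suc l)))" and ?U = "\<lambda>s. reals s (tensor_arr (Suc l))"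
  let ?gap = "\<lambda>Y i. greedy_gap N (N ^ l) X Y i"
  \<comment> \<open>After \<open>i\<close> rounds the first \<open>i\<close> signs are the greedy
    ones, the lower tensor is the partial sum, and array 7 contains the squared norms of the
    remaining slices.\<close>
  define good where "good i s \<longleftrightarrow> (\<forall>j<i. ?Y s j = (if ?gap (?Y s) j < 0 then - 1 else 1)) \<and>
    (\<forall>w<M. ?U s w = (\<Sum>j<i. ?Y s j * X (j * M + w))) \<and>
    (\<forall>v<N. reals s 7 v = a v - (\<Sum>j<i. b j v))" for i and s :: store
  have less: "q * N + v < M" if "q < N ^ l" "v < N" for q v
  proof -
    have "q * N + v < Suc q * N" using that by simp
    also have "\<dots> \<le> N ^ l * N" using that by (intro mult_right_mono) auto
    finally show ?thesis unfolding NM .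
  qed
  have loop: "does (N * (57 * M + 1 + ((1 + 1) + 1 + (M * 6 + 5)) + 5) + 5) (For 2 num_vars (choose_prog l)) s1 (good N)"
    if s1: "loaded s1" "\<forall>v<N. reals s1 6 v = a v \<and> reals s1 7 v = a v" "\<forall>w<M. ?U s1 w = 0"
      "reals s1 (tensor_arr (Suc (Suc l))) = X" for s1
  proof (rule does_For[where I = good])
    show "(0, 2) \<notin> int_writes (choose_prog l)" by (auto simp: choose_prog_def gap_prog_def)
    show "good 0 s1" using s1 by (simp add: good_def)
    show "good i (set_int 0 2 v s)" if "good i s" for i s v using that by (simp add: good_def)
    fix s assume same: "same_outside (For 2 num_vars (choose_prog l)) s1 s"
    have ls: "loaded s" by (rule loaded_mono[OF s1(1) same]) simp
    then show "ival num_vars s = N" by (simp add: loaded_def)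
    fix i assume i: "i < N" "ints s 0 2 = i" and good: "good i s"
    have "reals s (tensor_arr (Suc (Suc l))) = reals s1 (tensor_arr (Suc (Suc l)))"
      by (rule same_outside_array[OF same]) (auto simp: choose_prog_def gap_prog_def)
    then have X: "reals s (tensor_arr (Suc (Suc l))) = X" using s1(4) by simp
    have "reals s 6 = reals s1 6"
      by (rule same_outside_array[OF same]) (auto simp: choose_prog_def gap_prog_def)
    then have a: "\<forall>v<N. reals s 6 v = a v" using s1(2) by simp
    show "does (57 * M + 1 + ((1 + 1) + 1 + (M * 6 + 5))) (choose_prog l) s (good (Suc i))"
      unfolding choose_prog_def
    proof (rule does_Seq[OF does_gap[OF ls, of l, folded M_def, unfolded X i]])
      fix t assume post: "reals t 5 0 = (\<Sum>v<N. (\<Sum>q<N ^ l. ?U s (q * N + v) * X (i * M + (q * N + v))) *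
          (9 * reals s 6 v - 2 * ((\<Sum>q<N ^ l. (?U s (q * N + v))\<^sup>2) + (\<Sum>q<N ^ l. (X (i * M + (q * N + v)))\<^sup>2) +
            3 * (reals s 7 v - (\<Sum>q<N ^ l. (X (i * M + (q * N + v)))\<^sup>2)))) / (reals s 6 v * sqrt (reals s 6 v))) \<and>
          (\<forall>v<N. reals t 7 v = reals s 7 v - (\<Sum>q<N ^ l. (X (i * M + (q * N + v)))\<^sup>2))"
        and t: "same_outside (gap_prog l) s t"
      have lt: "loaded t" by (rule loaded_mono[OF ls t]) simp
      have it: "ints t 0 2 = i" using same_outside_int[OF t, of 0 2] i by (auto simp: gap_prog_def)
      have arr: "?Y t = ?Y s" "?U t = ?U s" "reals t (tensor_arr (Suc (Suc l))) = X"
        unfolding X[symmetric] by (rule same_outside_array[OF t]; auto simp: gap_prog_def)+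
      have gap: "reals t 5 0 = ?gap (?Y s) i"
      proof -
        have "reals t 5 0 = (\<Sum>v<N. (\<Sum>q<N ^ l. (\<Sum>j<i. ?Y s j * X (j * M + (q * N + v))) * X (i * M + (q * N + v))) *
          (9 * a v - 2 * ((\<Sum>q<N ^ l. (\<Sum>j<i. ?Y s j * X (j * M + (q * N + v)))\<^sup>2) + b i v +
            3 * (a v - (\<Sum>j<Suc i. b j v)))) / (a v * sqrt (a v)))"
          unfolding post[THEN conjunct1]
          using good a less by (intro sum.cong refl) (simp add: good_def b_def)
        then show ?thesis unfolding greedy_gap_def Let_def NM a_def b_def .
      qed
      have S: "reals t 7 v = a v - (\<Sum>j<Suc i. b j v)" if "v < N" for v
        using post[THEN conjunct2] good that by (simp add: good_def b_def)
      let ?y = "if ?gap (?Y s) i < 0 then - 1 else 1 :: real"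
      show "does ((1 + 1) + 1 + (M * 6 + 5)) (Seq (Cond (RLess (RRead 5 (IConst 0)) (rnat 0))
          (RAssign (dir_arr (Suc (Suc l))) (counter 2) (RSub (rnat 0) (rnat 1)))
          (RAssign (dir_arr (Suc (Suc l))) (counter 2) (rnat 1)))
          (MapLoop 3 (num_vars_pow (Suc l)) (tensor_arr (Suc l))
            (RAdd (RRead (tensor_arr (Suc l)) (counter 3))
              (RMul (RRead (dir_arr (Suc (Suc l))) (counter 2))
                (RRead (tensor_arr (Suc (Suc l))) (IAdd (IMul (counter 2) (num_vars_pow (Suc l))) (counter 3))))))) t
          (good (Suc i))" (is "does _ (Seq ?cond ?map) t _")
      proof (rule does_Seq[where P = "\<lambda>t'. t' = set_real (dir_arr (Suc (Suc l))) i ?y t"])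
        show "does (1 + 1) ?cond t (\<lambda>t'. t' = set_real (dir_arr (Suc (Suc l))) i ?y t)"
          using gap it by (intro does_Cond does_RAssign) auto
        fix u assume u: "u = set_real (dir_arr (Suc (Suc l))) i ?y t"
        have lu: "loaded u" using lt by (simp add: u loaded_def arr_simps(6)[THEN leD] dir_arr_def)
        have Yu: "?Y u = (?Y s)(i := ?y)" and arr_u: "?U u = ?U s" "reals u (tensor_arr (Suc (Suc l))) = X" "ints u 0 2 = i"
          "reals u 7 = reals t 7"
          using arr it by (simp_all add: u)
        show "does (M * 6 + 5) ?map u (good (Suc i))"
        proof (rule does_mono[OF does_MapLoop[where E = "\<lambda>w. ?U s w + ?y * X (i * M + w)" and L = M]])
          fix r assume r: "same_outside ?map u r"
          have lr: "loaded r" by (rule loaded_mono[OF lu r]) simp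
          then show "ival (num_vars_pow (Suc l)) r = M" by (simp add: loaded_def M_def)
          have r_arr: "?Y r = ?Y u" "reals r (tensor_arr (Suc (Suc l))) = reals u (tensor_arr (Suc (Suc l)))"
            by (rule same_outside_array[OF r]; auto)+
          have "ints r 0 2 = i" using same_outside_int[OF r, of 0 2] arr_u by auto
          then show "rval (RAdd (RRead (tensor_arr (Suc l)) (counter 3))
              (RMul (RRead (dir_arr (Suc (Suc l))) (counter 2))
                (RRead (tensor_arr (Suc (Suc l))) (IAdd (IMul (counter 2) (num_vars_pow (Suc l))) (counter 3))))) r =
              ?U s w + ?y * X (i * M + w)"
            if "ints r 0 3 = w" "?U r w = ?U u w" for w
            using that lr r_arr arr_u Yu by (simp add: loaded_def M_def)
        next
          fix r assume U: "\<forall>w. ?U r w = (if w < M then ?U s w + ?y * X (i * M + w) else ?U u w)"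
            and r: "same_outside ?map u r"
          have r_arr: "?Y r = (?Y s)(i := ?y)" "reals r 7 = reals t 7"
            unfolding Yu[symmetric] arr_u(4)[symmetric] by (rule same_outside_array[OF r]; auto)+
          \<comment> \<open>The gap at \<open>j\<close> reads only signs at indices below
            \<open>j\<close>, so writing the sign at \<open>i\<close> affects none of these
            gaps.\<close>
          have gap_eq: "?gap (?Y r) j = ?gap (?Y s) j" if "j \<le> i" for j
            by (rule greedy_gap_cong) (use that in \<open>simp add: r_arr\<close>)
          show "good (Suc i) r"
            unfolding good_def
          proof (intro conjI allI impI)
            fix j assume j: "j < Suc i"
            then have gap: "?gap (?Y r) j = ?gap (?Y s) j" by (intro gap_eq) simp
            have "?Y r j = (if ?gap (?Y s) j < 0 then - 1 else 1)"
            proof (cases "j = i")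
              case True
              then show ?thesis by (simp only: r_arr fun_upd_same)
            next
              case False
              then have "?Y r j = ?Y s j" unfolding r_arr(1) by (rule fun_upd_other)
              then show ?thesis using good j False by (simp only: good_def less_Suc_eq) simp
            qed
            then show "?Y r j = (if ?gap (?Y r) j < 0 then - 1 else 1)" by (simp only: gap)
          next
            fix w assume "w < M"
            then show "?U r w = (\<Sum>j<Suc i. ?Y r j * X (j * M + w))"
              using good U by (simp add: r_arr good_def)
          next
            fix v assume "v < N"
            then show "reals r 7 v = a v - (\<Sum>j<Suc i. b j v)" by (simp only: r_arr S)
          qed
        qed auto
      qed
    qed
  qed
  have "does ((M * 6 + 5) + 1 + ((N * (M * 6 + 16) + 5) + 1 + (N * (57 * M + 1 + ((1 + 1) + 1 + (M * 6 + 5)) + 5) + 5)))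
      (contract_prog l) s0 (\<lambda>s. good N s \<and> reals s (tensor_arr (Suc (Suc l))) = X)"
    unfolding contract_prog_def
  proof (rule does_Seq[OF does_MapLoop[where E = "\<lambda>_. 0" and L = M]])
    let ?map = "MapLoop 3 (num_vars_pow (Suc l)) (tensor_arr (Suc l)) (rnat 0)"
    fix s assume s: "same_outside ?map s0 s"
    have ls: "loaded s" by (rule loaded_mono[OF s0 s]) simp
    then show "ival (num_vars_pow (Suc l)) s = M" by (simp add: loaded_def M_def)
    assume zero: "\<forall>w. ?U s w = (if w < M then 0 else ?U s0 w)"
    have X: "reals s (tensor_arr (Suc (Suc l))) = X"
      unfolding X_def by (rule same_outside_array[OF s]) auto
    show "does ((N * (M * 6 + 16) + 5) + 1 + (N * (57 * M + 1 + ((1 + 1) + 1 + (M * 6 + 5)) + 5) + 5))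
        (Seq (norms_prog l) (For 2 num_vars (choose_prog l))) s (\<lambda>s. good N s \<and> reals s (tensor_arr (Suc (Suc l))) = X)"
    proof (rule does_Seq[OF does_norms[OF ls, of l, folded M_def, unfolded X]])
      fix t assume norms: "\<forall>v<N. reals t 6 v = (\<Sum>p<M. (X (p * N + v))\<^sup>2) \<and> reals t 7 v = (\<Sum>p<M. (X (p * N + v))\<^sup>2)"
        and t: "same_outside (norms_prog l) s t"
      have lt: "loaded t" by (rule loaded_mono[OF ls t]) simp
      have arr: "?U t = ?U s" "reals t (tensor_arr (Suc (Suc l))) = reals s (tensor_arr (Suc (Suc l)))"
        by (rule same_outside_array[OF t]; auto simp: norms_prog_def)+
      show "does (N * (57 * M + 1 + ((1 + 1) + 1 + (M * 6 + 5)) + 5) + 5) (For 2 num_vars (choose_prog l)) t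
          (\<lambda>s. good N s \<and> reals s (tensor_arr (Suc (Suc l))) = X)"
      proof (rule does_mono[OF loop[OF lt]])
        show "\<forall>v<N. reals t 6 v = a v \<and> reals t 7 v = a v" using norms by (simp add: a_def)
        show "\<forall>w<M. ?U t w = 0" using zero arr by simp
        show "reals t (tensor_arr (Suc (Suc l))) = X" using arr X by simp
        fix r assume good: "good N r" and r: "same_outside (For 2 num_vars (choose_prog l)) t r"
        have "reals r (tensor_arr (Suc (Suc l))) = reals t (tensor_arr (Suc (Suc l)))"
          by (rule same_outside_array[OF r]) (auto simp: choose_prog_def gap_prog_def)
        then show "good N r \<and> reals r (tensor_arr (Suc (Suc l))) = X"
          using good arr X by simp
      qed simp
    qed
  qed simp
  then show ?thesis
  proof (rule does_mono)
    have "M \<le> N * M" "N \<le> N * M" "1 \<le> N * M" using n by (simp_all add: M_def)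
    moreover have "N * M \<le> K" using K_ge(1)[OF l] by (simp add: M_def)
    moreover have "(M * 6 + 5) + 1 + ((N * (M * 6 + 16) + 5) + 1 +
        (N * (57 * M + 1 + ((1 + 1) + 1 + (M * 6 + 5)) + 5) + 5)) = 69 * (N * M) + 30 * N + 6 * M + 17"
      by (simp add: algebra_simps)
    ultimately show "(M * 6 + 5) + 1 + ((N * (M * 6 + 16) + 5) + 1 +
        (N * (57 * M + 1 + ((1 + 1) + 1 + (M * 6 + 5)) + 5) + 5)) \<le> 200 * K"
      by linarith
    fix s assume s: "good N s \<and> reals s (tensor_arr (Suc (Suc l))) = X"
    show "greedy N (N ^ l) (reals s (tensor_arr (Suc (Suc l)))) (?Y s) (?U s)"
      unfolding greedy_def s[THEN conjunct2] NM using s unfolding good_def by blast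
  qed
qed

definition identity_coeff :: real where
  "identity_coeff = \<alpha> (replicate n PI)"

definition gain :: "(nat \<Rightarrow> real) \<Rightarrow> real" where
  "gain x = (bloch_poly k n \<alpha> x - identity_coeff)\<^sup>2"

lemma gain_cong:
  "(\<And>v. 1 \<le> v \<Longrightarrow> v < N \<Longrightarrow> x v = y v) \<Longrightarrow> gain x = gain y"
  unfolding gain_def by (metis bloch_poly_cong)

text \<open>Cell 0 is exempt from the bound because it may hold the padding value 1.\<close>

definition best_ok :: "store \<Rightarrow> bool" where
  "best_ok s \<longleftrightarrow> reals s 5 4 = identity_coeff \<and> reals s 5 6 = gain (reals s 9) \<and>
     (\<forall>v<N. 1 \<le> v \<longrightarrow> \<bar>sqrt 3 * reals s 9 v\<bar> \<le> 1)"

lemma rval_comb_exp: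
  assumes "\<epsilon> \<in> signs \<kappa>" "m \<le> \<kappa>"
  shows "rval (comb_exp \<epsilon> m) s = (\<Sum>j\<in>{1..m}. \<epsilon> j * reals s (dir_arr j) (ints s 0 3))"
  using assms(2)
proof (induction m)
  case (Suc m)
  have "\<epsilon> (Suc m) \<in> {- 1, 1}"
    using assms(1) Suc.prems unfolding signs_def by (auto dest!: PiE_mem[of _ _ _ "Suc m"])
  then show ?case using Suc by auto
qed simp

text \<open>A signed sum of \<open>\<kappa>\<close> coordinates of modulus at most 1 is bounded by
  the denominator \<open>\<kappa>\<close>, and the scale only shrinks it.\<close>

lemma candidate_bound:
  assumes "\<epsilon> \<in> signs \<kappa>" "1 \<le> \<kappa>" "l \<le> k - \<kappa>" "\<And>j. j \<in> {1..\<kappa>} \<Longrightarrow> \<bar>Y j v\<bar> \<le> 1"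
  shows "\<bar>sqrt 3 * candidate k \<kappa> \<epsilon> l Y v\<bar> \<le> 1"
proof -
  have "\<bar>\<Sum>j\<in>{1..\<kappa>}. \<epsilon> j * Y j v\<bar> \<le> (\<Sum>j\<in>{1..\<kappa>}. 1)"
  proof (rule order_trans[OF sum_abs sum_mono])
    fix j assume j: "j \<in> {1..\<kappa>}"
    then have "\<epsilon> j \<in> {- 1, 1}" using assms(1) unfolding signs_def by (rule PiE_mem[rotated])
    then show "\<bar>\<epsilon> j * Y j v\<bar> \<le> 1" using assms(4)[OF j] by (auto simp: abs_mult)
  qed
  moreover have "0 \<le> scale (k - \<kappa>) l" "scale (k - \<kappa>) l \<le> 1"
    using scale_bounds[OF assms(3)] by auto
  ultimately have "scale (k - \<kappa>) l * \<bar>\<Sum>j\<in>{1..\<kappa>}. \<epsilon> j * Y j v\<bar> \<le> 1 * real \<kappa>"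
    by (intro mult_mono) auto
  moreover have "\<bar>sqrt 3 * candidate k \<kappa> \<epsilon> l Y v\<bar> = scale (k - \<kappa>) l * \<bar>\<Sum>j\<in>{1..\<kappa>}. \<epsilon> j * Y j v\<bar> / real \<kappa>"
    using \<open>0 \<le> scale (k - \<kappa>) l\<close> by (simp add: candidate_def abs_mult)
  ultimately show ?thesis using assms(2) by simp
qed

lemma copy_time: "N * 6 + 5 \<le> 11 * K"
  using K_ge by linarith

lemma does_try:
  assumes s0: "loaded s0" and best: "best_ok s0" and \<kappa>: "1 \<le> \<kappa>" "\<kappa> \<le> k"
    and \<epsilon>: "\<epsilon> \<in> signs \<kappa>" and l: "l \<le> k - \<kappa>"
    and Y: "\<And>j v. j \<in> {1..\<kappa>} \<Longrightarrow> v < N \<Longrightarrow> \<bar>reals s0 (dir_arr j) v\<bar> \<le> 1"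
  shows "does (100 * K) (try_prog k \<kappa> (\<epsilon>, l)) s0 (\<lambda>s. best_ok s \<and> reals s0 5 6 \<le> reals s 5 6 \<and>
    gain (candidate k \<kappa> \<epsilon> l (\<lambda>j. reals s0 (dir_arr j))) \<le> reals s 5 6)"
proof -
  let ?c = "candidate k \<kappa> \<epsilon> l (\<lambda>j. reals s0 (dir_arr j))"
  let ?e = "RMul (RDiv (RSub (rnat 1) (RDiv (rnat (2 * l)) (rnat (5 * (k - \<kappa>))))) (RMul (rnat \<kappa>) (RRoot 2 (rnat 3))))
    (comb_exp \<epsilon> \<kappa>)"
  let ?Q = "\<lambda>s. best_ok s \<and> reals s0 5 6 \<le> reals s 5 6 \<and> gain ?c \<le> reals s 5 6"
  let ?upd = "Seq (RAssign 5 (IConst 6) gain_exp) (MapLoop 3 num_vars 9 (RRead 8 (counter 3)))"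
  have "does ((N * 6 + 5) + 1 + (13 * K + 1 + (N * 6 + 5 + 2 + 1) + 2)) (try_prog k \<kappa> (\<epsilon>, l)) s0 ?Q"
    unfolding try_prog_def prod.case
  proof (rule does_Seq[OF does_MapLoop[where E = ?c and L = N]])
    fix s assume s: "same_outside (MapLoop 3 num_vars 8 ?e) s0 s"
    have ls: "loaded s" by (rule loaded_mono[OF s0 s]) simp
    then show "ival num_vars s = N" by (simp add: loaded_def)
    have "reals s (dir_arr j) = reals s0 (dir_arr j)" for j
      by (rule same_outside_array[OF s]) auto
    then show "rval ?e s = ?c v" if "ints s 0 3 = v" for v
      using that by (simp add: rval_comb_exp[OF \<epsilon> order_refl] candidate_def scale_def sqrt_def)
  next
    fix s assume x: "\<forall>v. reals s 8 v = (if v < N then ?c v else reals s0 8 v)"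
      and s: "same_outside (MapLoop 3 num_vars 8 ?e) s0 s"
    have ls: "loaded s" by (rule loaded_mono[OF s0 s]) simp
    have s_vals: "reals s 5 = reals s0 5" "reals s 9 = reals s0 9"
      by (rule same_outside_array[OF s]; auto)+
    let ?s = "set_real 8 0 1 s"
    have l': "loaded ?s" using ls by (simp add: loaded_def)
    have x': "reals ?s 8 v = ?c v" if "1 \<le> v" "v < N" for v using x that by simp
    have poly: "bloch_poly k n \<alpha> (reals ?s 8) = bloch_poly k n \<alpha> ?c"
      by (rule bloch_poly_cong) (use x' in auto)
    have "does (13 * K + 1 + (N * 6 + 5 + 2 + 1)) (Seq (eval_prog k)
        (Cond (RLess (RRead 5 (IConst 6)) gain_exp) ?upd Skip)) ?s ?Q"
    proof (rule does_Seq[OF does_eval[OF l']])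
      show "reals ?s 8 0 = 1" by simp
      fix t assume val: "reals t 5 5 = bloch_poly k n \<alpha> (reals ?s 8)" and t: "same_outside (eval_prog k) ?s t"
      have lt: "loaded t" by (rule loaded_mono[OF l' t]) simp
      have "reals t 5 4 = reals ?s 5 4" "reals t 5 6 = reals ?s 5 6"
        by (rule same_outside_real[OF t]; auto simp: eval_prog_def)+
      then have t_vals: "reals t 5 4 = identity_coeff" "reals t 5 6 = reals s0 5 6"
        using best s_vals by (simp_all add: best_ok_def)
      have arr: "reals t 8 = reals ?s 8" "reals t 9 = reals s0 9"
        using same_outside_array[OF t, of 8] same_outside_array[OF t, of 9] s_vals
        by (auto simp: eval_prog_def)
      have g: "rval gain_exp t = gain ?c"
        using val t_vals poly by (simp add: gain_exp_def gain_def power2_eq_square)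
      show "does (N * 6 + 5 + 2 + 1) (Cond (RLess (RRead 5 (IConst 6)) gain_exp) ?upd Skip) t ?Q"
      proof (rule does_Cond)
        assume "bval (RLess (RRead 5 (IConst 6)) gain_exp) t"
        then have less: "reals s0 5 6 < gain ?c" using t_vals g by simp
        let ?t = "set_real 5 6 (rval gain_exp t) t"
        have l2: "loaded ?t" using lt by (simp add: loaded_def)
        show "does (N * 6 + 5 + 2) ?upd t ?Q"
        proof (rule does_RAssign_Seq, unfold ival.simps, rule does_mono[OF does_MapLoop[where E = "reals ?s 8" and L = N]])
          fix r assume r: "same_outside (MapLoop 3 num_vars 9 (RRead 8 (counter 3))) ?t r"
          have lr: "loaded r" by (rule loaded_mono[OF l2 r]) simp
          then show "ival num_vars r = N" by (simp add: loaded_def)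
          have "reals r 8 = reals ?t 8" by (rule same_outside_array[OF r]) auto
          then show "rval (RRead 8 (counter 3)) r = reals ?s 8 v" if "ints r 0 3 = v" for v
            using that arr by simp
        next
          fix r assume copy: "\<forall>v. reals r 9 v = (if v < N then reals ?s 8 v else reals ?t 9 v)"
            and r: "same_outside (MapLoop 3 num_vars 9 (RRead 8 (counter 3))) ?t r"
          have 5: "reals r 5 = reals ?t 5" by (rule same_outside_array[OF r]) auto
          have x9: "reals r 9 v = ?c v" if "1 \<le> v" "v < N" for v
            using copy x' that by simp
          have "gain (reals r 9) = gain ?c" by (rule gain_cong) (rule x9)
          moreover have "\<bar>sqrt 3 * reals r 9 v\<bar> \<le> 1" if "v < N" "1 \<le> v" for v
            unfolding x9[OF that(2,1)] using Y that by (intro candidate_bound \<epsilon> \<kappa> l) auto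
          ultimately show "?Q r" using less g t_vals 5 by (simp add: best_ok_def)
        qed auto
      next
        assume "\<not> bval (RLess (RRead 5 (IConst 6)) gain_exp) t"
        then have "gain ?c \<le> reals s0 5 6" using t_vals g by simp
        then show "does (N * 6 + 5 + 2) Skip t ?Q"
          using best t_vals arr by (intro does_Skip) (simp add: best_ok_def)
      qed
    qed
    then show "does (13 * K + 1 + (N * 6 + 5 + 2 + 1) + 2) (Seq (RAssign 8 (IConst 0) (rnat 1)) (Seq (eval_prog k)
        (Cond (RLess (RRead 5 (IConst 6)) gain_exp) ?upd Skip))) s ?Q"
      by (intro does_RAssign_Seq) simp
  qed
  then show ?thesis by (rule does_mono) (use copy_time K_ge(2) in auto)
qed

definition good_dirs :: "nat \<Rightarrow> (nat \<Rightarrow> nat \<Rightarrow> real) \<Rightarrow> bool" where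
  "good_dirs \<kappa> Y \<longleftrightarrow>
     sqrt (fact (\<kappa> - 1)) * level_infl n \<alpha> \<kappa> \<le> sqrt 3 ^ (\<kappa> - 1) * directional_sum n \<alpha> \<kappa> Y"

text \<open>Later phases overwrite the directions, so these are existentially quantified; only the
  record gain stays in the store. As the record never decreases, the property persists.\<close>

definition explored :: "nat \<Rightarrow> store \<Rightarrow> bool" where
  "explored \<kappa> s \<longleftrightarrow> (\<exists>Y. good_dirs \<kappa> Y \<and>
     (\<forall>\<epsilon>\<in>signs \<kappa>. \<forall>l\<le>k - \<kappa>. gain (candidate k \<kappa> \<epsilon> l Y) \<le> reals s 5 6))"

definition phase_time :: "nat \<Rightarrow> nat" where
  "phase_time \<kappa> = fill_time \<kappa> + 300 * \<kappa> + 200 * length (cand_list k \<kappa>) + 100"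

lemma does_phase:
  assumes s0: "loaded s0" and best: "best_ok s0" and \<kappa>: "1 \<le> \<kappa>" "\<kappa> \<le> k"
  shows "does (phase_time \<kappa> * K) (phase_prog k \<kappa>) s0
    (\<lambda>s. best_ok s \<and> reals s0 5 6 \<le> reals s 5 6 \<and> explored \<kappa> s)"
proof -
  interpret term_family "level n \<kappa>" var_set \<alpha> \<kappa> N
    using term_family_level \<kappa> by blast
  let ?cs = "map contract_prog (rev [0..<\<kappa> - 1])"
  let ?ts = "map (try_prog k \<kappa>) (cand_list k \<kappa>)"
  let ?T = "\<lambda>s m. reals s (tensor_arr m)" and ?D = "\<lambda>s m. reals s (dir_arr m)"
  let ?Q = "\<lambda>s. best_ok s \<and> reals s0 5 6 \<le> reals s 5 6 \<and> explored \<kappa> s"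
  have best_mono: "best_ok s' \<and> reals s' 5 6 = reals s 5 6"
    if "best_ok s" "same_outside c s s'" "{(5, 4), (5, 6)} \<inter> real_writes c = {}" "{9} \<times> UNIV \<inter> real_writes c = {}"
    for s s' c
  proof -
    have "reals s' 5 4 = reals s 5 4" "reals s' 5 6 = reals s 5 6"
      by (rule same_outside_real[OF that(2)]; use that(3) in auto)+
    moreover have "reals s' 9 = reals s 9" by (rule same_outside_array[OF that(2,4)])
    ultimately show ?thesis using that(1) by (simp add: best_ok_def)
  qed
  have contract_real: "real_writes (contract_prog l) \<subseteq>
      ({tensor_arr (Suc l), dir_arr (Suc (Suc l)), 6, 7} \<times> UNIV) \<union> {5} \<times> {..3}" for l
    by (auto simp: contract_prog_def choose_prog_def gap_prog_def norms_prog_def)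
  \<comment> \<open>After \<open>m\<close> contractions the tensors of orders
    \<open>\<kappa>\<close> down to \<open>\<kappa> - m\<close> are all still in memory, each one
    linked to the next by the greedy rule.\<close>
  define chain where "chain m s \<longleftrightarrow> (\<forall>xs\<in>lists_below N \<kappa>. ?T s \<kappa> (enc N xs) = tensor xs) \<and>
    (\<forall>q. \<kappa> - m \<le> q \<and> 1 \<le> q \<and> q < \<kappa> \<longrightarrow> greedy N (N ^ (q - 1)) (?T s (Suc q)) (?D s (Suc q)) (?T s q))"
    for m and s :: store
  have contracts: "does (length ?cs * (200 * K + 1)) (Seqs ?cs) s1 (chain (length ?cs))"
    if s1: "loaded s1" "\<forall>xs\<in>lists_below N \<kappa>. ?T s1 \<kappa> (enc N xs) = tensor xs" for s1
  proof (rule does_Seqs[where I = chain])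
    show "chain 0 s1" using s1 by (auto simp: chain_def)
    fix m s assume m: "m < length ?cs" and ch: "chain m s" and s: "same_outside (Seqs ?cs) s1 s"
    have ls: "loaded s" by (rule loaded_mono[OF s1(1) s]) simp
    \<comment> \<open>Contraction number \<open>m\<close>, counted from 0, starts from order
      \<open>\<kappa> - m\<close>, which is \<open>l + 2\<close>.\<close>
    define l where "l = \<kappa> - 2 - m"
    have l: "?cs ! m = contract_prog l" "Suc l = \<kappa> - Suc m" "Suc (Suc l) \<le> k" "m < \<kappa> - 1"
      using m \<kappa> by (auto simp: l_def rev_nth)
    show "does (200 * K) (?cs ! m) s (chain (Suc m))"
      unfolding l(1)
    proof (rule does_mono[OF does_contract[OF ls l(3)]])
      fix t assume gr: "greedy N (N ^ l) (?T t (Suc (Suc l))) (?D t (Suc (Suc l))) (?T t (Suc l))"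
        and t: "same_outside (contract_prog l) s t"
      have T: "?T t q = ?T s q" if "q \<noteq> Suc l" for q
        using contract_real[of l] that by (intro same_outside_array[OF t]) fastforce
      have D: "?D t q = ?D s q" if "q \<noteq> Suc (Suc l)" for q
        using contract_real[of l] that by (intro same_outside_array[OF t]) fastforce
      show "chain (Suc m) t"
        unfolding chain_def
      proof (intro conjI ballI allI impI)
        fix xs assume "xs \<in> lists_below N \<kappa>"
        then show "?T t \<kappa> (enc N xs) = tensor xs"
          using ch l T[of \<kappa>] by (simp add: chain_def)
      next
        fix q assume q: "\<kappa> - Suc m \<le> q \<and> 1 \<le> q \<and> q < \<kappa>"
        show "greedy N (N ^ (q - 1)) (?T t (Suc q)) (?D t (Suc q)) (?T t q)"
        proof (cases "q = Suc l")
          case True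
          then show ?thesis using gr by simp
        next
          case False
          then have "\<kappa> - m \<le> q" using q l by linarith
          then show ?thesis
            using ch q False T[of q] T[of "Suc q"] D[of "Suc q"] l by (simp add: chain_def)
        qed
      qed
    qed simp
  qed
  have tries: "does (length ?ts * (100 * K + 1)) (Seqs ?ts) s1 ?Q"
    if s1: "loaded s1" "best_ok s1" "reals s1 5 6 = reals s0 5 6" "good_dirs \<kappa> (?D s1)"
      "\<And>j v. j \<in> {1..\<kappa>} \<Longrightarrow> v < N \<Longrightarrow> \<bar>?D s1 j v\<bar> \<le> 1" for s1
  proof -
    define I where "I m s \<longleftrightarrow> best_ok s \<and> reals s0 5 6 \<le> reals s 5 6 \<and>
      (\<forall>i<m. gain (candidate k \<kappa> (fst (cand_list k \<kappa> ! i)) (snd (cand_list k \<kappa> ! i)) (?D s1)) \<le> reals s 5 6)"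
      for m and s :: store
    have "does (length ?ts * (100 * K + 1)) (Seqs ?ts) s1 (I (length ?ts))"
    proof (rule does_Seqs[where I = I])
      show "I 0 s1" using s1 by (simp add: I_def)
      fix m s assume m: "m < length ?ts" and I: "I m s" and s: "same_outside (Seqs ?ts) s1 s"
      have ls: "loaded s" by (rule loaded_mono[OF s1(1) s]) simp
      have D: "?D s = ?D s1"
        by (rule ext, rule same_outside_array[OF s]) (auto simp: try_prog_def eval_prog_def)
      obtain \<epsilon> l where c: "cand_list k \<kappa> ! m = (\<epsilon>, l)" by fastforce
      then have mem: "\<epsilon> \<in> signs \<kappa>" "l \<le> k - \<kappa>"
        using m nth_mem[of m "cand_list k \<kappa>"] set_cand_list[of k \<kappa>] by auto
      have "does (100 * K) (try_prog k \<kappa> (\<epsilon>, l)) s (\<lambda>t. best_ok t \<and> reals s 5 6 \<le> reals t 5 6 \<and>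
          gain (candidate k \<kappa> \<epsilon> l (?D s)) \<le> reals t 5 6)"
        using I s1(5) fun_cong[OF D] by (intro does_try ls \<kappa> mem) (simp_all add: I_def)
      then have "does (100 * K) (try_prog k \<kappa> (\<epsilon>, l)) s (I (Suc m))"
      proof (rule does_mono)
        fix t assume t: "best_ok t \<and> reals s 5 6 \<le> reals t 5 6 \<and>
          gain (candidate k \<kappa> \<epsilon> l (?D s)) \<le> reals t 5 6"
        show "I (Suc m) t"
          unfolding I_def
        proof (intro conjI allI impI)
          show "best_ok t" "reals s0 5 6 \<le> reals t 5 6" using t I by (auto simp: I_def)
          fix i assume "i < Suc m"
          then consider "i = m" | "i < m" by linarith
          then show "gain (candidate k \<kappa> (fst (cand_list k \<kappa> ! i)) (snd (cand_list k \<kappa> ! i)) (?D s1)) \<le> reals t 5 6"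
          proof cases
            case 1
            then show ?thesis using t c D by simp
          next
            case 2
            then have "gain (candidate k \<kappa> (fst (cand_list k \<kappa> ! i)) (snd (cand_list k \<kappa> ! i)) (?D s1)) \<le> reals s 5 6"
              using I by (simp add: I_def)
            then show ?thesis using t by linarith
          qed
        qed
      qed simp
      then show "does (100 * K) (?ts ! m) s (I (Suc m))" using m c by simp
    qed
    then show ?thesis
    proof (rule does_mono)
      fix s assume I: "I (length ?ts) s"
      have "gain (candidate k \<kappa> \<epsilon> l (?D s1)) \<le> reals s 5 6" if "\<epsilon> \<in> signs \<kappa>" "l \<le> k - \<kappa>" for \<epsilon> l
      proof -
        have "(\<epsilon>, l) \<in> set (cand_list k \<kappa>)" using that by (simp add: set_cand_list)
        then obtain i where "i < length (cand_list k \<kappa>)" "cand_list k \<kappa> ! i = (\<epsilon>, l)"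
          by (auto simp: in_set_conv_nth)
        then show ?thesis using I by (force simp: I_def)
      qed
      then show "?Q s" using I s1(4) by (auto simp: I_def explored_def)
    qed simp
  qed
  let ?x = "RRead (tensor_arr 1) (counter 3)"
  have sign: "does (N * 6 + 5) sign_prog s1 (\<lambda>s. \<forall>v<N. ?D s 1 v = sgn (?T s1 1 v))" if s1: "loaded s1" for s1
    unfolding sign_prog_def Let_def
  proof (rule does_mono[OF does_MapLoop[where L = N and E = "\<lambda>v. sgn (?T s1 1 v)"]])
    fix s assume s: "same_outside (MapLoop 3 num_vars (dir_arr 1) (RDiv ?x (RRoot 2 (RMul ?x ?x)))) s1 s"
    have "loaded s" by (rule loaded_mono[OF s1 s]) simp
    then show "ival num_vars s = N" by (simp add: loaded_def)
    have "?T s 1 = ?T s1 1" by (rule same_outside_array[OF s]) auto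
    moreover have "z / root 2 (z * z) = sgn z" for z :: real
      by (simp add: sqrt_def[symmetric] sgn_if)
    ultimately show "rval (RDiv ?x (RRoot 2 (RMul ?x ?x))) s = sgn (?T s1 1 v)" if "ints s 0 3 = v" for v
      using that by simp
  qed auto
  have "does (fill_time \<kappa> * K + 1 + (length ?cs * (200 * K + 1) + 1 +
      ((N * 6 + 5) + 1 + length ?ts * (100 * K + 1)))) (phase_prog k \<kappa>) s0 ?Q"
    unfolding phase_prog_def
  proof (rule does_Seq[OF does_fill[OF s0 \<kappa>]])
    fix s1 assume T: "\<forall>xs\<in>lists_below N \<kappa>. ?T s1 \<kappa> (enc N xs) = tensor xs" and same1: "same_outside (fill_prog \<kappa>) s0 s1"
    have l1: "loaded s1" by (rule loaded_mono[OF s0 same1]) simp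
    have b1: "best_ok s1 \<and> reals s1 5 6 = reals s0 5 6"
      by (rule best_mono[OF best same1]) (auto simp: fill_prog_def add_cmd_def)
    show "does (length ?cs * (200 * K + 1) + 1 + ((N * 6 + 5) + 1 + length ?ts * (100 * K + 1)))
        (Seq (Seqs ?cs) (Seq sign_prog (Seqs ?ts))) s1 ?Q"
    proof (rule does_Seq[OF contracts[OF l1 T]])
      fix s2 assume ch: "chain (length ?cs) s2" and same2: "same_outside (Seqs ?cs) s1 s2"
      have l2: "loaded s2" by (rule loaded_mono[OF l1 same2]) simp
      have b2: "best_ok s2 \<and> reals s2 5 6 = reals s1 5 6"
        by (rule best_mono[OF _ same2]) (use b1 contract_real in fastforce)+
      show "does ((N * 6 + 5) + 1 + length ?ts * (100 * K + 1)) (Seq sign_prog (Seqs ?ts)) s2 ?Q"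
      proof (rule does_Seq[OF sign[OF l2]])
        fix s3 assume sg: "\<forall>v<N. ?D s3 1 v = sgn (?T s2 1 v)" and same3: "same_outside sign_prog s2 s3"
        have l3: "loaded s3" by (rule loaded_mono[OF l2 same3]) simp
        have b3: "best_ok s3 \<and> reals s3 5 6 = reals s2 5 6"
          by (rule best_mono[OF _ same3]) (use b2 in \<open>auto simp: sign_prog_def Let_def\<close>)
        have T3: "?T s3 q = ?T s2 q" for q
          by (rule same_outside_array[OF same3]) (auto simp: sign_prog_def Let_def)
        have D3: "?D s3 q = ?D s2 q" if "q \<noteq> 1" for q
          by (rule same_outside_array[OF same3]) (use that in \<open>auto simp: sign_prog_def Let_def\<close>)
        have gr: "greedy N (N ^ (m - 1)) (?T s3 (Suc m)) (?D s3 (Suc m)) (?T s3 m)" if "1 \<le> m" "m < \<kappa>" for m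
          using ch that D3[of "Suc m"] by (simp add: chain_def T3)
        have "good_dirs \<kappa> (?D s3)"
          unfolding good_dirs_def level_infl_def directional_sum_def
        proof (rule greedy_directions[where U = "?T s3"])
          show "?T s3 \<kappa> (enc N xs) = tensor xs" if "xs \<in> lists_below N \<kappa>" for xs
            using ch that by (simp add: chain_def T3)
          show "?D s3 1 v = sgn (?T s3 1 v)" if "v < N" for v using sg that by (simp add: T3)
        qed (rule gr)
        moreover have "\<bar>?D s3 j v\<bar> \<le> 1" if j: "j \<in> {1..\<kappa>}" and v: "v < N" for j v
        proof (cases "j = 1")
          case True
          then show ?thesis using sg v by (simp add: sgn_if)
        next
          case False
          obtain m where "j = Suc m" using j by (cases j) auto
          then have m: "j = Suc m" "1 \<le> m" "m < \<kappa>" using j False by auto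
          then show ?thesis using gr[OF m(2,3)] v by (simp add: greedy_def)
        qed
        ultimately show "does (length ?ts * (100 * K + 1)) (Seqs ?ts) s3 ?Q"
          using b1 b2 b3 by (intro tries l3) auto
      qed
    qed
  qed
  then show ?thesis
  proof (rule does_mono)
    have cs: "length ?cs \<le> \<kappa>" by simp
    have "length ?cs * (200 * K + 1) \<le> \<kappa> * (300 * K)"
      using K_ge(2) by (intro mult_mono cs) auto
    moreover have "length ?ts * (100 * K + 1) \<le> length (cand_list k \<kappa>) * (200 * K)"
      using K_ge(2) by (intro mult_mono) auto
    moreover have "phase_time \<kappa> * K =
        fill_time \<kappa> * K + \<kappa> * (300 * K) + length (cand_list k \<kappa>) * (200 * K) + 100 * K"
      by (simp add: phase_time_def algebra_simps)
    ultimately show "fill_time \<kappa> * K + 1 + (length ?cs * (200 * K + 1) + 1 +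
        ((N * 6 + 5) + 1 + length ?ts * (100 * K + 1))) \<le> phase_time \<kappa> * K"
      using copy_time K_ge(2) by linarith
  qed
qed

text \<open>At the zero vector only the identity term is left, which gives the reference value; the
  zero vector is also the first record, with gain 0.\<close>

lemma does_init:
  assumes s0: "loaded s0"
  shows "does (100 * K) (init_prog k) s0 best_ok"
proof -
  let ?zero = "MapLoop 3 num_vars 8 (rnat 0)" and ?copy = "MapLoop 3 num_vars 9 (RRead 8 (counter 3))"
  have "does ((N * 6 + 5) + 1 + ((13 * K + 1 + (((N * 6 + 5) + 2) + 2)) + 2)) (init_prog k) s0 best_ok"
    unfolding init_prog_def
  proof (rule does_Seq[OF does_MapLoop[where E = "\<lambda>_. 0" and L = N]])
    fix s assume s: "same_outside ?zero s0 s"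
    have ls: "loaded s" by (rule loaded_mono[OF s0 s]) simp
    then show "ival num_vars s = N" by (simp add: loaded_def)
    assume x: "\<forall>v. reals s 8 v = (if v < N then 0 else reals s0 8 v)"
    let ?s = "set_real 8 0 1 s"
    have l': "loaded ?s" using ls by (simp add: loaded_def)
    have zero: "bloch_poly k n \<alpha> (reals ?s 8) = identity_coeff"
    proof -
      have "bloch_poly k n \<alpha> (reals ?s 8) = bloch_poly k n \<alpha> (\<lambda>_. 0)"
        by (rule bloch_poly_cong) (use x in auto)
      also have "\<dots> = identity_coeff"
      proof -
        have "(\<Sum>\<kappa>\<in>{1..k}. \<Sum>P\<in>level n \<kappa>. \<alpha> P * (\<Prod>v\<in>var_set P. 0 :: real)) = 0"
          by (intro sum.neutral ballI) (auto simp: level_def)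
        then show ?thesis by (simp add: bloch_poly_levels identity_coeff_def)
      qed
      finally show ?thesis .
    qed
    have "does (13 * K + 1 + (((N * 6 + 5) + 2) + 2)) (Seq (eval_prog k)
      (Seq (RAssign 5 (IConst 4) (RRead 5 (IConst 5))) (Seq (RAssign 5 (IConst 6) (rnat 0)) ?copy))) ?s best_ok"
    proof (rule does_Seq[OF does_eval[OF l']])
      show "reals ?s 8 0 = 1" by simp
      fix t assume val: "reals t 5 5 = bloch_poly k n \<alpha> (reals ?s 8)" and t: "same_outside (eval_prog k) ?s t"
      have lt: "loaded t" by (rule loaded_mono[OF l' t]) simp
      have "reals t 8 = reals ?s 8"
        by (rule same_outside_array[OF t]) (auto simp: eval_prog_def)
      let ?t = "set_real 5 6 0 (set_real 5 4 (reals t 5 5) t)"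
      have l2: "loaded ?t" using lt by (simp add: loaded_def)
      have "does (N * 6 + 5) ?copy ?t best_ok"
      proof (rule does_mono[OF does_MapLoop[where E = "reals ?s 8" and L = N]])
        fix r assume r: "same_outside ?copy ?t r"
        have lr: "loaded r" by (rule loaded_mono[OF l2 r]) simp
        then show "ival num_vars r = N" by (simp add: loaded_def)
        have "reals r 8 = reals ?t 8" by (rule same_outside_array[OF r]) auto
        then show "rval (RRead 8 (counter 3)) r = reals ?s 8 v" if "ints r 0 3 = v" for v
          using that \<open>reals t 8 = reals ?s 8\<close> by simp
      next
        fix r assume copy: "\<forall>v. reals r 9 v = (if v < N then reals ?s 8 v else reals ?t 9 v)"
          and r: "same_outside ?copy ?t r"
        have 5: "reals r 5 = reals ?t 5" by (rule same_outside_array[OF r]) auto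
        have "gain (reals r 9) = gain (reals ?s 8)" by (rule gain_cong) (use copy in auto)
        then show "best_ok r"
          using 5 val zero copy x by (simp add: best_ok_def gain_def)
      qed auto
      then show "does (((N * 6 + 5) + 2) + 2) (Seq (RAssign 5 (IConst 4) (RRead 5 (IConst 5)))
          (Seq (RAssign 5 (IConst 6) (rnat 0)) ?copy)) t best_ok"
        by (intro does_RAssign_Seq) simp
    qed
    then show "does ((13 * K + 1 + (((N * 6 + 5) + 2) + 2)) + 2) (Seq (RAssign 8 (IConst 0) (rnat 1)) (Seq (eval_prog k)
      (Seq (RAssign 5 (IConst 4) (RRead 5 (IConst 5))) (Seq (RAssign 5 (IConst 6) (rnat 0)) ?copy)))) s best_ok"
      by (intro does_RAssign_Seq) simp
  qed simp
  then show ?thesis by (rule does_mono) (use copy_time K_ge(2) in auto)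
qed

definition search_time :: nat where
  "search_time = 200 + k * ((\<Sum>\<kappa>\<le>k. phase_time \<kappa>) + 1)"

lemma does_search:
  assumes s0: "loaded s0"
  shows "does (search_time * K) (search_prog k) s0 (\<lambda>s. (\<forall>v<N. \<bar>sqrt 3 * reals s 9 v\<bar> \<le> 1) \<and>
    opt_const k * (\<Sum>P\<in>local_paulis k n - {replicate n PI}.
      \<bar>\<alpha> P\<bar> powr (2 * real k / (real k + 1))) powr ((real k + 1) / (2 * real k)) \<le>
    \<bar>bloch_poly k n \<alpha> (reals s 9) - \<alpha> (replicate n PI)\<bar>)" (is "does _ _ _ ?Q")
proof -
  let ?ps = "map (phase_prog k) [1..<Suc k]"
  define p where "p = (\<Sum>\<kappa>\<le>k. phase_time \<kappa>)"
  define I where "I m s \<longleftrightarrow> best_ok s \<and> (\<forall>\<kappa>\<in>{1..m}. explored \<kappa> s)" for m s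
  have bound: "\<bar>sqrt 3 * reals s 9 v\<bar> \<le> 1 \<and> opt_const k * (\<Sum>P\<in>local_paulis k n - {replicate n PI}.
      \<bar>\<alpha> P\<bar> powr (2 * real k / (real k + 1))) powr ((real k + 1) / (2 * real k)) \<le>
    \<bar>bloch_poly k n \<alpha> (reals s 9) - \<alpha> (replicate n PI)\<bar>" if I: "I k s" and v: "1 \<le> v" "v < N" for s v
  proof
    show "\<bar>sqrt 3 * reals s 9 v\<bar> \<le> 1" using I v by (simp add: I_def best_ok_def)
    have "\<forall>\<kappa>\<in>{1..k}. \<exists>Y. good_dirs \<kappa> Y \<and> (\<forall>\<epsilon>\<in>signs \<kappa>. \<forall>l\<le>k - \<kappa>. gain (candidate k \<kappa> \<epsilon> l Y) \<le> reals s 5 6)"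
      using I by (simp add: I_def explored_def)
    then obtain Y where Y: "\<And>\<kappa>. \<kappa> \<in> {1..k} \<Longrightarrow> good_dirs \<kappa> (Y \<kappa>)"
        "\<And>\<kappa> \<epsilon> l. \<kappa> \<in> {1..k} \<Longrightarrow> \<epsilon> \<in> signs \<kappa> \<Longrightarrow> l \<le> k - \<kappa> \<Longrightarrow> gain (candidate k \<kappa> \<epsilon> l (Y \<kappa>)) \<le> reals s 5 6"
      by metis
    have "reals s 5 6 = gain (reals s 9)" using I by (simp add: I_def best_ok_def)
    then show "opt_const k * (\<Sum>P\<in>local_paulis k n - {replicate n PI}.
        \<bar>\<alpha> P\<bar> powr (2 * real k / (real k + 1))) powr ((real k + 1) / (2 * real k)) \<le>
      \<bar>bloch_poly k n \<alpha> (reals s 9) - \<alpha> (replicate n PI)\<bar>"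
      using Y by (intro best_candidate_bound[OF k, where Y = Y])
        (simp_all add: good_dirs_def gain_def identity_coeff_def abs_le_square_iff)
  qed
  have phases: "does (length ?ps * (p * K + 1)) (Seqs ?ps) s1 (I (length ?ps))"
    if s1: "loaded s1" "best_ok s1" for s1
  proof (rule does_Seqs[where I = I])
    show "I 0 s1" using s1 by (simp add: I_def)
    fix m s assume m: "m < length ?ps" and I: "I m s" and s: "same_outside (Seqs ?ps) s1 s"
    have ls: "loaded s" by (rule loaded_mono[OF s1(1) s]) simp
    have \<kappa>: "1 \<le> Suc m" "Suc m \<le> k" using m by (simp_all del: upt_Suc)
    have "does (p * K) (phase_prog k (Suc m)) s (I (Suc m))"
    proof (rule does_mono[OF does_phase[OF ls _ \<kappa>]])
      show "best_ok s" using I by (simp add: I_def)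
      have "phase_time (Suc m) \<le> p" unfolding p_def using \<kappa> by (intro member_le_sum) auto
      then show "phase_time (Suc m) * K \<le> p * K" by simp
      fix t assume t: "best_ok t \<and> reals s 5 6 \<le> reals t 5 6 \<and> explored (Suc m) t"
      have "explored \<kappa> t" if "explored \<kappa> s" for \<kappa>
        using that t unfolding explored_def by (meson order_trans)
      then show "I (Suc m) t" using I t by (auto simp: I_def le_Suc_eq)
    qed
    then show "does (p * K) (?ps ! m) s (I (Suc m))" using m by (simp del: upt_Suc)
  qed
  have "does (100 * K + 1 + (k * (p * K + 1) + 1 + 1)) (search_prog k) s0 ?Q"
    unfolding search_prog_def
  proof (rule does_Seq[OF does_init[OF s0]])
    fix s1 assume best: "best_ok s1" and same1: "same_outside (init_prog k) s0 s1"
    have l1: "loaded s1" by (rule loaded_mono[OF s0 same1]) simp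
    have len: "length ?ps = k" by simp
    show "does (k * (p * K + 1) + 1 + 1) (Seq (Seqs ?ps) (RAssign 9 (IConst 0) (rnat 0))) s1 ?Q"
    proof (rule does_Seq[OF phases[OF l1 best, unfolded len]])
      fix s assume I: "I k s"
      \<comment> \<open>Variable 0 belongs to no monomial, so resetting its cell keeps the value of
        the polynomial.\<close>
      have "bloch_poly k n \<alpha> ((reals s 9)(0 := 0)) = bloch_poly k n \<alpha> (reals s 9)"
        by (rule bloch_poly_cong) simp
      then show "does 1 (RAssign 9 (IConst 0) (rnat 0)) s ?Q"
        using bound[OF I, of 1] bound[OF I] n by (intro does_RAssign) (auto simp: Suc_le_eq)
    qed
  qed
  then show ?thesis
  proof (rule does_mono)
    have "k \<le> k * K" using K_ge(2) by simp
    moreover have "100 * K + 1 + (k * (p * K + 1) + 1 + 1) = 100 * K + k * p * K + k + 3"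
      "search_time * K = 200 * K + k * p * K + k * K"
      by (simp_all add: search_time_def p_def[symmetric] algebra_simps)
    ultimately show "100 * K + 1 + (k * (p * K + 1) + 1 + 1) \<le> search_time * K"
      using K_ge(2) by linarith
  qed
qed

end

section \<open>Independent rounding of the means to pure product states\<close>

section \<open>Random rounding to a product state\<close>

text \<open>With this bias the spin of cell \<open>v\<close> has mean \<open>sqrt 3 * x v\<close>,
  so the Bloch coordinate, the spin divided by \<open>sqrt 3\<close>, has mean
  \<open>x v\<close>.\<close>

definition bias_exp :: rexp where
  "bias_exp = RDiv (RAdd (rnat 1) (RMul (RRoot 2 (rnat 3)) (RRead 9 (counter 2)))) (rnat 2)"

definition flip_prog :: com where
  "flip_prog = For 2 num_vars (Flip 1 (counter 2) bias_exp)"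

definition bloch_exp :: "nat \<Rightarrow> rexp" where
  "bloch_exp c = RDiv (RSub (RMul (rnat 2) (OfNat (IRead 1 (IAdd (IMul (IConst 4) (counter 3)) (IConst c))))) (rnat 1))
     (RRoot 2 (rnat 3))"

definition output_prog :: com where
  "output_prog = Seq (MapLoop 3 (counter 0) 1 (RRoot 2 (RDiv (RAdd (rnat 1) (bloch_exp 3)) (rnat 2))))
     (Seq (MapLoop 3 (counter 0) 2 (rnat 0))
     (Seq (MapLoop 3 (counter 0) 3 (RDiv (bloch_exp 1) (RMul (rnat 2) (RRead 1 (counter 3)))))
       (MapLoop 3 (counter 0) 4 (RDiv (bloch_exp 2) (RMul (rnat 2) (RRead 1 (counter 3)))))))"

lemma expectation_bind_finite:
  fixes h :: "'b \<Rightarrow> real"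
  assumes "finite (set_pmf p)" "\<And>x. x \<in> set_pmf p \<Longrightarrow> finite (set_pmf (f x))"
  shows "measure_pmf.expectation (bind_pmf p f) h = measure_pmf.expectation p (\<lambda>x. measure_pmf.expectation (f x) h)"
proof -
  \<comment> \<open>Outside the support of \<open>p\<close> nothing is known about \<open>f\<close>;
    a point mass there makes all supports finite.\<close>
  define f' where "f' x = (if x \<in> set_pmf p then f x else return_pmf undefined)" for x
  have "bind_pmf p f = bind_pmf p f'" by (rule bind_pmf_cong) (auto simp: f'_def)
  then have "measure_pmf.expectation (bind_pmf p f) h =
      (\<Sum>x\<in>set_pmf p. pmf p x *\<^sub>R measure_pmf.expectation (f' x) h)"
    using assms by (simp add: pmf_expectation_bind[of "set_pmf p"] f'_def)
  also have "\<dots> = (\<Sum>x\<in>set_pmf p. pmf p x *\<^sub>R measure_pmf.expectation (f x) h)"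
    by (rule sum.cong) (auto simp: f'_def)
  also have "\<dots> = measure_pmf.expectation p (\<lambda>x. measure_pmf.expectation (f x) h)"
    using assms(1) by (subst integral_measure_pmf[of "set_pmf p"]) auto
  finally show ?thesis .
qed

definition spin :: "store \<Rightarrow> nat \<Rightarrow> real" where
  "spin s v = 2 * real (ints s 1 v) - 1"

definition flip_inv :: "nat \<Rightarrow> (nat \<Rightarrow> real) \<Rightarrow> nat \<Rightarrow> store \<Rightarrow> bool" where
  "flip_inv n x i s \<longleftrightarrow> ints s 0 0 = n \<and> ints s 0 2 = i \<and> reals s 9 = x \<and> (\<forall>v<i. ints s 1 v \<in> {0, 1})"

text \<open>Independence is established in the form of multiplicative expectations. For the
  induction over the remaining rounds, cells below \<open>i\<close> keep their known spin and all
  others contribute their mean.\<close>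

lemma outcome_flips:
  assumes x: "\<And>v. v < 4 * n \<Longrightarrow> \<bar>sqrt 3 * x v\<bar> \<le> 1"
    and "flip_inv n x i s" "i \<le> 4 * n"
  shows "\<exists>p. outcome ((4 * n - i) * 6 + 2) (While (ILess (counter 2) num_vars)
      (Seq (Flip 1 (counter 2) bias_exp) (IAssign 0 (IConst 2) (IAdd (counter 2) (IConst 1))))) s p \<and>
    finite (set_pmf p) \<and> (\<forall>s'\<in>set_pmf p. flip_inv n x (4 * n) s') \<and>
    (\<forall>W. W \<subseteq> {..<4 * n} \<longrightarrow> measure_pmf.expectation p (\<lambda>s. \<Prod>v\<in>W. spin s v) =
      (\<Prod>v\<in>W. if v < i then spin s v else sqrt 3 * x v))"
  using assms(2,3)
proof (induction "4 * n - i" arbitrary: i s)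
  case 0
  let ?B = "Seq (Flip 1 (counter 2) bias_exp) (IAssign 0 (IConst 2) (IAdd (counter 2) (IConst 1)))"
  let ?W = "While (ILess (counter 2) num_vars) ?B"
  have i: "i = 4 * n" using 0 by simp
  have "outcome 2 ?W s (return_pmf s)"
    using 0 i by (intro outcome_While_end) (simp add: flip_inv_def)
  moreover have "(\<Prod>v\<in>W. spin s v) = (\<Prod>v\<in>W. if v < i then spin s v else sqrt 3 * x v)"
    if "W \<subseteq> {..<4 * n}" for W
    using that i by (intro prod.cong) auto
  moreover have "flip_inv n x (4 * n) s" using 0 i by simp
  ultimately show ?case
    unfolding i by (intro exI[of _ "return_pmf s"] conjI) (simp_all del: One_nat_def add_2_eq_Suc')
next
  case (Suc m)
  let ?B = "Seq (Flip 1 (counter 2) bias_exp) (IAssign 0 (IConst 2) (IAdd (counter 2) (IConst 1)))"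
  let ?W = "While (ILess (counter 2) num_vars) ?B"
  have i: "i < 4 * n" using Suc.hyps(2) by simp
  define \<beta> where "\<beta> = (1 + sqrt 3 * x i) / 2"
  have \<beta>: "0 \<le> \<beta>" "\<beta> \<le> 1" using x[OF i] by (auto simp: \<beta>_def)
  define f where "f b = set_int 0 2 (Suc i) (set_int 1 i (if b then 1 else 0) s)" for b
  have inv: "flip_inv n x (Suc i) (f b)" for b
    using Suc.prems(1) by (auto simp: flip_inv_def f_def less_Suc_eq)
  have "\<forall>b. \<exists>p. outcome ((4 * n - Suc i) * 6 + 2) ?W (f b) p \<and> finite (set_pmf p) \<and>
      (\<forall>s'\<in>set_pmf p. flip_inv n x (4 * n) s') \<and>
      (\<forall>W. W \<subseteq> {..<4 * n} \<longrightarrow> measure_pmf.expectation p (\<lambda>s. \<Prod>v\<in>W. spin s v) =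
        (\<Prod>v\<in>W. if v < Suc i then spin (f b) v else sqrt 3 * x v))"
    by (rule allI, rule Suc.hyps(1)[OF _ inv]) (use Suc.hyps(2) i in simp_all)
  from choice[OF this] obtain q where "\<forall>b. outcome ((4 * n - Suc i) * 6 + 2) ?W (f b) (q b) \<and>
      finite (set_pmf (q b)) \<and> (\<forall>s'\<in>set_pmf (q b). flip_inv n x (4 * n) s') \<and>
      (\<forall>W. W \<subseteq> {..<4 * n} \<longrightarrow> measure_pmf.expectation (q b) (\<lambda>s. \<Prod>v\<in>W. spin s v) =
        (\<Prod>v\<in>W. if v < Suc i then spin (f b) v else sqrt 3 * x v))"
    by (rule exE)
  note all = spec[OF this]
  have q: "outcome ((4 * n - Suc i) * 6 + 2) ?W (f b) (q b)"
      "finite (set_pmf (q b))" "s' \<in> set_pmf (q b) \<Longrightarrow> flip_inv n x (4 * n) s'"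
      "W \<subseteq> {..<4 * n} \<Longrightarrow> measure_pmf.expectation (q b) (\<lambda>s. \<Prod>v\<in>W. spin s v) =
        (\<Prod>v\<in>W. if v < Suc i then spin (f b) v else sqrt 3 * x v)" for b s' W
    using all[of b] by blast+
  define p where "p = bind_pmf (bernoulli_pmf \<beta>) q"
  have bias: "rval bias_exp s = \<beta>"
    using Suc.prems(1) by (simp add: bias_exp_def \<beta>_def flip_inv_def sqrt_def)
  have i2: "ints s 0 2 = i" using Suc.prems(1) by (simp add: flip_inv_def)
  have flip: "outcome 1 (Flip 1 (counter 2) bias_exp) s
      (map_pmf (\<lambda>b. set_int 1 i (if b then 1 else 0) s) (bernoulli_pmf \<beta>))"
    by (simp add: outcome_def bind_return_pmf bias i2 map_pmf_comp)
  have inc: "outcome 1 (IAssign 0 (IConst 2) (IAdd (counter 2) (IConst 1))) s'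
      (return_pmf (set_int 0 2 (Suc i) s'))" if "ints s' 0 2 = i" for s'
    using that by (simp add: outcome_def bind_return_pmf)
  have "outcome (1 + 1 + 1) ?B s
      (bind_pmf (map_pmf (\<lambda>b. set_int 1 i (if b then 1 else 0) s) (bernoulli_pmf \<beta>))
        (\<lambda>s'. return_pmf (set_int 0 2 (Suc i) s')))"
    by (rule outcome_Seq[OF flip], rule inc) (use i2 in auto)
  also have "bind_pmf (map_pmf (\<lambda>b. set_int 1 i (if b then 1 else 0) s) (bernoulli_pmf \<beta>))
        (\<lambda>s'. return_pmf (set_int 0 2 (Suc i) s')) = map_pmf f (bernoulli_pmf \<beta>)"
    by (simp add: map_pmf_def f_def bind_assoc_pmf bind_return_pmf)
  finally have body: "outcome 3 ?B s
      (map_pmf f (bernoulli_pmf \<beta>))" by (rule outcome_mono) simp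
  \<comment> \<open>The continuation must be a function of the store; the bit just written
    identifies the branch.\<close>
  have f_bit: "(ints (f b) 1 i = 1) = b" for b by (simp add: f_def)
  have "outcome (3 + 1 + ((4 * n - Suc i) * 6 + 2)) (Seq ?B ?W) s
      (bind_pmf (map_pmf f (bernoulli_pmf \<beta>)) (\<lambda>s'. q (ints s' 1 i = 1)))"
  proof (rule outcome_Seq[OF body])
    fix s' assume "s' \<in> set_pmf (map_pmf f (bernoulli_pmf \<beta>))"
    then obtain b where b: "s' = f b" by auto
    show "outcome ((4 * n - Suc i) * 6 + 2) ?W s' (q (ints s' 1 i = 1))"
      unfolding b f_bit by (rule q(1))
  qed
  also have "bind_pmf (map_pmf f (bernoulli_pmf \<beta>)) (\<lambda>s'. q (ints s' 1 i = 1)) = p"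
    by (simp add: p_def bind_map_pmf f_bit del: One_nat_def)
  finally have "outcome (3 + 1 + ((4 * n - Suc i) * 6 + 2) + 2) ?W s p"
    using Suc.prems(1) i by (intro outcome_While_step) (auto simp: flip_inv_def)
  moreover have "3 + 1 + ((4 * n - Suc i) * 6 + 2) + 2 = (4 * n - i) * 6 + 2"
    using i by (simp add: Suc_diff_Suc[OF i, symmetric])
  ultimately have out: "outcome ((4 * n - i) * 6 + 2) ?W s p" by (simp only:)
  have fin: "finite (set_pmf p)"
    using q(2) by (simp add: p_def finite_subset[OF subset_UNIV])
  have "measure_pmf.expectation p (\<lambda>s. \<Prod>v\<in>W. spin s v) =
      (\<Prod>v\<in>W. if v < i then spin s v else sqrt 3 * x v)" if W: "W \<subseteq> {..<4 * n}" for W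
  proof -
    have finW: "finite W" using W finite_subset by blast
    \<comment> \<open>Both branches share the product over the other cells, so only the factor at
      \<open>i\<close> is averaged.\<close>
    define R where "R = (\<Prod>v\<in>W - {i}. if v < i then spin s v else sqrt 3 * x v)"
    have rest: "(\<Prod>v\<in>W - {i}. if v < Suc i then spin (f b) v else sqrt 3 * x v) = R" for b
      unfolding R_def by (intro prod.cong refl) (auto simp: spin_def f_def)
    have b: "(\<Prod>v\<in>W. if v < Suc i then spin (f b) v else sqrt 3 * x v) = (if i \<in> W then (if b then 1 else - 1) else 1) * R" for b
    proof (cases "i \<in> W")
      case True
      then show ?thesis
        using finW by (subst prod.remove[of W i]) (auto simp: rest spin_def f_def)
    next
      case False
      then show ?thesis using rest[of b] by simp
    qed
    have "measure_pmf.expectation p (\<lambda>s. \<Prod>v\<in>W. spin s v) =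
        measure_pmf.expectation (bernoulli_pmf \<beta>) (\<lambda>b. measure_pmf.expectation (q b) (\<lambda>s. \<Prod>v\<in>W. spin s v))"
      unfolding p_def by (rule expectation_bind_finite) (auto simp: q(2) finite_subset[OF subset_UNIV])
    also have "\<dots> = measure_pmf.expectation (bernoulli_pmf \<beta>) (\<lambda>b. (if i \<in> W then (if b then 1 else - 1) else 1) * R)"
      by (simp add: q(4)[OF W] b)
    also have "\<dots> = (if i \<in> W then sqrt 3 * x i else 1) * R"
      using \<beta> by (simp add: integral_bernoulli_pmf \<beta>_def field_simps)
    also have "\<dots> = (\<Prod>v\<in>W. if v < i then spin s v else sqrt 3 * x v)"
    proof (cases "i \<in> W")
      case True
      then show ?thesis using finW by (subst prod.remove[of W i]) (auto simp: R_def)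
    next
      case False
      then show ?thesis by (simp add: R_def)
    qed
    finally show ?thesis .
  qed
  moreover have "\<forall>s'\<in>set_pmf p. flip_inv n x (4 * n) s'" using q(3) by (auto simp: p_def)
  ultimately show ?case by (intro exI[of _ p] conjI out fin allI impI)
qed

lemma outcome_flip_prog:
  assumes "\<And>v. v < 4 * n \<Longrightarrow> \<bar>sqrt 3 * x v\<bar> \<le> 1" "ints s 0 0 = n" "reals s 9 = x"
  shows "\<exists>p. outcome (24 * n + 4) flip_prog s p \<and> finite (set_pmf p) \<and>
    (\<forall>s'\<in>set_pmf p. ints s' 0 0 = n \<and> (\<forall>v<4 * n. ints s' 1 v \<in> {0, 1})) \<and>
    (\<forall>W. W \<subseteq> {..<4 * n} \<longrightarrow> measure_pmf.expectation p (\<lambda>s. \<Prod>v\<in>W. spin s v) = (\<Prod>v\<in>W. sqrt 3 * x v))"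
proof -
  let ?s = "set_int 0 2 0 s"
  have inv: "flip_inv n x 0 ?s" using assms(2,3) by (simp add: flip_inv_def)
  obtain p where p: "outcome ((4 * n - 0) * 6 + 2) (While (ILess (counter 2) num_vars)
      (Seq (Flip 1 (counter 2) bias_exp) (IAssign 0 (IConst 2) (IAdd (counter 2) (IConst 1))))) ?s p"
    "finite (set_pmf p)" "\<forall>s'\<in>set_pmf p. flip_inv n x (4 * n) s'"
    "\<forall>W. W \<subseteq> {..<4 * n} \<longrightarrow> measure_pmf.expectation p (\<lambda>s. \<Prod>v\<in>W. spin s v) =
      (\<Prod>v\<in>W. if v < 0 then spin ?s v else sqrt 3 * x v)"
    using outcome_flips[OF assms(1) inv] by auto
  have "outcome (1 + 1 + ((4 * n - 0) * 6 + 2)) flip_prog s (bind_pmf (return_pmf ?s) (\<lambda>_. p))"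
    unfolding flip_prog_def For_def
    using exec_IAssign[of 0 "IConst 2" "IConst 0" s] p(1) by (intro outcome_Seq) (auto simp: exec_def)
  then have "outcome (24 * n + 4) flip_prog s p"
    by (simp add: bind_return_pmf) (erule outcome_mono, simp)
  then show ?thesis
    using p(2-4) by (intro exI[of _ p]) (auto simp: flip_inv_def)
qed

text \<open>Each of the three coordinates is plus or minus \<open>1 / sqrt 3\<close>, so every
  outcome is a unit Bloch vector, that is, a pure state. Its last coordinate stays away from -1,
  where the amplitude formula breaks down.\<close>

lemma does_output:
  assumes s0: "ints s0 0 0 = n" and bits: "\<And>v. v < 4 * n \<Longrightarrow> ints s0 1 v \<in> {0, 1}"
  shows "does (24 * n + 23) output_prog s0 (\<lambda>s. \<forall>i<n.
    output_qubit s i \<in> carrier_vec 2 \<and> output_qubit s i \<bullet>c output_qubit s i = 1 \<and>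
    (\<forall>p. (pauli_mat p *\<^sub>v output_qubit s i) \<bullet>c output_qubit s i =
      complex_of_real (if p = PI then 1 else spin s0 (4 * i + pauli_code p) / sqrt 3)))"
proof -
  define b where "b c i = spin s0 (4 * i + c) / sqrt 3" for c i
  define u where "u i = sqrt ((1 + b 3 i) / 2)" for i
  have map: "does (n * 6 + 5) (MapLoop 3 (counter 0) a e) s (\<lambda>s'. ints s' 0 0 = n \<and> ints s' 1 = ints s0 1 \<and>
      (\<forall>i<n. reals s' a i = E i) \<and> (\<forall>a'. a' \<noteq> a \<longrightarrow> reals s' a' = reals s a'))"
    if s: "ints s 0 0 = n" "ints s 1 = ints s0 1"
      and E: "\<And>s' i. ints s' 1 = ints s0 1 \<Longrightarrow> ints s' 0 3 = i \<Longrightarrow> i < n \<Longrightarrow>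
        (\<And>a'. a' \<noteq> a \<Longrightarrow> reals s' a' = reals s a') \<Longrightarrow> rval e s' = E i" for s a e E
  proof (rule does_mono[OF does_MapLoop[where L = n and E = E]])
    fix s' assume s': "same_outside (MapLoop 3 (counter 0) a e) s s'"
    have 0: "ints s' 0 0 = n" using same_outside_int[OF s', of 0 0] s by simp
    then show "ival (counter 0) s' = n" by simp
    have 1: "ints s' 1 = ints s0 1" using same_outside_int[OF s', of 1] s by auto
    have 2: "reals s' a' = reals s a'" if "a' \<noteq> a" for a'
      by (rule same_outside_array[OF s']) (use that in auto)
    show "rval e s' = E i" if "ints s' 0 3 = i" "i < n" for i
      by (rule E[OF 1 that 2])
    assume "\<forall>i. reals s' a i = (if i < n then E i else reals s a i)"
    then show "ints s' 0 0 = n \<and> ints s' 1 = ints s0 1 \<and>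
      (\<forall>i<n. reals s' a i = E i) \<and> (\<forall>a'. a' \<noteq> a \<longrightarrow> reals s' a' = reals s a')"
      using 0 1 2 by simp
  qed auto
  have bloch: "rval (bloch_exp c) s = b c i" if "ints s 1 = ints s0 1" "ints s 0 3 = i" for s c i
    using that by (simp add: bloch_exp_def b_def spin_def sqrt_def)
  let ?c2 = "MapLoop 3 (counter 0) 2 (rnat 0)"
  let ?c3 = "MapLoop 3 (counter 0) 3 (RDiv (bloch_exp 1) (RMul (rnat 2) (RRead 1 (counter 3))))"
  let ?c4 = "MapLoop 3 (counter 0) 4 (RDiv (bloch_exp 2) (RMul (rnat 2) (RRead 1 (counter 3))))"
  let ?Q = "\<lambda>s. \<forall>i<n.
     reals s 1 i = u i \<and> reals s 2 i = 0 \<and> reals s 3 i = b 1 i / (2 * u i) \<and> reals s 4 i = b 2 i / (2 * u i)"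
  have "does ((n * 6 + 5) + 1 + ((n * 6 + 5) + 1 + ((n * 6 + 5) + 1 + (n * 6 + 5)))) output_prog s0
    ?Q"
    unfolding output_prog_def
  proof (rule does_Seq[OF map[OF s0 refl, where E = u]])
    show "rval (RRoot 2 (RDiv (RAdd (rnat 1) (bloch_exp 3)) (rnat 2))) s' = u i"
      if "ints s' 1 = ints s0 1" "ints s' 0 3 = i" for s' i
      using bloch[OF that] by (simp add: u_def sqrt_def)
    fix s1 :: store assume s1: "ints s1 0 0 = n \<and> ints s1 1 = ints s0 1 \<and> (\<forall>i<n. reals s1 1 i = u i) \<and>
      (\<forall>a'. a' \<noteq> 1 \<longrightarrow> reals s1 a' = reals s0 a')"
    show "does ((n * 6 + 5) + 1 + ((n * 6 + 5) + 1 + (n * 6 + 5))) (Seq ?c2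
      (Seq ?c3
        ?c4)) s1
      ?Q"
    proof (rule does_Seq[OF map[where E = "\<lambda>_. 0"]])
      show "ints s1 0 0 = n" "ints s1 1 = ints s0 1" using s1 by auto
      fix s2 :: store assume s2: "ints s2 0 0 = n \<and> ints s2 1 = ints s0 1 \<and> (\<forall>i<n. reals s2 2 i = 0) \<and>
        (\<forall>a'. a' \<noteq> 2 \<longrightarrow> reals s2 a' = reals s1 a')"
      show "does ((n * 6 + 5) + 1 + (n * 6 + 5))
        (Seq ?c3
          ?c4) s2
        ?Q"
      proof (rule does_Seq[OF map[where E = "\<lambda>i. b 1 i / (2 * u i)"]])
        show "ints s2 0 0 = n" "ints s2 1 = ints s0 1" using s2 by auto
        show "rval (RDiv (bloch_exp 1) (RMul (rnat 2) (RRead 1 (counter 3)))) s' = b 1 i / (2 * u i)"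
          if "ints s' 1 = ints s0 1" "ints s' 0 3 = i" "i < n" "\<And>a'. a' \<noteq> 3 \<Longrightarrow> reals s' a' = reals s2 a'" for s' i
          using bloch[OF that(1,2)] that s1 s2 by simp
        fix s3 :: store assume s3: "ints s3 0 0 = n \<and> ints s3 1 = ints s0 1 \<and> (\<forall>i<n. reals s3 3 i = b 1 i / (2 * u i)) \<and>
          (\<forall>a'. a' \<noteq> 3 \<longrightarrow> reals s3 a' = reals s2 a')"
        show "does (n * 6 + 5) ?c4 s3
          ?Q"
        proof (rule does_mono[OF map[where E = "\<lambda>i. b 2 i / (2 * u i)"]])
          show "ints s3 0 0 = n" "ints s3 1 = ints s0 1" using s3 by auto
          show "rval (RDiv (bloch_exp 2) (RMul (rnat 2) (RRead 1 (counter 3)))) s' = b 2 i / (2 * u i)"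
            if "ints s' 1 = ints s0 1" "ints s' 0 3 = i" "i < n" "\<And>a'. a' \<noteq> 4 \<Longrightarrow> reals s' a' = reals s3 a'" for s' i
            using bloch[OF that(1,2)] that s1 s2 s3 by simp
        qed (use s1 s2 s3 in auto)
      qed
    qed simp
  qed
  then show ?thesis
  proof (rule does_mono)
    fix s :: store assume s: "\<forall>i<n. reals s 1 i = u i \<and> reals s 2 i = 0 \<and> reals s 3 i = b 1 i / (2 * u i) \<and> reals s 4 i = b 2 i / (2 * u i)"
    show "\<forall>i<n. output_qubit s i \<in> carrier_vec 2 \<and> output_qubit s i \<bullet>c output_qubit s i = 1 \<and>
      (\<forall>p. (pauli_mat p *\<^sub>v output_qubit s i) \<bullet>c output_qubit s i =
        complex_of_real (if p = PI then 1 else spin s0 (4 * i + pauli_code p) / sqrt 3))"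
    proof (intro allI impI)
      fix i assume i: "i < n"
      have sq: "(b c i)\<^sup>2 = 1 / 3" if "c < 4" for c
        using bits[of "4 * i + c"] i that by (auto simp: b_def spin_def power_divide)
      have unit: "(b 1 i)\<^sup>2 + (b 2 i)\<^sup>2 + (b 3 i)\<^sup>2 = 1" by (simp add: sq)
      have "\<bar>b 3 i\<bar> < 1" using sq[of 3] abs_square_less_1[of "b 3 i"] by simp
      then have gt: "- 1 < b 3 i" by simp
      have q: "output_qubit s i = vec_of_list [Complex (u i) 0, Complex (b 1 i / (2 * u i)) (b 2 i / (2 * u i))]"
        using s i by (simp add: output_qubit_def)
      have carrier: "output_qubit s i \<in> carrier_vec 2"
        unfolding q by (rule carrier_vecI) simp
      have exp: "(pauli_mat p *\<^sub>v output_qubit s i) \<bullet>c output_qubit s i =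
          complex_of_real (case p of PI \<Rightarrow> 1 | PX \<Rightarrow> b 1 i | PY \<Rightarrow> b 2 i | PZ \<Rightarrow> b 3 i)" for p
        unfolding q u_def by (rule pauli_mat_expectation[OF unit gt])
      have "pauli_mat PI = 1\<^sub>m 2"
        by (rule eq_matI) (auto simp: mat_of_rows_list_def less_Suc_eq numeral_2_eq_2)
      then have "output_qubit s i \<bullet>c output_qubit s i = 1"
        using exp[of PI] carrier by (simp del: pauli_mat.simps)
      moreover have "complex_of_real (case p of PI \<Rightarrow> 1 | PX \<Rightarrow> b 1 i | PY \<Rightarrow> b 2 i | PZ \<Rightarrow> b 3 i) =
          complex_of_real (if p = PI then 1 else spin s0 (4 * i + pauli_code p) / sqrt 3)" for p
        by (cases p) (auto simp: b_def)
      ultimately show "output_qubit s i \<in> carrier_vec 2 \<and> output_qubit s i \<bullet>c output_qubit s i = 1 \<and>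
        (\<forall>p. (pauli_mat p *\<^sub>v output_qubit s i) \<bullet>c output_qubit s i =
          complex_of_real (if p = PI then 1 else spin s0 (4 * i + pauli_code p) / sqrt 3))"
        using exp carrier by simp
    qed
  qed simp
qed

section \<open>Search, rounding and output combined\<close>

definition main_prog :: "nat \<Rightarrow> com" where
  "main_prog k = Seq (search_prog k) (Seq flip_prog output_prog)"

context problem
begin

lemma loaded_input: "loaded (input_store n Ps \<alpha>)"
proof -
  have "4 * position_entry r P + letter_entry r P = entry P r" for r P
    by (simp add: position_entry_def letter_entry_def entry_def pauli_vars_def pauli_weight_def)
  then show ?thesis
    by (auto simp: loaded_def input_store_def list_array_def)
qed

definition main_time :: nat where
  "main_time = search_time + 100"

text \<open>Rounding replaces the point found by the search by random spins. The polynomial is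
  multilinear and the spins are independent, so its expected value is the value at that
  point.\<close>

lemma main_correct:
  "\<exists>p. outcome (main_time * K) (main_prog k) (input_store n Ps \<alpha>) p \<and>
    (\<forall>s\<in>set_pmf p. \<forall>i<n. output_qubit s i \<bullet>c output_qubit s i = 1) \<and>
    opt_const k * (\<Sum>P\<in>local_paulis k n - {replicate n PI}.
      \<bar>\<alpha> P\<bar> powr (2 * real k / (real k + 1))) powr ((real k + 1) / (2 * real k)) \<le>
    \<bar>measure_pmf.expectation p (\<lambda>s. energy (hamiltonian k n \<alpha>) (output_state n s)) - \<alpha> (replicate n PI)\<bar>"
proof -
  let ?s0 = "input_store n Ps \<alpha>"
  obtain s1 where s1: "exec (search_time * K) (search_prog k) ?s0 s1" "\<forall>v<N. \<bar>sqrt 3 * reals s1 9 v\<bar> \<le> 1"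
    and bound: "opt_const k * (\<Sum>P\<in>local_paulis k n - {replicate n PI}.
        \<bar>\<alpha> P\<bar> powr (2 * real k / (real k + 1))) powr ((real k + 1) / (2 * real k)) \<le>
      \<bar>bloch_poly k n \<alpha> (reals s1 9) - \<alpha> (replicate n PI)\<bar>"
    using does_search[OF loaded_input] unfolding does_def by blast
  have "loaded s1" by (rule loaded_mono[OF loaded_input exec_writes[OF s1(1)]]) simp
  then have n1: "ints s1 0 0 = n" by (simp add: loaded_def)
  define x where "x = reals s1 9"
  obtain p where p: "outcome (24 * n + 4) flip_prog s1 p" "finite (set_pmf p)"
    "\<forall>s'\<in>set_pmf p. ints s' 0 0 = n \<and> (\<forall>v<N. ints s' 1 v \<in> {0, 1})"
    "\<forall>W. W \<subseteq> {..<N} \<longrightarrow> measure_pmf.expectation p (\<lambda>s. \<Prod>v\<in>W. spin s v) = (\<Prod>v\<in>W. sqrt 3 * x v)"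
    using outcome_flip_prog[of n x s1] s1(2) n1 unfolding x_def by blast
  have "\<forall>s\<in>set_pmf p. \<exists>s'. exec (24 * n + 23) output_prog s s' \<and> (\<forall>i<n.
    output_qubit s' i \<in> carrier_vec 2 \<and> output_qubit s' i \<bullet>c output_qubit s' i = 1 \<and>
    (\<forall>p. (pauli_mat p *\<^sub>v output_qubit s' i) \<bullet>c output_qubit s' i =
      complex_of_real (if p = PI then 1 else spin s (4 * i + pauli_code p) / sqrt 3)))"
    using p(3) does_output[of _ n] unfolding does_def by blast
  from bchoice[OF this] obtain g where G: "\<forall>s\<in>set_pmf p. exec (24 * n + 23) output_prog s (g s) \<and> (\<forall>i<n.
    output_qubit (g s) i \<in> carrier_vec 2 \<and> output_qubit (g s) i \<bullet>c output_qubit (g s) i = 1 \<and>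
    (\<forall>p. (pauli_mat p *\<^sub>v output_qubit (g s) i) \<bullet>c output_qubit (g s) i =
      complex_of_real (if p = PI then 1 else spin s (4 * i + pauli_code p) / sqrt 3)))"
    by (rule exE)
  note all = bspec[OF G]
  have g: "exec (24 * n + 23) output_prog s (g s)"
    "i < n \<Longrightarrow> output_qubit (g s) i \<in> carrier_vec 2"
    "i < n \<Longrightarrow> output_qubit (g s) i \<bullet>c output_qubit (g s) i = 1"
    "i < n \<Longrightarrow> (pauli_mat q *\<^sub>v output_qubit (g s) i) \<bullet>c output_qubit (g s) i =
      complex_of_real (if q = PI then 1 else spin s (4 * i + pauli_code q) / sqrt 3)"
    if "s \<in> set_pmf p" for s i q
    using all[OF that] by blast+
  define r where "r = map_pmf g p"
  have "outcome ((24 * n + 4) + 1 + (24 * n + 23)) (Seq flip_prog output_prog) s1 r"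
    unfolding r_def map_pmf_def
    by (rule outcome_Seq[OF p(1)]) (use g(1) in \<open>simp add: exec_def\<close>)
  then have "outcome (search_time * K + 1 + ((24 * n + 4) + 1 + (24 * n + 23))) (main_prog k) ?s0
      (bind_pmf (return_pmf s1) (\<lambda>_. r))"
    unfolding main_prog_def using s1(1) by (intro outcome_Seq) (auto simp: exec_def)
  then have "outcome (main_time * K) (main_prog k) ?s0 r"
    unfolding bind_return_pmf
    by (rule outcome_mono) (use K_ge(2,3) in \<open>simp add: main_time_def algebra_simps\<close>)
  moreover have "\<forall>s\<in>set_pmf r. \<forall>i<n. output_qubit s i \<bullet>c output_qubit s i = 1"
    using g(3) by (auto simp: r_def)
  moreover have "measure_pmf.expectation r (\<lambda>s. energy (hamiltonian k n \<alpha>) (output_state n s)) = bloch_poly k n \<alpha> x"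
  proof -
    \<comment> \<open>Each variable occurs at most once in a monomial, so products of spins over
      sets of distinct cells are all that has to be averaged.\<close>
    have mean: "measure_pmf.expectation p (\<lambda>s. \<Prod>v\<in>var_set P. spin s v / sqrt 3) = (\<Prod>v\<in>var_set P. x v)"
      if P: "P \<in> local_paulis k n" for P
    proof -
      have "var_set P \<subseteq> {..<N}" using var_set_less[of _ P] P by (auto simp: local_paulis_def)
      then have "measure_pmf.expectation p (\<lambda>s. \<Prod>v\<in>var_set P. spin s v) = (\<Prod>v\<in>var_set P. sqrt 3 * x v)"
        using p(4) by blast
      then show ?thesis by (simp add: prod_dividef prod.distrib)
    qed
    have "measure_pmf.expectation r (\<lambda>s. energy (hamiltonian k n \<alpha>) (output_state n s)) =
        measure_pmf.expectation p (\<lambda>s. energy (hamiltonian k n \<alpha>) (output_state n (g s)))"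
      by (simp add: r_def)
    also have "\<dots> = measure_pmf.expectation p (\<lambda>s. bloch_poly k n \<alpha> (\<lambda>v. spin s v / sqrt 3))"
    proof (rule integral_cong_AE)
      show "AE s in measure_pmf p. energy (hamiltonian k n \<alpha>) (output_state n (g s)) =
          bloch_poly k n \<alpha> (\<lambda>v. spin s v / sqrt 3)"
        unfolding output_state_def
        by (rule AE_pmfI, rule energy_product_state) (use g(2,4) in auto)
    qed auto
    also have "\<dots> = (\<Sum>P\<in>local_paulis k n. \<alpha> P * measure_pmf.expectation p (\<lambda>s. \<Prod>v\<in>var_set P. spin s v / sqrt 3))"
      unfolding bloch_poly_def
      by (subst Bochner_Integration.integral_sum)
        (auto intro!: integrable_measure_pmf_finite p(2))
    also have "\<dots> = bloch_poly k n \<alpha> x"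
      by (simp add: bloch_poly_def mean)
    finally show ?thesis .
  qed
  ultimately show ?thesis using bound by (intro exI[of _ r]) (simp add: x_def)
qed

end

theorem corollary5:
  fixes k :: nat
  assumes "k \<ge> 1"
  shows "\<exists>(prog :: com) (T :: nat \<Rightarrow> nat).
    (\<lambda>n. real (T n)) \<in> O(\<lambda>n. real n ^ k) \<and>
    (\<forall>n \<ge> 1. \<forall>(\<alpha> :: pauli list \<Rightarrow> real) (Ps :: pauli list list).
       distinct Ps \<and> set Ps = local_paulis k n \<longrightarrow>
       halts_within (T n) prog (input_store n Ps \<alpha>) \<and>
       (\<forall>s \<in> set_pmf (final_store (T n) prog (input_store n Ps \<alpha>)).
          \<forall>i < n. output_qubit s i \<bullet>c output_qubit s i = 1) \<and>
       (\<forall>\<mu> :: complex vec measure. is_haar_measure n \<mu> \<longrightarrow>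
          \<bar>measure_pmf.expectation (final_store (T n) prog (input_store n Ps \<alpha>))
              (\<lambda>s. energy (hamiltonian k n \<alpha>) (output_state n s))
            - (\<integral>\<phi>. energy (hamiltonian k n \<alpha>) \<phi> \<partial>\<mu>)\<bar>
          \<ge> opt_const k *
             (\<Sum>P \<in> local_paulis k n - {replicate n PI}.
                \<bar>\<alpha> P\<bar> powr (2 * real k / (real k + 1))) powr ((real k + 1) / (2 * real k))))"
proof -
  \<comment> \<open>\<open>main_time\<close> is built from \<open>k\<close> alone, through the
    numbers of permutations and candidates, so it is a constant factor here.\<close>
  define T where "T n = problem.main_time k * (4 * n) ^ k" for n
  have "(\<lambda>n. real (T n)) \<in> O(\<lambda>n. real n ^ k)"
    by (rule bigoI[where c = "real (problem.main_time k) * 4 ^ k"])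
      (simp add: T_def power_mult_distrib)
  moreover have "halts_within (T n) (main_prog k) (input_store n Ps \<alpha>) \<and>
       (\<forall>s \<in> set_pmf (final_store (T n) (main_prog k) (input_store n Ps \<alpha>)).
          \<forall>i < n. output_qubit s i \<bullet>c output_qubit s i = 1) \<and>
       (\<forall>\<mu> :: complex vec measure. is_haar_measure n \<mu> \<longrightarrow>
          \<bar>measure_pmf.expectation (final_store (T n) (main_prog k) (input_store n Ps \<alpha>))
              (\<lambda>s. energy (hamiltonian k n \<alpha>) (output_state n s))
            - (\<integral>\<phi>. energy (hamiltonian k n \<alpha>) \<phi> \<partial>\<mu>)\<bar>
          \<ge> opt_const k *
             (\<Sum>P \<in> local_paulis k n - {replicate n PI}.
                \<bar>\<alpha> P\<bar> powr (2 * real k / (real k + 1))) powr ((real k + 1) / (2 * real k)))"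
    if n: "n \<ge> 1" and Ps: "distinct Ps" "set Ps = local_paulis k n" for n \<alpha> Ps
  proof -
    interpret problem k n \<alpha> Ps using assms n Ps by unfold_locales
    obtain p where p: "outcome (T n) (main_prog k) (input_store n Ps \<alpha>) p"
      "\<forall>s\<in>set_pmf p. \<forall>i<n. output_qubit s i \<bullet>c output_qubit s i = 1"
      "opt_const k * (\<Sum>P\<in>local_paulis k n - {replicate n PI}.
        \<bar>\<alpha> P\<bar> powr (2 * real k / (real k + 1))) powr ((real k + 1) / (2 * real k)) \<le>
       \<bar>measure_pmf.expectation p (\<lambda>s. energy (hamiltonian k n \<alpha>) (output_state n s)) - \<alpha> (replicate n PI)\<bar>"
      using main_correct unfolding T_def K_def by blast
    then show ?thesis
      using outcome_halts[OF p(1)] haar_average by auto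
  qed
  ultimately show ?thesis by (intro exI[of _ "main_prog k"] exI[of _ T]) blast
qed

end
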